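(* Let $\Delta$ be a positive integer and let $T_\Delta=\langle 2\Delta\rangle\perp U\perp\langle -2\rangle^2$ (over $\mathbb{Q}$) carry a polarized weight 2 Hodge structure with Hodge numbers $(1,3,1)$; let $A(T_\Delta)$ be its associated Kuga-Satake variety. Let $A_\Delta$ be any Abelian fourfold (principally polarized, with multiplication by $\mathbb{Z}[\mathrm{i}]$ of type $(2,2)$) whose moduli point lies on the hypersurface $D_\Delta$ of the moduli space $\mathbf{M}$, say on the image of $\mathbf{y}^\perp$, and such that the rational sub-Hodge structure $\mathbf{y}^\perp\subset T(A_\Delta)$ is isomorphic to $T_\Delta$ as a polarized $\mathbb{Q}$-Hodge structure. Then there is an isogeny $$A(T_\Delta)\sim A_\Delta^2,\qquad\text{and}\qquad (-1,\Delta)_{\mathbb{Q}}\subset\mathrm{End}_{\mathbb{Q}}(A_\Delta).$$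
   Context: Lattices: $U$ is the hyperbolic plane, $\langle a\rangle$ the rank one form with generator of square $a$, $\perp$ orthogonal sum. $(a,b)_{\mathbb{Q}}$ is the quaternion algebra with $\mathbf{i}^2=a$, $\mathbf{j}^2=b$, $\mathbf{i}\mathbf{j}=-\mathbf{j}\mathbf{i}$. $\mathrm{End}_{\mathbb{Q}}(A)=\mathrm{End}(A)\otimes\mathbb{Q}$. Abelian fourfolds and $\mathbf{M}$: consider principally polarized Abelian fourfolds $A$ with $\mathbb{Z}[\mathrm{i}]\subset\mathrm{End}(A)$ preserving the polarization, $\mathrm{i}$ acting on the tangent space at $0$ with eigenvalues $\mathrm{i},\mathrm{i},-\mathrm{i},-\mathrm{i}$. Then $H_1(A;\mathbb{Z})\simeq\mathbb{Z}[\mathrm{i}]^4$ with a basis $a_1,a_2,b_1,b_2$ in which the polarization comes from the skew-hermitian form $f$ with Gram matrix $\begin{pmatrix}0&\mathbf{1}_2\\-\mathbf{1}_2&0\end{pmatrix}$. Regard $V=H_1(A;\mathbb{R})$ as a $4$-dimensional complex vector space via the action of $\mathrm{i}\in\mathrm{End}(A)$. The complex structure $J$ of $A$ commutes with this action and is given by a splitting $V=P\perp P^\perp$ into complex $2$-planes, $P$ being positive for $\mathrm{i}f$, $J|_P=\mathrm{i}$, $J|_{P^\perp}=-\mathrm{i}$. The Hodge structure $T(A)$: on the $6$-dimensional complex space $\Lambda^2_{\mathbb{C}}V$ (equivalently on its dual $\Lambda^2_{\mathbb{C}}V^*\subset H^2(A;\mathbb{R})$) there is the hermitian form $g=\Lambda^2f$,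 $g(x\wedge y,z\wedge w)=f(x,z)f(y,w)-f(y,z)f(x,w)$, and the $\mathbb{C}$-antilinear involution $t$ defined by $g(u,v)=-\det(t(v)\wedge u)$, where $\det(a_1\wedge a_2\wedge b_1\wedge b_2)=1$. $T(A)$ is the $(+1)$-eigenspace of $t$; it is a rational Hodge structure of weight 2 with Hodge numbers $(1,4,1)$, polarized by $-g$ of signature $(2,4)$, the extremal Hodge pieces being the lines $\Lambda^2P$ and $\Lambda^2P^\perp$ of $\Lambda^2_{\mathbb{C}}V=T(A)\otimes_{\mathbb{R}}\mathbb{C}$. There is an integral structure $T\simeq U^2\perp\langle-1\rangle^2$ on $T(A)$. With $\mathbf{D}_4$ a connected component of $\{[z]\in\mathbb{P}(T\otimes\mathbb{C}):\langle z,z\rangle=0,\langle z,\bar z\rangle>0\}$ and $\mathrm{SO}^*(T)\subset\mathrm{O}(T)$ the index two subgroup preserving $\mathbf{D}_4$, the assignment $A\mapsto T(A)$ identifies the moduli space of such $A$ with $\mathbf{M}=\mathbf{D}_4/\mathrm{SO}^*(T)$. Divisors $D_\Delta$: in coordinates on $T$ with $\langle x,x\rangle=2(x_1x_2+x_3x_4)-x_5^2-x_6^2$, $D_\Delta\subset\mathbf{M}$ is the image of the hyperplane sections $\mathbf{y}^\perp\cap\mathbf{D}_4$ with $\mathbf{y}=(2y_1,2y_2,2y_3,2y_4,y_5+y_6,y_5-y_6)$, $y_i\in\mathbb{Z}$, $\gcd(y_1,\dots,y_6)=1$, $-\tfrac12\langle\mathbf{y},\mathbf{y}\rangle=\Delta$.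 For such $\mathbf{y}$ the form on $\mathbf{y}^\perp$ is rationally equivalent to $U\perp\langle-2\rangle^2\perp\langle 2\Delta\rangle$. Kuga-Satake variety: let $(V,q)$ be an $n$-dimensional rational vector space with a weight 2 Hodge structure polarized by $q$ with $h^{2,0}=1$. The Clifford algebra $\mathrm{Cl}(V)$ is the tensor algebra modulo $x\otimes x-q(x,x)$, with even part $\mathrm{Cl}^+(V)$. $V^{2,0}\oplus V^{0,2}$ is the complexification of a real plane $W$ on which $q$ is definite; choose an oriented basis $f_1,f_2$ of $W$, orthonormal up to the sign of $q|_W$. Left multiplication by $f_1f_2$ is a complex structure on $\mathrm{Cl}^+(V)\otimes\mathbb{R}$, defining a weight one Hodge structure on $\mathrm{Cl}^+(V)$ (the $\pm\mathrm{i}$-eigenspaces being $H^{1,0},H^{0,1}$), polarized by $(x,y)\mapsto\mathrm{Tr}(\epsilon\,\iota(x)y)$, where $\iota$ is the canonical anti-involution reversing products of vectors, $\epsilon\in\mathrm{Cl}^+(V)$ satisfies $\iota(\epsilon)=-\epsilon$, and $\mathrm{Tr}$ is the trace of left multiplication. $A(V,q)$ is the resulting Abelian variety of dimension $2^{n-2}$ (the dual of $\mathrm{Cl}^+(V)\otimes\mathbb{R}$ modulo a lattice), well defined up to isogeny. The orientation of $W$ is fixed by the Hodge structure through one fixed convention (either always $f_1+\mathrm{i}f_2\in V^{2,0}$ or always $f_1+\mathrm{i}f_2\in V^{0,2}$; the two choices give complex conjugate varieties); the convention is taken compatible with the assignment $A\mapsto T(A)$, i.e. so that $A$ rather than its complex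 conjugate is recovered from $T(A)$. *)

theory Defs
  imports
    "HOL-Analysis.Analysis"
    "HOL-Algebra.QuotRing"
    "HOL-Library.Poly_Mapping"
    "HOL-Library.Function_Algebras"
begin

section \<open>Rational quadratic spaces and Hodge structures of weight two\<close>

text \<open>
  A rational quadratic space is \<open>rat ^ 'n\<close> with a Gram matrix \<open>G\<close>. The same Gram matrix gives the
  bilinear extension of the form to the real and complex scalar extensions.
\<close>

definition gram_form :: "rat^'n^'n \<Rightarrow> 'a::field_char_0^'n \<Rightarrow> 'a^'n \<Rightarrow> 'a" where
  "gram_form G x y = (\<Sum>i\<in>UNIV. \<Sum>j\<in>UNIV. of_rat (G $ i $ j) * (x $ i) * (y $ j))"

definition vmap :: "('a \<Rightarrow> 'b) \<Rightarrow> 'a^'n \<Rightarrow> 'b^'n" where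
  "vmap h x = (\<chi> i. h (x $ i))"

text \<open>\<open>H p\<close> stands for $V^{p,2-p}$, a complex subspace of \<open>complex ^ 'n\<close>; only \<open>p \<le> 2\<close> matters.\<close>

definition weight2_hodge_structure :: "(nat \<Rightarrow> (complex^'n) set) \<Rightarrow> bool" where
  "weight2_hodge_structure H \<longleftrightarrow>
     (\<forall>p\<le>2. vec.subspace (H p)) \<and>
     (\<forall>v. \<exists>!(a, b, c). a \<in> H 2 \<and> b \<in> H 1 \<and> c \<in> H 0 \<and> v = a + b + c) \<and>
     (\<forall>p\<le>2. vmap cnj ` H p = H (2 - p))"

definition hodge_numbers :: "(nat \<Rightarrow> (complex^'n) set) \<Rightarrow> nat \<times> nat \<times> nat" where
  "hodge_numbers H = (vec.dim (H 2), vec.dim (H 1), vec.dim (H 0))"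

text \<open>
  The sign is normalised so that a polarization is positive on the real plane underlying
  $V^{2,0} \oplus V^{0,2}$ and negative on the real points of $V^{1,1}$.
\<close>

definition weight2_polarization :: "rat^'n^'n \<Rightarrow> (nat \<Rightarrow> (complex^'n) set) \<Rightarrow> bool" where
  "weight2_polarization G H \<longleftrightarrow>
     transpose G = G \<and>
     (\<forall>p\<le>2. \<forall>r\<le>2. p + r \<noteq> 2 \<longrightarrow> (\<forall>x\<in>H p. \<forall>y\<in>H r. gram_form G x y = 0)) \<and>
     (\<forall>p\<le>2. \<forall>x\<in>H p. x \<noteq> 0 \<longrightarrow> (-1) ^ p * Re (gram_form G x (vmap cnj x)) > 0)"

text \<open>
  \<open>M\<close> is an isomorphism of polarized rational Hodge structures from \<open>(rat ^ 'n, G, H)\<close> onto the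
  sub-Hodge structure with underlying rational space \<open>S\<close> of \<open>(rat ^ 'm, G', H')\<close>. The Hodge pieces
  of the latter are the intersections of the \<open>H' p\<close> with the complexification of \<open>S\<close>.
\<close>

definition polarized_hodge_iso_onto ::
  "rat^'n^'m \<Rightarrow> rat^'n^'n \<Rightarrow> (nat \<Rightarrow> (complex^'n) set) \<Rightarrow>
   rat^'m^'m \<Rightarrow> (nat \<Rightarrow> (complex^'m) set) \<Rightarrow> (rat^'m) set \<Rightarrow> bool" where
  "polarized_hodge_iso_onto M G H G' H' S \<longleftrightarrow>
     bij_betw ((*v) M) UNIV S \<and>
     (\<forall>x y :: rat^'n. gram_form G' (M *v x) (M *v y) = gram_form G x y) \<and>
     (\<forall>p\<le>2. (*v) (map_matrix of_rat M) ` H p = H' p \<inter> vec.span (vmap of_rat ` S))"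


section \<open>Complex tori, isogenies and endomorphism algebras\<close>

instantiation "fun" :: (type, real_vector) real_vector
begin

definition scaleR_fun :: "real \<Rightarrow> ('a \<Rightarrow> 'b) \<Rightarrow> 'a \<Rightarrow> 'b" where
  "scaleR_fun c h = (\<lambda>x. c *\<^sub>R h x)"

instance
  by standard (auto simp: scaleR_fun_def plus_fun_def fun_eq_iff scaleR_add_right scaleR_add_left)

end

text \<open>
  A complex torus is given by its lattice \<open>lat X = H\<^sub>1(X; \<int>)\<close> and the complex structure on
  \<open>tspace X = H\<^sub>1(X; \<real>)\<close>, the tangent space at the origin. The tangent space may be a proper subspace
  of the ambient type; maps are taken to be linear on the whole type, which is no restriction, and
  are only compared on \<open>tspace X\<close>.
\<close>

record 'v torus =
  lat :: "'v set"
  cstr :: "'v \<Rightarrow> 'v"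

definition tspace :: "('v::real_vector, 'z) torus_scheme \<Rightarrow> 'v set" where
  "tspace X = span (lat X)"

definition int_span :: "'v::real_vector set \<Rightarrow> 'v set" where
  "int_span B = {\<Sum>b\<in>B. of_int (n b) *\<^sub>R b | n. True}"

definition complex_torus :: "'v::real_vector torus \<Rightarrow> bool" where
  "complex_torus X \<longleftrightarrow>
     (\<exists>B. finite B \<and> independent B \<and> lat X = int_span B) \<and>
     linear (cstr X) \<and>
     (\<forall>v\<in>tspace X. cstr X v \<in> tspace X \<and> cstr X (cstr X v) = - v)"

definition torus_hom :: "'v::real_vector torus \<Rightarrow> 'w::real_vector torus \<Rightarrow> ('v \<Rightarrow> 'w) set" where
  "torus_hom X Y =
     {h. linear h \<and> h ` lat X \<subseteq> lat Y \<and> (\<forall>v\<in>tspace X. h (cstr X v) = cstr Y (h v))}"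

text \<open>
  An isogeny is a surjective homomorphism with finite kernel; the kernel of the map induced by \<open>h\<close>
  consists of the classes modulo \<open>lat X\<close> of the vectors sent into \<open>lat Y\<close>.
\<close>

definition isogeny :: "'v::real_vector torus \<Rightarrow> 'w::real_vector torus \<Rightarrow> ('v \<Rightarrow> 'w) \<Rightarrow> bool" where
  "isogeny X Y h \<longleftrightarrow>
     h \<in> torus_hom X Y \<and> h ` tspace X = tspace Y \<and>
     finite ({v \<in> tspace X. h v \<in> lat Y} // {(u, v). u - v \<in> lat X})"

definition isogenous :: "'v::real_vector torus \<Rightarrow> 'w::real_vector torus \<Rightarrow> bool" where
  "isogenous X Y \<longleftrightarrow> (\<exists>h. isogeny X Y h)"

definition torus_prod ::
  "'v::real_vector torus \<Rightarrow> 'w::real_vector torus \<Rightarrow> ('v \<times> 'w) torus" where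
  "torus_prod X Y = \<lparr>lat = lat X \<times> lat Y, cstr = map_prod (cstr X) (cstr Y)\<rparr>"

text \<open>\<open>End(X) \<otimes> \<rat>\<close>, realised inside the real endomorphisms of the tangent space.\<close>

definition torus_End_Q :: "'v::real_vector torus \<Rightarrow> ('v \<Rightarrow> 'v) set" where
  "torus_End_Q X =
     {h. linear h \<and> (\<exists>n::nat. n > 0 \<and> (\<lambda>v. real n *\<^sub>R h v) \<in> torus_hom X X)}"


section \<open>Quaternion algebras\<close>

text \<open>
  \<open>rat ^ 4\<close> with coordinates with respect to 1, i, j, ij, where $i^2 = a$, $j^2 = b$, $ij = -ji$.
\<close>

definition quat_mult :: "rat \<Rightarrow> rat \<Rightarrow> rat^4 \<Rightarrow> rat^4 \<Rightarrow> rat^4" where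
  "quat_mult a b x y = vector
     [x$1 * y$1 + a * x$2 * y$2 + b * x$3 * y$3 - a * b * x$4 * y$4,
      x$1 * y$2 + x$2 * y$1 - b * x$3 * y$4 + b * x$4 * y$3,
      x$1 * y$3 + x$3 * y$1 + a * x$2 * y$4 - a * x$4 * y$2,
      x$1 * y$4 + x$4 * y$1 + x$2 * y$3 - x$3 * y$2]"

definition quaternion_embeds_End_Q :: "rat \<Rightarrow> rat \<Rightarrow> 'v::real_vector torus \<Rightarrow> bool" where
  "quaternion_embeds_End_Q a b X \<longleftrightarrow>
     (\<exists>\<Psi>. (\<forall>x. \<Psi> x \<in> torus_End_Q X) \<and>
       (\<forall>v\<in>tspace X.
          \<Psi> (axis 1 1) v = v \<and>
          (\<forall>x y. \<Psi> (x + y) v = \<Psi> x v + \<Psi> y v) \<and>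
          (\<forall>c x. \<Psi> (c *s x) v = of_rat c *\<^sub>R \<Psi> x v) \<and>
          (\<forall>x y. \<Psi> (quat_mult a b x y) v = \<Psi> x (\<Psi> y v))) \<and>
       (\<forall>x. (\<forall>v\<in>tspace X. \<Psi> x v = 0) \<longrightarrow> x = 0))"


section \<open>Clifford algebras\<close>

text \<open>
  The tensor algebra of \<open>real ^ 'n\<close> is the free algebra on the standard basis: the monoid algebra of
  the words in \<open>'n\<close>, words being added by concatenation.
\<close>

datatype 'n tword = TWord (letters: "'n list")

instantiation tword :: (type) monoid_add
begin

definition zero_tword :: "'a tword" where "0 = TWord []"
definition plus_tword :: "'a tword \<Rightarrow> 'a tword \<Rightarrow> 'a tword" where
  "u + v = TWord (letters u @ letters v)"

instance
  by standard (auto simp: zero_tword_def plus_tword_def)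

end

type_synonym 'n tensor = "'n tword \<Rightarrow>\<^sub>0 real"

definition tensor_ring :: "'n tensor ring" where
  "tensor_ring = \<lparr>carrier = UNIV, mult = (*), one = 1, zero = 0, add = (+)\<rparr>"

definition tensor_const :: "real \<Rightarrow> 'n tensor" where
  "tensor_const c = Poly_Mapping.single 0 c"

definition tensor_vec :: "real^'n \<Rightarrow> 'n tensor" where
  "tensor_vec x = (\<Sum>i\<in>UNIV. Poly_Mapping.single (TWord [i]) (x $ i))"

definition tensor_even :: "'n tensor set" where
  "tensor_even = {u. \<forall>w\<in>Poly_Mapping.keys u. even (length (letters w))}"

definition tensor_rational :: "'n tensor set" where
  "tensor_rational = {u. \<forall>w. Poly_Mapping.lookup u w \<in> \<rat>}"

definition clifford_ideal :: "rat^'n^'n \<Rightarrow> 'n tensor set" where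
  "clifford_ideal G =
     Idl\<^bsub>tensor_ring\<^esub> {tensor_vec x * tensor_vec x - tensor_const (gram_form G x x) | x. True}"

text \<open>\<open>clifford_ring G\<close> is the Clifford algebra of \<open>real ^ 'n\<close>, that is, $\mathrm{Cl}(V)\otimes\mathbb{R}$.\<close>

definition clifford_ring :: "rat^'n^'n \<Rightarrow> 'n tensor set ring" where
  "clifford_ring G = tensor_ring Quot clifford_ideal G"

definition clifford_class :: "rat^'n^'n \<Rightarrow> 'n tensor \<Rightarrow> 'n tensor set" where
  "clifford_class G u = clifford_ideal G +>\<^bsub>tensor_ring\<^esub> u"

definition clifford_even :: "rat^'n^'n \<Rightarrow> 'n tensor set set" where
  "clifford_even G = clifford_class G ` tensor_even"

text \<open>The rational even Clifford algebra inside its real scalar extension.\<close>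

definition clifford_even_rational :: "rat^'n^'n \<Rightarrow> 'n tensor set set" where
  "clifford_even_rational G = clifford_class G ` (tensor_even \<inter> tensor_rational)"

text \<open>The real linear functionals on the even part (set to 0 outside of it).\<close>

definition clifford_even_dual :: "rat^'n^'n \<Rightarrow> ('n tensor set \<Rightarrow> real) set" where
  "clifford_even_dual G = {\<phi>.
     (\<forall>x. x \<notin> clifford_even G \<longrightarrow> \<phi> x = 0) \<and>
     (\<forall>x\<in>clifford_even G. \<forall>y\<in>clifford_even G. \<phi> (x \<oplus>\<^bsub>clifford_ring G\<^esub> y) = \<phi> x + \<phi> y) \<and>
     (\<forall>c. \<forall>x\<in>clifford_even G.
        \<phi> (clifford_class G (tensor_const c) \<otimes>\<^bsub>clifford_ring G\<^esub> x) = c * \<phi> x)}"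


section \<open>The Kuga-Satake variety\<close>

text \<open>
  \<open>kuga_satake G H K\<close>: the torus \<open>K\<close> is a Kuga-Satake variety of the polarized Hodge structure
  \<open>(rat ^ 'n, G, H)\<close>. Left multiplication by \<open>f\<^sub>1 f\<^sub>2\<close> gives the weight one Hodge structure
  \<open>Cl\<^sup>+ = H\<^sup>1(K)\<close>; the space \<open>H\<^sub>1(K; \<real>)\<close> is the dual of \<open>Cl\<^sup>+ \<otimes> \<real>\<close> with the transposed complex
  structure, and the lattice is any lattice of functionals with rational values on \<open>Cl\<^sup>+(V)\<close>. The
  choice of the lattice only affects \<open>K\<close> up to isogeny, and the polarization of \<open>K\<close> by
  \<open>(x, y) \<mapsto> Tr(\<epsilon> \<iota>(x) y)\<close> plays no role in its isogeny class.

  Orientation: $f_1 + i f_2 \in V^{0,2}$. With the Hodge structure on \<open>T(A)\<close> normalised by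
  $T(A)^{2,0} = \Lambda^2 P$ (see \<open>wedge_hodge\<close> below) this is the choice for which \<open>A\<close> rather than
  its complex conjugate is recovered: for $z = f_1 + i f_2 \in \Lambda^2 P$ the product \<open>f\<^sub>1 f\<^sub>2\<close> acts as
  the complex structure \<open>J\<close> in the spin representation of \<open>Cl\<^sup>+(T(A))\<close> on \<open>H\<^sub>1(A)\<close>, hence as the
  transpose of \<open>J\<close> on its dual, which is isomorphic to \<open>(H\<^sub>1(A), -J)\<close> by the polarization.
\<close>

definition kuga_satake ::
  "rat^'n^'n \<Rightarrow> (nat \<Rightarrow> (complex^'n) set) \<Rightarrow> ('n tensor set \<Rightarrow> real) torus \<Rightarrow> bool" where
  "kuga_satake G H K \<longleftrightarrow>
     (\<exists>(f\<^sub>1 :: real^'n) (f\<^sub>2 :: real^'n) s.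
        s \<in> {1, -1} \<and> gram_form G f\<^sub>1 f\<^sub>1 = s \<and> gram_form G f\<^sub>2 f\<^sub>2 = s \<and> gram_form G f\<^sub>1 f\<^sub>2 = 0 \<and>
        (\<chi> k. Complex (f\<^sub>1 $ k) (f\<^sub>2 $ k)) \<in> H 0 \<and>
        cstr K = (\<lambda>\<phi> x.
          if x \<in> clifford_even G
          then \<phi> (clifford_class G (tensor_vec f\<^sub>1 * tensor_vec f\<^sub>2) \<otimes>\<^bsub>clifford_ring G\<^esub> x)
          else 0)) \<and>
     complex_torus K \<and>
     tspace K = clifford_even_dual G \<and>
     (\<forall>\<phi>\<in>lat K. \<forall>x\<in>clifford_even_rational G. \<phi> x \<in> \<rat>)"


section \<open>Abelian fourfolds with multiplication by the Gaussian integers\<close>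

definition principal_polarization :: "'v::real_vector torus \<Rightarrow> ('v \<Rightarrow> 'v \<Rightarrow> real) \<Rightarrow> bool" where
  "principal_polarization X E \<longleftrightarrow>
     bilinear E \<and>
     (\<forall>v\<in>tspace X. E v v = 0) \<and>
     (\<forall>v\<in>tspace X. \<forall>w\<in>tspace X. E (cstr X v) (cstr X w) = E v w) \<and>
     (\<forall>v\<in>tspace X. v \<noteq> 0 \<longrightarrow> E (cstr X v) v > 0) \<and>
     {v \<in> tspace X. \<forall>w\<in>lat X. E v w \<in> \<int>} = lat X"

text \<open>
  The sign \<open>E(Jv, v) > 0\<close> is the one for which $\mathrm{i}f$ is positive on the plane \<open>P\<close> below when
  \<open>E = Re f\<close>.

  The endomorphism \<open>\<iota>\<close> is multiplication by $\mathrm{i} \in \mathbb{Z}[\mathrm{i}]$. Its eigenspaces on the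
  complex tangent space \<open>(tspace X, cstr X)\<close> are complex planes, that is, of real dimension four.
\<close>

definition gaussian_ppav4 ::
  "'v::real_vector torus \<Rightarrow> ('v \<Rightarrow> 'v \<Rightarrow> real) \<Rightarrow> ('v \<Rightarrow> 'v) \<Rightarrow> bool" where
  "gaussian_ppav4 X E \<iota> \<longleftrightarrow>
     complex_torus X \<and> dim (tspace X) = 8 \<and> principal_polarization X E \<and>
     \<iota> \<in> torus_hom X X \<and>
     (\<forall>v\<in>tspace X. \<iota> (\<iota> v) = - v) \<and>
     (\<forall>v\<in>tspace X. \<forall>w\<in>tspace X. E (\<iota> v) (\<iota> w) = E v w) \<and>
     dim {v \<in> tspace X. \<iota> v = cstr X v} = 4 \<and>
     dim {v \<in> tspace X. \<iota> v = - cstr X v} = 4"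

text \<open>
  The skew-hermitian form \<open>f\<close> on \<open>complex ^ 4\<close> with basis \<open>a\<^sub>1, a\<^sub>2, b\<^sub>1, b\<^sub>2\<close>, linear in the first
  argument.
\<close>

definition skew_form :: "complex^4 \<Rightarrow> complex^4 \<Rightarrow> complex" where
  "skew_form x y = x$1 * cnj (y$3) + x$2 * cnj (y$4) - x$3 * cnj (y$1) - x$4 * cnj (y$2)"

definition gaussian_lattice :: "(complex^4) set" where
  "gaussian_lattice = {c. \<forall>k. Re (c $ k) \<in> \<int> \<and> Im (c $ k) \<in> \<int>}"

text \<open>
  For \<open>\<beta> = (a\<^sub>1, a\<^sub>2, b\<^sub>1, b\<^sub>2)\<close>, the map from \<open>complex ^ 4\<close> to \<open>V = H\<^sub>1(X; \<real>)\<close> with the complex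
  structure \<open>\<iota>\<close>.
\<close>

definition gaussian_comb :: "('v::real_vector \<Rightarrow> 'v) \<Rightarrow> 'v^4 \<Rightarrow> complex^4 \<Rightarrow> 'v" where
  "gaussian_comb \<iota> \<beta> c = (\<Sum>k\<in>UNIV. Re (c $ k) *\<^sub>R \<beta> $ k + Im (c $ k) *\<^sub>R \<iota> (\<beta> $ k))"

definition adapted_basis ::
  "'v::real_vector torus \<Rightarrow> ('v \<Rightarrow> 'v \<Rightarrow> real) \<Rightarrow> ('v \<Rightarrow> 'v) \<Rightarrow> 'v^4 \<Rightarrow> bool" where
  "adapted_basis X E \<iota> \<beta> \<longleftrightarrow>
     bij_betw (gaussian_comb \<iota> \<beta>) gaussian_lattice (lat X) \<and>
     (\<forall>c d. E (gaussian_comb \<iota> \<beta> c) (gaussian_comb \<iota> \<beta> d) = Re (skew_form c d))"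

text \<open>The plane \<open>P\<close> on which the complex structure of \<open>X\<close> coincides with \<open>\<iota>\<close>.\<close>

definition period_plane ::
  "'v::real_vector torus \<Rightarrow> ('v \<Rightarrow> 'v) \<Rightarrow> 'v^4 \<Rightarrow> (complex^4) set" where
  "period_plane X \<iota> \<beta> = {c. cstr X (gaussian_comb \<iota> \<beta> c) = \<iota> (gaussian_comb \<iota> \<beta> c)}"

definition skew_perp :: "(complex^4) set \<Rightarrow> (complex^4) set" where
  "skew_perp P = {c. \<forall>d\<in>P. skew_form c d = 0}"


section \<open>The Hodge structure \<open>T(A)\<close>\<close>

text \<open>
  $\Lambda^2_{\mathbb{C}} V$ in the basis \<open>a\<^sub>1\<and>a\<^sub>2, b\<^sub>1\<and>b\<^sub>2, a\<^sub>1\<and>b\<^sub>2, a\<^sub>2\<and>b\<^sub>1, a\<^sub>1\<and>b\<^sub>1, a\<^sub>2\<and>b\<^sub>2\<close>. Note that the index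
  6 of the type 6 is 0.
\<close>

definition wedge :: "complex^4 \<Rightarrow> complex^4 \<Rightarrow> complex^6" where
  "wedge x y = vector
     [x$1 * y$2 - x$2 * y$1, x$3 * y$4 - x$4 * y$3, x$1 * y$4 - x$4 * y$1,
      x$2 * y$3 - x$3 * y$2, x$1 * y$3 - x$3 * y$1, x$2 * y$4 - x$4 * y$2]"

text \<open>The hermitian form \<open>g\<close>, the form $\det(u \wedge v)$ and the involution \<open>t\<close> in this basis.\<close>

definition wedge_g :: "complex^6 \<Rightarrow> complex^6 \<Rightarrow> complex" where
  "wedge_g u v = u$1 * cnj (v$2) + u$2 * cnj (v$1) + u$3 * cnj (v$4) + u$4 * cnj (v$3)
     + u$5 * cnj (v$5) + u$6 * cnj (v$6)"

definition wedge_det :: "complex^6 \<Rightarrow> complex^6 \<Rightarrow> complex" where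
  "wedge_det u v = u$1 * v$2 + u$2 * v$1 + u$3 * v$4 + u$4 * v$3 - u$5 * v$6 - u$6 * v$5"

definition wedge_t :: "complex^6 \<Rightarrow> complex^6" where
  "wedge_t v = vector
     [- cnj (v$1), - cnj (v$2), - cnj (v$3), - cnj (v$4), cnj (v$6), cnj (v$5)]"

definition wedge_span :: "(complex^4) set \<Rightarrow> (complex^4) set \<Rightarrow> (complex^6) set" where
  "wedge_span P Q = vec.span {wedge x y | x y. x \<in> P \<and> y \<in> Q}"

definition wedge_hodge :: "(complex^4) set \<Rightarrow> nat \<Rightarrow> (complex^6) set" where
  "wedge_hodge P p =
     (if p = 2 then wedge_span P P
      else if p = 1 then wedge_span P (skew_perp P)
      else wedge_span (skew_perp P) (skew_perp P))"

text \<open>The lattice \<open>T = U\<^sup>2 \<bottom> \<langle>-1\<rangle>\<^sup>2\<close>.\<close>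

definition T_gram :: "rat^6^6" where
  "T_gram = vector
     [vector [0, 1, 0, 0, 0, 0],
      vector [1, 0, 0, 0, 0, 0],
      vector [0, 0, 0, 1, 0, 0],
      vector [0, 0, 1, 0, 0, 0],
      vector [0, 0, 0, 0, -1, 0],
      vector [0, 0, 0, 0, 0, -1]]"

text \<open>
  The complex linear extension of the isometry from \<open>T \<otimes> \<real>\<close> to \<open>(T(A), -g)\<close> that defines the integral
  structure on \<open>T(A)\<close>. The points with \<open>x\<^sub>5 \<equiv> x\<^sub>6 (mod 2)\<close> of \<open>T\<close>, which form the even sublattice,
  correspond to \<open>T(A) \<inter> \<Lambda>\<^sup>2 \<int>[i]\<^sup>4\<close>, and \<open>T\<close> is its unique integral overlattice.
\<close>

definition T_iso :: "complex^6 \<Rightarrow> complex^6" where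
  "T_iso z = vector
     [\<i> * z$1, - \<i> * z$2, \<i> * z$3, - \<i> * z$4, (z$5 + \<i> * z$6) / (1 + \<i>), (z$5 - \<i> * z$6) / (1 - \<i>)]"

lemma exhaust_6: "x = 1 \<or> x = 2 \<or> x = 3 \<or> x = 4 \<or> x = 5 \<or> x = 6" for x :: 6
proof (induct x)
  case (of_int z)
  then have "z = 0 \<or> z = 1 \<or> z = 2 \<or> z = 3 \<or> z = 4 \<or> z = 5" by fastforce
  then show ?case by auto
qed

lemma UNIV_6: "UNIV = {1, 2, 3, 4, 5, 6::6}"
  using exhaust_6 by auto

lemma forall_6: "(\<forall>i::6. P i) \<longleftrightarrow> P 1 \<and> P 2 \<and> P 3 \<and> P 4 \<and> P 5 \<and> P 6"
  by (metis exhaust_6)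

lemma sum_6: "sum h (UNIV::6 set) = h 1 + h 2 + h 3 + h 4 + h 5 + h 6"
  unfolding UNIV_6 by (simp add: ac_simps)

lemma vector_6 [simp]:
  "(vector [a, b, c, d, e, f] :: 'a::zero^6) $ 1 = a"
  "(vector [a, b, c, d, e, f] :: 'a::zero^6) $ 2 = b"
  "(vector [a, b, c, d, e, f] :: 'a::zero^6) $ 3 = c"
  "(vector [a, b, c, d, e, f] :: 'a::zero^6) $ 4 = d"
  "(vector [a, b, c, d, e, f] :: 'a::zero^6) $ 5 = e"
  "(vector [a, b, c, d, e, f] :: 'a::zero^6) $ 6 = f"
  "(vector [a, b, c, d, e, f] :: 'a::zero^6) $ 0 = f"
  unfolding vector_def by simp_all

lemma wedge_g_wedge:
  "wedge_g (wedge x y) (wedge z w) =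
     skew_form x z * skew_form y w - skew_form y z * skew_form x w"
  by (simp add: wedge_g_def wedge_def skew_form_def algebra_simps)

lemma vector_4_components:
  "(vector [a, b, c, d] :: 'a::zero^4) $ 1 = a" "(vector [a, b, c, d] :: 'a::zero^4) $ 2 = b"
  "(vector [a, b, c, d] :: 'a::zero^4) $ 3 = c" "(vector [a, b, c, d] :: 'a::zero^4) $ 4 = d"
  unfolding vector_def by simp_all

lemma wedge_det_wedge: "wedge_det (wedge x y) (wedge z w) = det (vector [x, y, z, w] :: complex^4^4)"
proof -
  have f: "finite {2::4, 3, 4}" "1 \<notin> {2::4, 3, 4}" "finite {3::4, 4}" "2 \<notin> {3::4, 4}"
    "finite {4::4}" "3 \<notin> {4::4}"
    by auto
  show ?thesis
    unfolding det_def UNIV_4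
    unfolding sum_over_permutations_insert[OF f(1,2)] sum_over_permutations_insert[OF f(3,4)]
      sum_over_permutations_insert[OF f(5,6)] permutes_sing
    by (simp add: sign_swap_id permutation_swap_id sign_compose permutation_compose sign_id
        Transposition.transpose_def vector_4_components wedge_det_def wedge_def algebra_simps)
qed

lemma wedge_g_eq_wedge_det: "wedge_g u v = - wedge_det (wedge_t v) u"
  by (simp add: wedge_g_def wedge_det_def wedge_t_def algebra_simps)

lemma wedge_t_T_iso: "wedge_t (T_iso z) = T_iso (vmap cnj z)"
  by (simp add: vec_eq_iff forall_6 wedge_t_def T_iso_def vmap_def)

lemma wedge_g_T_iso: "- wedge_g (T_iso x) (T_iso y) = gram_form T_gram x (vmap cnj y)"
proof -
  have "(x + \<i> * y) / (1 + \<i>) * cnj ((z + \<i> * w) / (1 + \<i>))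
      + (x - \<i> * y) / (1 - \<i>) * cnj ((z - \<i> * w) / (1 - \<i>)) = x * cnj z + y * cnj w"
    for x y z w
  proof -
    have *: "(1 + \<i>) * (1 - \<i>) = 2" by (simp add: algebra_simps)
    have "(x + \<i> * y) / (1 + \<i>) * cnj ((z + \<i> * w) / (1 + \<i>)) =
        (x + \<i> * y) * (cnj z - \<i> * cnj w) / 2"
      using * by (simp add: mult.commute)
    moreover have "(x - \<i> * y) / (1 - \<i>) * cnj ((z - \<i> * w) / (1 - \<i>)) =
        (x - \<i> * y) * (cnj z + \<i> * cnj w) / 2"
      using * by (simp add: mult.commute)
    ultimately show ?thesis by (simp add: field_simps)
  qed
  note eq = this[of "x$5" "x$6" "y$5" "y$6"]
  have "wedge_g (T_iso x) (T_iso y) =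
      - (x$1 * cnj (y$2)) - x$2 * cnj (y$1) - x$3 * cnj (y$4) - x$4 * cnj (y$3)
      + (x$5 * cnj (y$5) + x$6 * cnj (y$6))"
    unfolding wedge_g_def eq[symmetric] T_iso_def by (simp add: algebra_simps)
  then show ?thesis
    by (simp add: gram_form_def sum_6 T_gram_def vmap_def algebra_simps)
qed


section \<open>The moduli space \<open>D\<^sub>4 / SO\<^sup>*(T)\<close> and the hypersurfaces \<open>D\<^sub>\<Delta>\<close>\<close>

text \<open>
  The affine cone over the two components of the period domain, one of which is \<open>D\<^sub>4\<close>. Its connected
  components are the cones over those of the domain. An isometry of \<open>T\<close> preserves \<open>D\<^sub>4\<close> if and only
  if it preserves both.
\<close>

definition period_cone :: "(complex^6) set" where
  "period_cone = {z. gram_form T_gram z z = 0 \<and> Re (gram_form T_gram z (vmap cnj z)) > 0}"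

definition SO_star_T :: "(int^6^6) set" where
  "SO_star_T = {\<sigma>.
     (\<forall>x y :: rat^6. gram_form T_gram (map_matrix of_int \<sigma> *v x) (map_matrix of_int \<sigma> *v y)
        = gram_form T_gram x y) \<and>
     (\<forall>D\<in>components period_cone. (*v) (map_matrix of_int \<sigma>) ` D = D)}"

text \<open>The vectors \<open>(2y\<^sub>1, 2y\<^sub>2, 2y\<^sub>3, 2y\<^sub>4, y\<^sub>5 + y\<^sub>6, y\<^sub>5 - y\<^sub>6)\<close> defining \<open>D\<^sub>\<Delta>\<close>.\<close>

definition divisor_vectors :: "nat \<Rightarrow> (rat^6) set" where
  "divisor_vectors \<Delta> =
     {w. \<exists>y :: int^6. Gcd (range (($) y)) = 1 \<and>
        w = vmap of_int
          (vector [2 * y$1, 2 * y$2, 2 * y$3, 2 * y$4, y$5 + y$6, y$5 - y$6] :: int^6) \<and>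
        - (1 / 2) * gram_form T_gram w w = of_nat \<Delta>}"

text \<open>
  The Hodge structure of \<open>A\<close> transported to \<open>T\<close> by the identification of \<open>T\<close> with the integral
  structure of \<open>T(A)\<close> given by the adapted basis \<open>\<beta>\<close> and changed by \<open>\<sigma> \<in> SO\<^sup>*(T)\<close>. As \<open>\<sigma>\<close> varies,
  \<open>T_hodge X \<iota> \<beta> \<sigma> 2\<close> runs through the points of \<open>D\<^sub>4\<close> over the moduli point of \<open>A\<close>.
\<close>

definition T_hodge ::
  "'v::real_vector torus \<Rightarrow> ('v \<Rightarrow> 'v) \<Rightarrow> 'v^4 \<Rightarrow> int^6^6 \<Rightarrow> nat \<Rightarrow> (complex^6) set" where
  "T_hodge X \<iota> \<beta> \<sigma> p =
     {z. T_iso (map_matrix of_int \<sigma> *v z) \<in> wedge_hodge (period_plane X \<iota> \<beta>) p}"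

definition T_perp :: "rat^6 \<Rightarrow> (rat^6) set" where
  "T_perp w = {x. gram_form T_gram w x = 0}"

text \<open>The form \<open>\<langle>2\<Delta>\<rangle> \<bottom> U \<bottom> \<langle>-2\<rangle>\<^sup>2\<close>.\<close>

definition T_Delta_gram :: "nat \<Rightarrow> rat^5^5" where
  "T_Delta_gram \<Delta> = vector
     [vector [2 * of_nat \<Delta>, 0, 0, 0, 0],
      vector [0, 0, 1, 0, 0],
      vector [0, 1, 0, 0, 0],
      vector [0, 0, 0, -2, 0],
      vector [0, 0, 0, 0, -2]]"

end

theory Submission
  imports Defs
begin

text \<open>
  A bivector \<open>u\<close> acts on \<open>V = H\<^sub>1(A)\<close> through the form \<open>f\<close> by an antilinear operator, and for \<open>u\<close> in \<open>T(A)\<close>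
  the square of this operator is the scalar \<open>- q(u) / 2\<close>. Hence even products of vectors give the spin
  representation of the even Clifford algebra of \<open>T(A)\<close> on \<open>V\<close>. If \<open>f\<^sub>1 + \<i> f\<^sub>2\<close> lies in
  $\Lambda^2 P^\perp$, its operator kills \<open>P\<close>, so \<open>f\<^sub>1 f\<^sub>2\<close> acts as \<open>- J\<close> on \<open>P\<close>. The operator of \<open>y\<close>
  commutes with \<open>f\<^sub>1 f\<^sub>2\<close>, has square \<open>\<Delta>\<close> and, as \<open>y\<close> is orthogonal to $\Lambda^2 P$, exchanges \<open>P\<close> and its
  orthogonal complement; therefore \<open>f\<^sub>1 f\<^sub>2\<close> acts as \<open>- J\<close> everywhere. The operator of \<open>y\<close> then commutes
  with \<open>J\<close> and generates the quaternion algebra together with \<open>\<i>\<close>.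

  The even Clifford algebra of $y^\perp$ has dimension 16. It is mapped bijectively onto $V^2$ by its
  action on a pair of rational spinors, and with the polarization of \<open>A\<close> the transpose of this map is an
  isomorphism from $V^2$ to the dual of the even Clifford algebra. It carries \<open>J\<close> to the
  transpose of the multiplication by \<open>f\<^sub>1 f\<^sub>2\<close>. A multiple of its inverse is the isogeny.
\<close>

section \<open>Quadratic forms\<close>

text \<open>The real dimension of V is 8 and that of the even Clifford algebra is 16: this is why
  two spinors are needed and why the square of the fourfold appears. The dimension of the Clifford
  algebra is not presupposed. Reordering of words shows that sixteen even words span it, and their
  independence is read off from the action on the pair of spinors. The pair cannot be arbitrary. The
  even words in \<open>c\<^sub>1\<close>, \<open>c\<^sub>4\<close>, \<open>c\<^sub>5\<close> have
  zero divisors over the reals, since \<open>c\<^sub>1 c\<^sub>4\<close> has the positive square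
  \<Delta>, so a nonzero spinor may well satisfy relations. The isotropic vectors of U and the
  normal vector y single out spinors without relations. Both conditions are linear over the
  rationals, hence such spinors exist among the rational vectors, and rationality is what makes the
  lattices commensurable.\<close>

lemma complex_of_rat: "complex_of_rat r = complex_of_real (of_rat r)"
  by (cases r) (simp add: of_rat_rat)

lemma gram_form_add_left: "gram_form G (x + y) z = gram_form G x z + gram_form G y z"
  and gram_form_add_right: "gram_form G z (x + y) = gram_form G z x + gram_form G z y"
  by (simp_all add: gram_form_def algebra_simps sum.distrib)

lemma gram_form_axis: "gram_form G (axis i 1) (axis j 1) = of_rat (G $ i $ j)"
proof -
  have "gram_form G (axis i 1) (axis j 1) =
     (\<Sum>k\<in>UNIV. \<Sum>l\<in>UNIV. if l = j then (if k = i then of_rat (G $ i $ j) else 0) else 0)"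
    unfolding gram_form_def by (intro sum.cong) (auto simp: axis_def)
  then show ?thesis by simp
qed

lemma gram_form_smult: "gram_form G (c *s x) z = c * gram_form G x z"
  "gram_form G x (c *s z) = c * gram_form G x z"
  by (simp_all add: gram_form_def sum_distrib_left mult_ac)

lemma gram_form_sum: "gram_form G (sum u I) z = (\<Sum>i\<in>I. gram_form G (u i) z)"
  "gram_form G z (sum u I) = (\<Sum>i\<in>I. gram_form G z (u i))"
  by (induction I rule: infinite_finite_induct)
     (simp_all add: gram_form_add_left gram_form_add_right, simp_all add: gram_form_def)

lemma gram_form_of_rat:
  "gram_form G (vmap of_rat x) (vmap of_rat z) = of_rat (gram_form G x z)"
  by (simp add: gram_form_def vmap_def of_rat_sum of_rat_mult)

lemma gram_form_commute:
  assumes "transpose G = G"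
  shows "gram_form G x z = gram_form G z x"
proof -
  have "G $ i $ j = G $ j $ i" for i j
    using assms by (metis transpose_def vec_lambda_beta)
  then show ?thesis
    unfolding gram_form_def by (subst sum.swap) (simp add: mult_ac)
qed

lemma map_matrix_of_rat_mult_vec:
  "map_matrix of_rat N *v w = (\<Sum>i\<in>UNIV. w $ i *s vmap of_rat (N *v axis i 1))"
proof -
  have "N *v axis i 1 = (\<chi> j. N $ j $ i)" for i
    by (simp add: vec_eq_iff matrix_vector_mult_def axis_def if_distrib cong: if_cong)
  then show ?thesis
    by (simp add: matrix_mult_sum column_def vmap_def map_matrix_def)
qed

lemma map_matrix_of_rat_vmap:
  "map_matrix of_rat N *v vmap of_rat x = vmap of_rat (N *v x)"
  by (simp add: vec_eq_iff matrix_vector_mult_def map_matrix_def vmap_def of_rat_sum of_rat_mult)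

lemma map_matrix_of_rat_mult:
  "map_matrix of_rat (M ** N) = map_matrix of_rat M ** map_matrix of_rat N"
  by (simp add: vec_eq_iff matrix_matrix_mult_def map_matrix_def of_rat_sum of_rat_mult)

lemma map_matrix_of_int: "map_matrix of_int \<sigma> = map_matrix of_rat (map_matrix of_int \<sigma>)"
  by (simp add: vec_eq_iff map_matrix_def)

text \<open>By the hypothesis at the rational unit vectors, the columns of \<open>N\<close> have
  Gram matrix \<open>G\<close>; bilinearity carries the identity over to the complex vectors in
  which the Hodge pieces live.\<close>

lemma gram_form_isometry:
  fixes G :: "rat^'n^'n" and G' :: "rat^'m^'m" and N :: "rat^'n^'m"
  assumes "\<And>x z :: rat^'n. gram_form G' (N *v x) (N *v z) = gram_form G x z"
  shows "gram_form G' (map_matrix of_rat N *v x) (map_matrix of_rat N *v z) = gram_form G x z"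
proof -
  have "gram_form G' (map_matrix of_rat N *v x) (map_matrix of_rat N *v z) =
      (\<Sum>i\<in>UNIV. \<Sum>j\<in>UNIV. z $ i * (x $ j * of_rat (G $ j $ i)))"
    unfolding map_matrix_of_rat_mult_vec
    by (simp add: gram_form_sum gram_form_smult gram_form_of_rat assms gram_form_axis sum_distrib_left)
  also have "\<dots> = gram_form G x z"
    unfolding gram_form_def by (subst sum.swap) (simp add: mult_ac)
  finally show ?thesis .
qed

lemma T_gram_nondegenerate:
  assumes "\<And>x. gram_form T_gram z x = 0"
  shows "z = 0"
  using assms[of "axis 1 1"] assms[of "axis 2 1"] assms[of "axis 3 1"] assms[of "axis 4 1"]
    assms[of "axis 5 1"] assms[of "axis 6 1"]
  by (simp add: gram_form_def sum_6 T_gram_def axis_def vec_eq_iff forall_6)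

lemma transpose_T_gram: "transpose T_gram = T_gram"
  by (simp add: transpose_def vec_eq_iff forall_6 T_gram_def)

section \<open>Tensors and the Clifford ideal\<close>

abbreviation tensor_word :: "'n list \<Rightarrow> 'n tensor" where
  "tensor_word ws \<equiv> Poly_Mapping.single (TWord ws) 1"

lemma tensor_expansion:
  fixes t :: "'n tensor"
  assumes "finite A" "Poly_Mapping.keys t \<subseteq> A"
  shows "t = (\<Sum>w\<in>A. Poly_Mapping.single w (Poly_Mapping.lookup t w))"
proof (rule poly_mapping_eqI)
  fix w
  have "Poly_Mapping.lookup (\<Sum>w\<in>A. Poly_Mapping.single w (Poly_Mapping.lookup t w)) w =
      (\<Sum>u\<in>A. if u = w then Poly_Mapping.lookup t w else 0)"
    unfolding lookup_sum by (rule sum.cong) (auto simp: lookup_single)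
  also have "\<dots> = Poly_Mapping.lookup t w"
    using assms by (auto simp: in_keys_iff)
  finally show "Poly_Mapping.lookup t w =
    Poly_Mapping.lookup (\<Sum>w\<in>A. Poly_Mapping.single w (Poly_Mapping.lookup t w)) w" by simp
qed

lemma tensor_induct [case_names zero single add]:
  fixes t :: "'n tensor"
  assumes "P 0" "\<And>w c. P (Poly_Mapping.single w c)" "\<And>s t. P s \<Longrightarrow> P t \<Longrightarrow> P (s + t)"
  shows "P t"
proof -
  have "P (\<Sum>w\<in>A. Poly_Mapping.single w (Poly_Mapping.lookup t w))" if "finite A" for A
    using that by induction (auto intro: assms)
  then show ?thesis
    using tensor_expansion[of "Poly_Mapping.keys t" t] by (metis finite_keys order_refl)
qed

lemma tensor_word_Cons: "tensor_word (i # w) = tensor_word [i] * tensor_word w"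
  by (simp add: mult_single plus_tword_def)

lemma tensor_const_simps:
  "tensor_const (c + d) = tensor_const c + tensor_const d"
  "tensor_const (c * d) = tensor_const c * tensor_const d"
  "tensor_const 1 = 1" "tensor_const 0 = 0"
  by (simp_all add: tensor_const_def single_add mult_single flip: single_one)

lemma single_eq_const_word: "Poly_Mapping.single w c = tensor_const c * tensor_word (letters w)"
  by (simp add: tensor_const_def mult_single)

lemma tensor_const_commute: "tensor_const c * t = t * tensor_const c"
  by (induction t rule: tensor_induct) (simp_all add: tensor_const_def mult_single algebra_simps)

text \<open>Scalars act as constants of the algebra, so every ideal is a subspace and the span of
  words together with an ideal can be formed without passing to the quotient.\<close>

interpretation tensor: vector_space "\<lambda>c (t :: 'n tensor). tensor_const c * t"
  by standard (simp_all add: tensor_const_simps algebra_simps)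

lemma tensor_vec_axis: "tensor_vec (axis i 1) = tensor_word [i]"
proof -
  have "(\<Sum>j\<in>UNIV. Poly_Mapping.single (TWord [j]) ((axis i 1 :: real^'a) $ j)) =
      (\<Sum>j\<in>UNIV. if j = i then tensor_word [i] else 0)"
    by (rule sum.cong) (auto simp: axis_def)
  then show ?thesis by (simp add: tensor_vec_def)
qed

lemma tensor_vec_add: "tensor_vec (x + y) = tensor_vec x + tensor_vec y"
  by (simp add: tensor_vec_def single_add sum.distrib)

lemma tensor_even_word: "even (length w) \<Longrightarrow> tensor_word w \<in> tensor_even"
  by (simp add: tensor_even_def)

lemma tensor_even_0: "0 \<in> tensor_even"
  by (simp add: tensor_even_def)

lemma tensor_even_add: "s \<in> tensor_even \<Longrightarrow> t \<in> tensor_even \<Longrightarrow> s + t \<in> tensor_even"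
  using keys_add[of s t] by (auto simp: tensor_even_def)

lemma tensor_even_mult:
  assumes "s \<in> tensor_even" "t \<in> tensor_even"
  shows "s * t \<in> tensor_even"
  using assms keys_mult[of s t] unfolding tensor_even_def by (fastforce simp: plus_tword_def)

lemma tensor_even_const: "tensor_const c \<in> tensor_even"
  by (simp add: tensor_even_def tensor_const_def zero_tword_def)

lemma tensor_even_sum: "(\<And>i. i \<in> A \<Longrightarrow> f i \<in> tensor_even) \<Longrightarrow> sum f A \<in> tensor_even"
  by (induction A rule: infinite_finite_induct) (auto intro: tensor_even_0 tensor_even_add)

lemma tensor_even_vec_mult_vec: "tensor_vec x * tensor_vec y \<in> tensor_even"
  unfolding tensor_vec_def sum_product
  by (intro tensor_even_sum) (simp add: mult_single plus_tword_def tensor_even_def)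

lemma tensor_rational_sum:
  "(\<And>i. i \<in> A \<Longrightarrow> f i \<in> tensor_rational) \<Longrightarrow> sum f A \<in> tensor_rational"
  by (auto simp: tensor_rational_def lookup_sum)

lemma tensor_rational_single: "c \<in> \<rat> \<Longrightarrow> Poly_Mapping.single w c \<in> tensor_rational"
  by (auto simp: tensor_rational_def lookup_single when_def)

text \<open>The universal property of the tensor algebra: operators assigned to the letters extend
  to all tensors. The last letter of a word acts first, so products of tensors become
  composites.\<close>

definition tensor_eval :: "('n \<Rightarrow> 'm \<Rightarrow> 'm) \<Rightarrow> 'n tensor \<Rightarrow> 'm \<Rightarrow> 'm::real_vector" where
  "tensor_eval \<rho> t v =
     (\<Sum>w\<in>Poly_Mapping.keys t. Poly_Mapping.lookup t w *\<^sub>R foldr \<rho> (letters w) v)"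

lemma tensor_eval_superset:
  assumes "finite A" "Poly_Mapping.keys t \<subseteq> A"
  shows "tensor_eval \<rho> t v = (\<Sum>w\<in>A. Poly_Mapping.lookup t w *\<^sub>R foldr \<rho> (letters w) v)"
  unfolding tensor_eval_def using assms
  by (intro sum.mono_neutral_left) (auto simp: in_keys_iff)

lemma tensor_eval_0 [simp]: "tensor_eval \<rho> 0 v = 0"
  by (simp add: tensor_eval_def)

lemma tensor_eval_single:
  "tensor_eval \<rho> (Poly_Mapping.single w c) v = c *\<^sub>R foldr \<rho> (letters w) v"
  by (subst tensor_eval_superset[of "{w}"]) (auto simp: lookup_single)

lemma tensor_eval_const: "tensor_eval \<rho> (tensor_const c) v = c *\<^sub>R v"
  by (simp add: tensor_const_def tensor_eval_single zero_tword_def)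

lemma tensor_eval_add: "tensor_eval \<rho> (s + t) v = tensor_eval \<rho> s v + tensor_eval \<rho> t v"
proof -
  let ?A = "Poly_Mapping.keys s \<union> Poly_Mapping.keys t"
  have "Poly_Mapping.keys (s + t) \<subseteq> ?A" by (rule keys_add)
  then show ?thesis
    by (simp add: tensor_eval_superset[of ?A] lookup_add scaleR_add_left sum.distrib)
qed

lemma tensor_eval_diff: "tensor_eval \<rho> (s - t) v = tensor_eval \<rho> s v - tensor_eval \<rho> t v"
  using tensor_eval_add[of \<rho> "s - t" t v] by simp

lemma tensor_eval_uminus: "tensor_eval \<rho> (- t) v = - tensor_eval \<rho> t v"
  using tensor_eval_diff[of \<rho> 0 t v] by simp

lemma tensor_eval_sum: "tensor_eval \<rho> (sum f A) v = (\<Sum>i\<in>A. tensor_eval \<rho> (f i) v)"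
  by (induction A rule: infinite_finite_induct) (simp_all add: tensor_eval_add)

lemma tensor_eval_vec: "tensor_eval \<rho> (tensor_vec x) v = (\<Sum>i\<in>UNIV. x $ i *\<^sub>R \<rho> i v)"
  by (simp add: tensor_vec_def tensor_eval_sum tensor_eval_single)

lemma linear_foldr:
  assumes "\<And>i. linear (\<rho> i)"
  shows "linear (foldr \<rho> w)"
proof (induction w)
  case Nil
  then show ?case by (simp add: id_def linear_id flip: id_def)
next
  case (Cons i w)
  then show ?case using linear_compose[OF Cons assms[of i]] by (simp add: comp_def)
qed

lemma linear_tensor_eval:
  assumes "\<And>i. linear (\<rho> i)"
  shows "linear (tensor_eval \<rho> t)"
  unfolding tensor_eval_def
  by (intro linear_compose_sum ballI linear_compose_scale_right linear_foldr assms)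

lemma tensor_eval_mult:
  assumes lin: "\<And>i. linear (\<rho> i)"
  shows "tensor_eval \<rho> (s * t) v = tensor_eval \<rho> s (tensor_eval \<rho> t v)"
proof (induction s rule: tensor_induct)
  case (single u c)
  have "tensor_eval \<rho> (Poly_Mapping.single u c * t) v = c *\<^sub>R foldr \<rho> (letters u) (tensor_eval \<rho> t v)"
  proof (induction t rule: tensor_induct)
    case (single w d)
    show ?case
      by (simp add: mult_single tensor_eval_single plus_tword_def
          linear_scale[OF linear_foldr[of \<rho>, OF lin]])
  next
    case (add s t)
    then show ?case
      by (simp add: tensor_eval_add algebra_simps linear_add[OF linear_foldr[of \<rho>, OF lin]])
  qed (simp add: linear_0[OF linear_foldr[of \<rho>, OF lin]])
  then show ?case by (simp add: tensor_eval_single)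
next
  case (add s t)
  then show ?case by (simp only: tensor_eval_add distrib_right)
next
  case zero
  show ?case by (simp only: tensor_eval_0 mult_zero_left)
qed

lemma tensor_eval_scale:
  assumes "\<And>i. linear (\<rho> i)"
  shows "tensor_eval \<rho> (tensor_const c * t) v = c *\<^sub>R tensor_eval \<rho> t v"
  by (simp add: tensor_eval_mult[of \<rho>, OF assms] tensor_eval_const)

section \<open>The Clifford ideal and its quotient ring\<close>

lemma tensor_ring_simps:
  "carrier tensor_ring = UNIV" "x \<otimes>\<^bsub>tensor_ring\<^esub> y = x * y"
  "x \<oplus>\<^bsub>tensor_ring\<^esub> y = x + y" "\<one>\<^bsub>tensor_ring\<^esub> = 1" "\<zero>\<^bsub>tensor_ring\<^esub> = 0"
  by (simp_all add: tensor_ring_def)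

lemma ring_tensor_ring: "ring (tensor_ring :: 'n tensor ring)"
proof (rule ringI, unfold tensor_ring_simps)
  show "abelian_group (tensor_ring :: 'n tensor ring)"
  proof (rule abelian_groupI, unfold tensor_ring_simps)
    fix t :: "'n tensor"
    show "\<exists>s\<in>UNIV. s + t = 0"
      by (intro bexI[of _ "- t"]) simp_all
  qed (simp_all add: add_ac)
  show "Group.monoid (tensor_ring :: 'n tensor ring)"
    by (rule monoidI, unfold tensor_ring_simps) (simp_all add: mult.assoc)
qed (simp_all add: distrib_right distrib_left)

lemma ideal_clifford_ideal: "ideal (clifford_ideal G) tensor_ring"
  unfolding clifford_ideal_def
  by (rule ring.genideal_ideal[OF ring_tensor_ring]) (simp add: tensor_ring_simps)

lemma clifford_ideal_generator:
  "tensor_vec x * tensor_vec x - tensor_const (gram_form G x x) \<in> clifford_ideal G"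
  unfolding clifford_ideal_def
  by (rule subsetD[OF ring.genideal_self[OF ring_tensor_ring]]) (auto simp: tensor_ring_simps)

lemma clifford_ideal_add: "s \<in> clifford_ideal G \<Longrightarrow> t \<in> clifford_ideal G \<Longrightarrow> s + t \<in> clifford_ideal G"
  using additive_subgroup.a_closed[OF ideal.axioms(1)[OF ideal_clifford_ideal]]
  by (fastforce simp: tensor_ring_simps)

lemma clifford_ideal_mult:
  assumes "t \<in> clifford_ideal G"
  shows "s * t \<in> clifford_ideal G" "t * s \<in> clifford_ideal G"
  using ideal.I_l_closed[OF ideal_clifford_ideal assms, of s]
    ideal.I_r_closed[OF ideal_clifford_ideal assms, of s]
  by (simp_all add: tensor_ring_simps)

lemma clifford_ideal_0: "0 \<in> clifford_ideal G"
  using clifford_ideal_mult(1)[OF clifford_ideal_generator, of 0] by simp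

lemma clifford_ideal_diff:
  "s \<in> clifford_ideal G \<Longrightarrow> t \<in> clifford_ideal G \<Longrightarrow> s - t \<in> clifford_ideal G"
  using clifford_ideal_add[of s G "(-1) * t"] clifford_ideal_mult(1)[of t G "-1"] by simp

lemma clifford_class_eq_image: "clifford_class G t = (\<lambda>u. u + t) ` clifford_ideal G"
  by (auto simp: clifford_class_def a_r_coset_def' tensor_ring_simps)

lemma mem_clifford_class_iff: "u \<in> clifford_class G t \<longleftrightarrow> u - t \<in> clifford_ideal G"
proof
  assume "u - t \<in> clifford_ideal G"
  then show "u \<in> clifford_class G t"
    unfolding clifford_class_eq_image by (rule rev_image_eqI) simp
qed (auto simp: clifford_class_eq_image)

lemma clifford_class_eqI:
  assumes "s - t \<in> clifford_ideal G"
  shows "clifford_class G s = clifford_class G t"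
proof -
  have "t - s \<in> clifford_ideal G"
    using clifford_ideal_diff[OF clifford_ideal_0 assms] by simp
  then have "u - s \<in> clifford_ideal G \<longleftrightarrow> u - t \<in> clifford_ideal G" for u
    using clifford_ideal_add[OF _ assms, of "u - s"] clifford_ideal_add[of "u - t" G "t - s"] by auto
  then show ?thesis by (auto simp: mem_clifford_class_iff)
qed

lemma clifford_class_add:
  "clifford_class G s \<oplus>\<^bsub>clifford_ring G\<^esub> clifford_class G t = clifford_class G (s + t)"
  using ring_hom_add[OF ideal.rcos_ring_hom[OF ideal_clifford_ideal], of s t]
  by (simp add: clifford_class_def clifford_ring_def) (simp add: tensor_ring_simps)

lemma clifford_class_mult:
  "clifford_class G s \<otimes>\<^bsub>clifford_ring G\<^esub> clifford_class G t = clifford_class G (s * t)"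
  using ring_hom_mult[OF ideal.rcos_ring_hom[OF ideal_clifford_ideal], of s t]
  by (simp add: clifford_class_def clifford_ring_def) (simp add: tensor_ring_simps)

text \<open>Polarization: the generators at two basis vectors are subtracted from the generator at
  their sum.\<close>

lemma clifford_anticommute:
  fixes G :: "rat^'n^'n"
  assumes "transpose G = G"
  shows "tensor_word [i] * tensor_word [j] + tensor_word [j] * tensor_word [i]
    - tensor_const (2 * of_rat (G $ i $ j)) \<in> clifford_ideal G"
proof -
  let ?e = "\<lambda>i. axis i 1 :: real^'n"
  have sym: "G $ j $ i = G $ i $ j"
    using assms by (metis transpose_def vec_lambda_beta)
  have "gram_form G (?e i + ?e j) (?e i + ?e j) =
      of_rat (G $ i $ i) + of_rat (G $ j $ j) + 2 * of_rat (G $ i $ j)"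
    by (simp add: gram_form_add_left gram_form_add_right gram_form_axis sym)
  moreover note clifford_ideal_diff[OF clifford_ideal_diff[OF
        clifford_ideal_generator[of "?e i + ?e j" G] clifford_ideal_generator[of "?e i" G]]
        clifford_ideal_generator[of "?e j" G]]
  ultimately show ?thesis
    by (simp add: tensor_vec_add tensor_vec_axis gram_form_axis tensor_const_simps algebra_simps)
qed

text \<open>The tensors acting as zero form an ideal, so only the generators have to be checked.
  There the double sum for the square of \<open>x\<close> is symmetrized, which brings in the
  relations between pairs of letters.\<close>

lemma tensor_eval_clifford_ideal:
  fixes G :: "rat^'n^'n"
  assumes lin: "\<And>i. linear (\<rho> i)"
    and rel: "\<And>i j v. \<rho> i (\<rho> j v) + \<rho> j (\<rho> i v) = (2 * of_rat (G $ i $ j)) *\<^sub>R v"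
    and "t \<in> clifford_ideal G"
  shows "tensor_eval \<rho> t v = 0"
proof -
  let ?Z = "{t. \<forall>v. tensor_eval \<rho> t v = 0}"
  have "ideal ?Z tensor_ring"
  proof (rule idealI[OF ring_tensor_ring])
    have inv: "inv\<^bsub>add_monoid tensor_ring\<^esub> s = - s" for s :: "'n tensor"
      by (rule group.inv_equality[OF abelian_group.a_group[OF ring.is_abelian_group[OF ring_tensor_ring]]])
         (simp_all add: tensor_ring_simps)
    show "subgroup ?Z (add_monoid tensor_ring)"
      by (rule subgroup.intro, unfold inv)
         (auto simp: tensor_ring_simps tensor_eval_add tensor_eval_uminus)
  qed (auto simp: tensor_ring_simps tensor_eval_mult[of \<rho>, OF lin] linear_0[OF linear_tensor_eval[of \<rho>, OF lin]])
  moreover have "tensor_vec x * tensor_vec x - tensor_const (gram_form G x x) \<in> ?Z" for x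
  proof safe
    fix v
    have sq: "tensor_eval \<rho> (tensor_vec x * tensor_vec x) v =
        (\<Sum>i\<in>UNIV. \<Sum>j\<in>UNIV. (x $ i * x $ j) *\<^sub>R \<rho> i (\<rho> j v))"
      by (simp add: tensor_eval_mult[of \<rho>, OF lin] tensor_eval_vec linear_sum[OF lin]
          linear_scale[OF lin] scaleR_sum_right)
    also have "\<dots> = (\<Sum>i\<in>UNIV. \<Sum>j\<in>UNIV. (x $ i * x $ j) *\<^sub>R \<rho> j (\<rho> i v))"
      by (subst sum.swap) (simp add: mult.commute)
    finally have "2 *\<^sub>R tensor_eval \<rho> (tensor_vec x * tensor_vec x) v =
       (\<Sum>i\<in>UNIV. \<Sum>j\<in>UNIV. (x $ i * x $ j) *\<^sub>R (\<rho> i (\<rho> j v) + \<rho> j (\<rho> i v)))"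
      using sq by (simp add: scaleR_2 sum.distrib scaleR_add_right)
    also have "\<dots> = 2 *\<^sub>R (gram_form G x x *\<^sub>R v)"
      unfolding rel gram_form_def scaleR_sum_left scaleR_sum_right
      by (intro sum.cong refl) (simp add: mult_ac)
    finally have "tensor_eval \<rho> (tensor_vec x * tensor_vec x) v = gram_form G x x *\<^sub>R v"
      by (rule real_vector.scale_left_imp_eq[rotated]) simp
    then show "tensor_eval \<rho> (tensor_vec x * tensor_vec x - tensor_const (gram_form G x x)) v = 0"
      by (simp add: tensor_eval_diff tensor_eval_const)
  qed
  ultimately have "clifford_ideal G \<subseteq> ?Z"
    unfolding clifford_ideal_def by (intro ring.genideal_minimal[OF ring_tensor_ring]) auto
  then show ?thesis using assms(3) by blast
qed

section \<open>The even Clifford algebra and its dual\<close>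

lemma subseqs_Nil_mem: "[] \<in> set (subseqs ls)"
  by (induction ls) (auto simp: Let_def)

lemma set_subseqs_Cons: "set (subseqs (k # ls)) = Cons k ` set (subseqs ls) \<union> set (subseqs ls)"
  by (simp add: Let_def)

text \<open>For a list without repetitions these are the ordered squarefree monomials of parity
  \<open>p\<close>. The odd ones are there because words are built letter by letter.\<close>

definition subseq_words :: "bool \<Rightarrow> 'n list \<Rightarrow> 'n tensor set" where
  "subseq_words p ls = tensor_word ` {w \<in> set (subseqs ls). even (length w) = p}"

lemma tensor_mult_span:
  assumes "\<And>x. x \<in> X \<Longrightarrow> a * x \<in> tensor.span Y" and "t \<in> tensor.span X"
  shows "a * t \<in> tensor.span Y"
  using assms(2)
proof (induction rule: tensor.span_induct_alt)
  case base
  then show ?case by (simp add: tensor.span_zero)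
next
  case (step c x t)
  have "a * (tensor_const c * x + t) = tensor_const c * (a * x) + a * t"
    by (metis (no_types, lifting) distrib_left mult.assoc tensor_const_commute)
  then show ?case
    using tensor.span_add[OF tensor.span_scale[OF assms(1)[OF step(1)]] step(2)] by metis
qed

text \<open>Straightening of words modulo the ideal. If \<open>j\<close> meets a word that starts
  with the head \<open>k\<close>, the anticommutation relation moves \<open>j\<close> behind
  \<open>k\<close>; the induction hypothesis orders it into the tail, and \<open>k\<close> can be
  put in front again.\<close>

lemma letter_mult_span_subseq_words:
  fixes G :: "rat^'n^'n"
  assumes sym: "transpose G = G"
  shows "j \<in> set ls \<Longrightarrow> t \<in> tensor.span (subseq_words p ls \<union> clifford_ideal G)
    \<Longrightarrow> tensor_word [j] * t \<in> tensor.span (subseq_words (\<not> p) ls \<union> clifford_ideal G)"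
proof (induction ls arbitrary: j t p)
  case (Cons k ls)
  let ?S = "\<lambda>p ls. tensor.span (subseq_words p ls \<union> clifford_ideal G)"
  let ?e = "\<lambda>i. tensor_word [i]"
  have word: "tensor_word w \<in> ?S p ls" if "w \<in> set (subseqs ls)" "even (length w) = p" for w p and ls :: "'n list"
    using that by (intro tensor.span_base) (auto simp: subseq_words_def)
  have ideal: "x \<in> ?S p ls" if "x \<in> clifford_ideal G" for x p and ls :: "'n list"
    using that by (intro tensor.span_base) auto
  have mono: "x \<in> ?S p (k # ls)" if "x \<in> ?S p ls" for x p
    by (rule subsetD[OF tensor.span_mono that]) (auto simp: subseq_words_def set_subseqs_Cons simp del: subseqs.simps)
  have consk: "tensor_word (k # w) \<in> ?S (\<not> p) (k # ls)"
    if "w \<in> set (subseqs ls)" "even (length w) = p" for w p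
    using that by (intro word) (auto simp: set_subseqs_Cons simp del: subseqs.simps)
  have k: "?e k * x \<in> ?S (\<not> p) (k # ls)" if "x \<in> ?S p ls" for x p
  proof (rule tensor_mult_span[OF _ that])
    fix x assume "x \<in> subseq_words p ls \<union> clifford_ideal G"
    then consider "x \<in> clifford_ideal G"
      | w where "w \<in> set (subseqs ls)" "even (length w) = p" "x = tensor_word w"
      by (auto simp: subseq_words_def)
    then show "?e k * x \<in> ?S (\<not> p) (k # ls)"
    proof cases
      case 1
      then show ?thesis by (intro ideal clifford_ideal_mult(1))
    next
      case 2
      show ?thesis using consk[OF 2(1,2)] unfolding 2(3) by (simp only: flip: tensor_word_Cons)
    qed
  qed
  show ?case
  proof (rule tensor_mult_span[OF _ Cons.prems(2)])
    fix x assume "x \<in> subseq_words p (k # ls) \<union> clifford_ideal G"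
    then consider (ideal) "x \<in> clifford_ideal G"
      | (old) w where "w \<in> set (subseqs ls)" "even (length w) = p" "x = tensor_word w"
      | (new) w where "w \<in> set (subseqs ls)" "even (length w) = (\<not> p)" "x = tensor_word (k # w)"
      by (auto simp: subseq_words_def set_subseqs_Cons simp del: subseqs.simps)
    then show "?e j * x \<in> ?S (\<not> p) (k # ls)"
    proof cases
      case ideal
      then show ?thesis by (intro tensor.span_base UnI2 clifford_ideal_mult(1))
    next
      case old
      show ?thesis
      proof (cases "j = k")
        case True
        then show ?thesis using consk[OF old(1,2)] unfolding old(3) by (simp only: flip: tensor_word_Cons)
      next
        case False
        then show ?thesis using mono[OF Cons.IH[OF _ word[OF old(1,2)], of j]] Cons.prems(1) old(3) by simp
      qed
    next
      case new
      let ?w = "tensor_word w"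
      have w: "?w \<in> ?S (\<not> p) ls" using new by (intro word)
      have anti: "(?e j * ?e k + ?e k * ?e j - tensor_const (2 * of_rat (G $ j $ k))) * ?w \<in> ?S (\<not> p) (k # ls)"
        by (rule ideal[OF clifford_ideal_mult(2)[OF clifford_anticommute[OF sym]]])
      have const: "tensor_const c * ?w \<in> ?S (\<not> p) (k # ls)" for c
        by (rule tensor.span_scale[OF mono[OF w]])
      show ?thesis
      proof (cases "j = k")
        case True
        \<comment> \<open>For equal letters the anticommutation relation only gives twice the
          square, hence the factor 1/2.\<close>
        have eq: "?e j * x = tensor_const (1/2) * ((?e j * ?e k + ?e k * ?e j
              - tensor_const (2 * of_rat (G $ j $ k))) * ?w + tensor_const (2 * of_rat (G $ j $ k)) * ?w)"
        proof -
          have "?e j * x = (?e j * ?e j) * ?w"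
            unfolding new(3) tensor_word_Cons[of k w] True by (rule mult.assoc[symmetric])
          also have "\<dots> = tensor_const (1/2) * (tensor_const 2 * ((?e j * ?e j) * ?w))"
            using tensor.scale_scale[of "1/2" 2 "?e j * ?e j * ?w"] tensor_const_simps(3) by simp
          also have "tensor_const 2 * ((?e j * ?e j) * ?w) = (?e j * ?e k + ?e k * ?e j) * ?w"
            unfolding True distrib_right using tensor_const_simps(1)[of 1 1, where ?'a='n]
            by (simp only: one_add_one tensor_const_simps(3) mult_2)
          finally show ?thesis by (simp only: left_diff_distrib diff_add_cancel)
        qed
        show ?thesis
          unfolding eq by (intro tensor.span_scale tensor.span_add anti const)
      next
        case False
        then have j: "j \<in> set ls" using Cons.prems(1) by simp
        have "?e k * (?e j * ?w) \<in> ?S (\<not> p) (k # ls)"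
          using k[OF Cons.IH[OF j w]] by simp
        moreover have "?e j * x = (?e j * ?e k + ?e k * ?e j - tensor_const (2 * of_rat (G $ j $ k))) * ?w
            + tensor_const (2 * of_rat (G $ j $ k)) * ?w - ?e k * (?e j * ?w)"
          unfolding new(3) tensor_word_Cons[of k w]
          by (simp only: left_diff_distrib distrib_right mult.assoc diff_add_cancel add_diff_cancel)
        ultimately show ?thesis
          by (simp only:) (intro tensor.span_diff tensor.span_add anti const)
      qed
    qed
  qed
qed (simp only: list.set(1) empty_iff)

lemma tensor_even_span_subseq_words:
  fixes G :: "rat^'n^'n"
  assumes sym: "transpose G = G" and ls: "set ls = UNIV" and t: "t \<in> tensor_even"
  shows "t \<in> tensor.span (subseq_words True ls \<union> clifford_ideal G)"
proof -
  have word: "tensor_word w \<in> tensor.span (subseq_words (even (length w)) ls \<union> clifford_ideal G)" for w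
  proof (induction w)
    case Nil
    show ?case by (intro tensor.span_base) (auto simp: subseq_words_def subseqs_Nil_mem)
  next
    case (Cons j w)
    show ?case
      using letter_mult_span_subseq_words[OF sym _ Cons, of j] ls
      by (simp flip: tensor_word_Cons)
  qed
  have "Poly_Mapping.single w c \<in> tensor.span (subseq_words True ls \<union> clifford_ideal G)"
    if "even (length (letters w))" for w c
    using tensor.span_scale[OF word[of "letters w"], of c] that
    by (simp only: single_eq_const_word[of w c])
  then have "(\<Sum>w\<in>Poly_Mapping.keys t. Poly_Mapping.single w (Poly_Mapping.lookup t w))
      \<in> tensor.span (subseq_words True ls \<union> clifford_ideal G)"
    using t by (intro tensor.span_sum) (auto simp: tensor_even_def)
  then show ?thesis
    using tensor_expansion[of "Poly_Mapping.keys t" t] by (metis finite_keys order_refl)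
qed

lemma clifford_even_dual_class:
  assumes "\<phi> \<in> clifford_even_dual G" "s \<in> tensor_even" "t \<in> tensor_even"
  shows "\<phi> (clifford_class G (s + t)) = \<phi> (clifford_class G s) + \<phi> (clifford_class G t)"
    and "\<phi> (clifford_class G (tensor_const c * t)) = c * \<phi> (clifford_class G t)"
  using assms unfolding clifford_even_dual_def clifford_even_def
  by (auto simp flip: clifford_class_add clifford_class_mult)

text \<open>The ordered even words span the even part, which bounds the dimension of the dual from
  above. The opposite bound comes later from a module on which these words act
  independently.\<close>

lemma clifford_even_dual_eq_0:
  fixes G :: "rat^'n^'n"
  assumes sym: "transpose G = G" and ls: "set ls = UNIV" and \<phi>: "\<phi> \<in> clifford_even_dual G"
    and 0: "\<And>w. w \<in> set (subseqs ls) \<Longrightarrow> even (length w) \<Longrightarrow> \<phi> (clifford_class G (tensor_word w)) = 0"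
  shows "\<phi> = 0"
proof
  fix X
  show "\<phi> X = 0 X"
  proof (cases "X \<in> clifford_even G")
    case False
    then show ?thesis using \<phi> by (simp add: clifford_even_dual_def)
  next
    case True
    then obtain t where t: "t \<in> tensor_even" "X = clifford_class G t"
      by (auto simp: clifford_even_def)
    obtain s u where su: "t = s + u" "s \<in> tensor.span (subseq_words True ls)"
      "u \<in> tensor.span (clifford_ideal G)"
      using tensor_even_span_subseq_words[OF sym ls t(1)] unfolding tensor.span_Un by auto
    have "tensor.subspace (clifford_ideal G)"
      by (simp add: tensor.subspace_def clifford_ideal_0 clifford_ideal_add clifford_ideal_mult)
    then have "u \<in> clifford_ideal G" using su(3) tensor.span_eq_iff by blast
    then have "X = clifford_class G s" unfolding t(2) su(1) by (intro clifford_class_eqI) simp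
    moreover have "s \<in> tensor_even \<and> \<phi> (clifford_class G s) = 0"
      using su(2)
    proof (induction rule: tensor.span_induct_alt)
      case base
      show ?case using clifford_even_dual_class(2)[OF \<phi> tensor_even_0 tensor_even_0, of 0]
        by (simp add: tensor_even_0)
    next
      case (step c x y)
      then have "x \<in> tensor_even" "\<phi> (clifford_class G x) = 0"
        using 0 by (auto simp: subseq_words_def intro: tensor_even_word)
      then show ?case using step
        by (simp add: clifford_even_dual_class[OF \<phi>] tensor_even_add tensor_even_mult tensor_even_const)
    qed
    ultimately show ?thesis by simp
  qed
qed

text \<open>
  The value does not depend on the chosen representative \<open>t\<close> when \<open>\<rho>\<close> satisfies the Clifford relations.
\<close>

definition clifford_functional ::
  "rat^'n^'n \<Rightarrow> ('n \<Rightarrow> 'm \<Rightarrow> 'm::real_vector) \<Rightarrow> 'm \<Rightarrow> ('m \<Rightarrow> real) \<Rightarrow> 'n tensor set \<Rightarrow> real" where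
  "clifford_functional G \<rho> v l X =
     (if X \<in> clifford_even G then l (tensor_eval \<rho> (SOME t. t \<in> X) v) else 0)"

lemma clifford_functional_class:
  fixes G :: "rat^'n^'n"
  assumes lin: "\<And>i. linear (\<rho> i)"
    and rel: "\<And>i j v. \<rho> i (\<rho> j v) + \<rho> j (\<rho> i v) = (2 * of_rat (G $ i $ j)) *\<^sub>R v"
    and t: "t \<in> tensor_even"
  shows "clifford_functional G \<rho> v l (clifford_class G t) = l (tensor_eval \<rho> t v)"
proof -
  have "t \<in> clifford_class G t"
    by (simp add: mem_clifford_class_iff clifford_ideal_0)
  then have "(SOME u. u \<in> clifford_class G t) \<in> clifford_class G t" by (rule someI)
  then have "tensor_eval \<rho> ((SOME u. u \<in> clifford_class G t) - t) v = 0"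
    using tensor_eval_clifford_ideal[of \<rho> G, OF lin rel] by (simp add: mem_clifford_class_iff)
  then show ?thesis
    using t by (auto simp: clifford_functional_def clifford_even_def tensor_eval_diff)
qed

lemma clifford_functional_in_dual:
  fixes G :: "rat^'n^'n"
  assumes lin: "\<And>i. linear (\<rho> i)"
    and rel: "\<And>i j v. \<rho> i (\<rho> j v) + \<rho> j (\<rho> i v) = (2 * of_rat (G $ i $ j)) *\<^sub>R v"
    and l: "linear l"
  shows "clifford_functional G \<rho> v l \<in> clifford_even_dual G"
proof -
  note cls = clifford_functional_class[of \<rho> G, OF lin rel]
  have "clifford_functional G \<rho> v l X = 0" if "X \<notin> clifford_even G" for X
    using that by (simp add: clifford_functional_def)
  then show ?thesis
    unfolding clifford_even_dual_def
    by (auto simp: clifford_even_def clifford_class_add clifford_class_mult cls tensor_even_add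
        tensor_even_mult tensor_even_const tensor_eval_add tensor_eval_scale[of \<rho>, OF lin]
        linear_add[OF l] linear_scale[OF l])
qed

text \<open>The point is the rationality of the coefficients, so the dimension count is made over
  the rationals. Real independence implies rational independence, and all vectors lie in the
  rational span of \<open>Basis\<close>. If \<open>b\<close> were outside the rational span of the
  family, adding it would give more independent vectors than that space allows.\<close>

lemma rational_basis_expansion:
  fixes F :: "'i \<Rightarrow> 'a::euclidean_space"
  assumes I: "finite I" "card I = DIM('a)"
    and rat: "\<And>i b. i \<in> I \<Longrightarrow> b \<in> Basis \<Longrightarrow> F i \<bullet> b \<in> \<rat>"
    and indep: "\<And>u i. (\<Sum>i\<in>I. u i *\<^sub>R F i) = 0 \<Longrightarrow> i \<in> I \<Longrightarrow> u i = 0"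
    and b: "b \<in> Basis"
  shows "\<exists>u. (\<forall>i. u i \<in> \<rat>) \<and> b = (\<Sum>i\<in>I. u i *\<^sub>R F i)"
proof -
  interpret Q: vector_space "\<lambda>r (v::'a). of_rat r *\<^sub>R v"
    by standard (simp_all add: algebra_simps of_rat_add of_rat_mult)
  have inj: "inj_on F I"
  proof (rule inj_onI, rule ccontr)
    fix i j assume ij: "i \<in> I" "j \<in> I" "F i = F j" "i \<noteq> j"
    let ?u = "\<lambda>k. if k = i then 1 else if k = j then -1 else (0::real)"
    have "(\<Sum>k\<in>I. ?u k *\<^sub>R F k) = (\<Sum>k\<in>I. (if k = i then F i else 0) - (if k = j then F i else 0))"
      using ij by (intro sum.cong) auto
    also have "\<dots> = 0" using ij I(1) by (simp add: sum_subtractf)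
    finally show False using indep[of ?u i] ij by simp
  qed
  have span: "Q.span (F ` I) = range (\<lambda>u. \<Sum>i\<in>I. of_rat (u (F i)) *\<^sub>R F i)"
    unfolding Q.span_finite[OF finite_imageI[OF I(1)]] by (simp add: sum.reindex[OF inj] comp_def)
  have F_Basis: "F ` I \<subseteq> Q.span Basis"
  proof
    fix x assume "x \<in> F ` I"
    then have "\<forall>b\<in>Basis. \<exists>r. x \<bullet> b = of_rat r" using rat by (auto elim!: Rats_cases)
    then obtain r where r: "\<forall>b\<in>Basis. x \<bullet> b = of_rat (r b)" by metis
    have "x = (\<Sum>b\<in>Basis. (x \<bullet> b) *\<^sub>R b)" by (simp add: euclidean_representation)
    also have "\<dots> = (\<Sum>b\<in>Basis. of_rat (r b) *\<^sub>R b)" using r by (intro sum.cong) auto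
    also have "\<dots> \<in> Q.span Basis" by (intro Q.span_sum Q.span_scale Q.span_base)
    finally show "x \<in> Q.span Basis" .
  qed
  have ind: "Q.independent (F ` I)"
    unfolding Q.independent_explicit_module
  proof safe
    fix t u x assume t: "finite t" "t \<subseteq> F ` I" "(\<Sum>w\<in>t. of_rat (u w) *\<^sub>R w) = 0" "x \<in> t"
    then obtain i where i: "i \<in> I" "x = F i" by auto
    have "(\<Sum>i\<in>I. (if F i \<in> t then of_rat (u (F i)) else 0) *\<^sub>R F i)
        = (\<Sum>w\<in>F ` I. (if w \<in> t then of_rat (u w) else 0) *\<^sub>R w)"
      by (simp add: sum.reindex[OF inj] comp_def)
    also have "\<dots> = (\<Sum>w\<in>t. of_rat (u w) *\<^sub>R w)"
      using t(2) I(1) by (intro sum.mono_neutral_cong_right) auto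
    finally show "u x = 0"
      using indep[of "\<lambda>i. if F i \<in> t then of_rat (u (F i)) else 0" i] i t(3,4) by simp
  qed
  have "b \<in> Q.span (F ` I)"
  proof (rule ccontr)
    assume nb: "b \<notin> Q.span (F ` I)"
    have "Q.independent (insert b (F ` I))" by (rule Q.independent_insertI[OF nb ind])
    moreover have "insert b (F ` I) \<subseteq> Q.span Basis" using F_Basis b Q.span_base by auto
    ultimately have "card (insert b (F ` I)) \<le> DIM('a)"
      using Q.independent_span_bound[OF finite_Basis] by blast
    moreover have "b \<notin> F ` I" using nb Q.span_base by auto
    ultimately show False using I by (simp add: card_image[OF inj])
  qed
  then obtain u where "b = (\<Sum>i\<in>I. of_rat (u (F i)) *\<^sub>R F i)" unfolding span by auto
  then show ?thesis by (intro exI[of _ "\<lambda>i. of_rat (u (F i))"]) auto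
qed

text \<open>The vector \<open>v\<close> generates the module freely over the even Clifford algebra:
  the ordered even words applied to it form a rational basis. Applying even elements to
  \<open>v\<close> is then a bijection, with inverse given by \<open>lift\<close> on basis vectors,
  and its transpose for the inner product is \<open>functional\<close>.\<close>

locale clifford_module =
  fixes G :: "rat^'n^'n" and \<rho> :: "'n \<Rightarrow> 'm \<Rightarrow> 'm::euclidean_space" and v :: 'm and ls :: "'n list"
  assumes sym: "transpose G = G" and ls: "set ls = UNIV"
    and lin: "\<And>i. linear (\<rho> i)"
    and rel: "\<And>i j z. \<rho> i (\<rho> j z) + \<rho> j (\<rho> i z) = (2 * of_rat (G $ i $ j)) *\<^sub>R z"
    and rational: "\<And>w b. w \<in> set (subseqs ls) \<Longrightarrow> b \<in> Basis \<Longrightarrow> foldr \<rho> w v \<bullet> b \<in> \<rat>"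
    and card: "card {w \<in> set (subseqs ls). even (length w)} = DIM('m)"
    and indep: "\<And>u w. (\<Sum>w | w \<in> set (subseqs ls) \<and> even (length w). u w *\<^sub>R foldr \<rho> w v) = 0
      \<Longrightarrow> w \<in> set (subseqs ls) \<Longrightarrow> even (length w) \<Longrightarrow> u w = 0"
begin

abbreviation "W \<equiv> {w \<in> set (subseqs ls). even (length w)}"

definition coeff :: "'m \<Rightarrow> 'n list \<Rightarrow> real" where
  "coeff b = (SOME u. (\<forall>w. u w \<in> \<rat>) \<and> b = (\<Sum>w\<in>W. u w *\<^sub>R foldr \<rho> w v))"

lemma coeff:
  assumes "b \<in> Basis"
  shows "coeff b w \<in> \<rat>" "b = (\<Sum>w\<in>W. coeff b w *\<^sub>R foldr \<rho> w v)"
proof -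
  have "\<exists>u. (\<forall>w. u w \<in> \<rat>) \<and> b = (\<Sum>w\<in>W. u w *\<^sub>R foldr \<rho> w v)"
    using card rational indep assms by (intro rational_basis_expansion) auto
  from someI_ex[OF this] show "coeff b w \<in> \<rat>" "b = (\<Sum>w\<in>W. coeff b w *\<^sub>R foldr \<rho> w v)"
    unfolding coeff_def[symmetric] by auto
qed

definition lift :: "'m \<Rightarrow> 'n tensor" where
  "lift b = (\<Sum>w\<in>W. Poly_Mapping.single (TWord w) (coeff b w))"

lemma lift_even: "lift b \<in> tensor_even"
  unfolding lift_def by (intro tensor_even_sum) (auto simp: tensor_even_def)

lemma lift_rational: "b \<in> Basis \<Longrightarrow> lift b \<in> tensor_rational"
  unfolding lift_def by (intro tensor_rational_sum tensor_rational_single coeff(1))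

lemma eval_lift: "b \<in> Basis \<Longrightarrow> tensor_eval \<rho> (lift b) v = b"
  using coeff(2) by (simp add: lift_def tensor_eval_sum tensor_eval_single)

text \<open>The coordinates of the vectors \<open>foldr \<rho> w v\<close> and the numbers
  \<open>coeff b w\<close> form mutually inverse square matrices. One product is the defining
  property of \<open>coeff\<close>; the other, needed here, follows from independence. Hence the
  lifts span everything that the words span.\<close>

lemma word_eq_sum_lift:
  assumes w: "w \<in> W"
  shows "tensor_word w = (\<Sum>b\<in>Basis. tensor_const (foldr \<rho> w v \<bullet> b) * lift b)"
proof -
  let ?c = "\<lambda>u. \<Sum>b\<in>Basis. (foldr \<rho> w v \<bullet> b) * coeff b u"
  have "(\<Sum>u\<in>W. ?c u *\<^sub>R foldr \<rho> u v) =
      (\<Sum>b\<in>Basis. (foldr \<rho> w v \<bullet> b) *\<^sub>R (\<Sum>u\<in>W. coeff b u *\<^sub>R foldr \<rho> u v))"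
    unfolding scaleR_sum_left scaleR_sum_right by (subst sum.swap) simp
  also have "\<dots> = (\<Sum>b\<in>Basis. (foldr \<rho> w v \<bullet> b) *\<^sub>R b)"
    by (intro sum.cong refl) (simp flip: coeff(2))
  also have "\<dots> = foldr \<rho> w v" by (rule euclidean_representation)
  also have "\<dots> = (\<Sum>u\<in>W. (if u = w then 1 else 0) *\<^sub>R foldr \<rho> u v)"
    using w by (simp add: if_distrib[of "\<lambda>x. x *\<^sub>R _"] cong: if_cong)
  finally have "(\<Sum>u\<in>W. (?c u - (if u = w then 1 else 0)) *\<^sub>R foldr \<rho> u v) = 0"
    by (simp only: scaleR_left_diff_distrib sum_subtractf diff_self)
  then have c: "?c u = (if u = w then 1 else 0)" if "u \<in> W" for u
    using indep[of "\<lambda>u. ?c u - (if u = w then 1 else 0)" u] that by simp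
  have "(\<Sum>b\<in>Basis. tensor_const (foldr \<rho> w v \<bullet> b) * lift b) =
      (\<Sum>b\<in>Basis. \<Sum>u\<in>W. Poly_Mapping.single (TWord u) ((foldr \<rho> w v \<bullet> b) * coeff b u))"
    by (simp add: lift_def sum_distrib_left tensor_const_def mult_single)
  also have "\<dots> = (\<Sum>u\<in>W. Poly_Mapping.single (TWord u) (?c u))"
  proof -
    have single_sum: "Poly_Mapping.single k (sum g B) = (\<Sum>b\<in>B. Poly_Mapping.single k (g b :: real))"
      for k :: "'n tword" and g and B :: "'m set"
      by (induction B rule: infinite_finite_induct) (simp_all add: single_add)
    show ?thesis by (subst sum.swap) (simp add: single_sum)
  qed
  also have "\<dots> = (\<Sum>u\<in>W. if u = w then tensor_word w else 0)"
    by (intro sum.cong refl) (use c in auto)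
  also have "\<dots> = tensor_word w" using w by simp
  finally show ?thesis by simp
qed

lemma dual_sum:
  assumes \<phi>: "\<phi> \<in> clifford_even_dual G" and t: "\<And>i. i \<in> I \<Longrightarrow> t i \<in> tensor_even"
  shows "\<phi> (clifford_class G (\<Sum>i\<in>I. tensor_const (c i) * t i)) = (\<Sum>i\<in>I. c i * \<phi> (clifford_class G (t i)))"
  using t
proof (induction I rule: infinite_finite_induct)
  case (insert i I)
  then have "(\<Sum>i\<in>I. tensor_const (c i) * t i) \<in> tensor_even"
    by (intro tensor_even_sum tensor_even_mult tensor_even_const) auto
  with insert show ?case
    by (simp add: clifford_even_dual_class[OF \<phi>] tensor_even_mult tensor_even_const)
qed (use clifford_even_dual_class(2)[OF \<phi> tensor_even_0 tensor_even_0, of 0] in simp_all)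

lemma dual_eqI:
  assumes "\<phi> \<in> clifford_even_dual G" "\<psi> \<in> clifford_even_dual G"
    and eq: "\<And>b. b \<in> Basis \<Longrightarrow> \<phi> (clifford_class G (lift b)) = \<psi> (clifford_class G (lift b))"
  shows "\<phi> = \<psi>"
proof -
  have "(\<lambda>X. \<phi> X - \<psi> X) \<in> clifford_even_dual G"
    using assms(1,2) unfolding clifford_even_dual_def by (simp add: algebra_simps)
  moreover have "\<phi> (clifford_class G (tensor_word w)) = \<psi> (clifford_class G (tensor_word w))"
    if "w \<in> set (subseqs ls)" "even (length w)" for w
  proof -
    have "w \<in> W" using that by simp
    then show ?thesis
      unfolding word_eq_sum_lift[OF \<open>w \<in> W\<close>]
      by (simp add: dual_sum[OF assms(1)] dual_sum[OF assms(2)] lift_even eq)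
  qed
  ultimately have "(\<lambda>X. \<phi> X - \<psi> X) = 0"
    by (intro clifford_even_dual_eq_0[OF sym ls]) auto
  then show ?thesis by (simp add: fun_eq_iff)
qed

definition functional :: "'m \<Rightarrow> 'n tensor set \<Rightarrow> real" where
  "functional z = clifford_functional G \<rho> v (\<lambda>x. z \<bullet> x)"

lemma functional_class:
  "t \<in> tensor_even \<Longrightarrow> functional z (clifford_class G t) = z \<bullet> tensor_eval \<rho> t v"
  unfolding functional_def by (rule clifford_functional_class[of \<rho> G, OF lin rel])

lemma functional_in_dual: "functional z \<in> clifford_even_dual G"
  unfolding functional_def
  by (rule clifford_functional_in_dual[of \<rho> G, OF lin rel])
     (simp add: bounded_linear.linear bounded_linear_inner_right)

text \<open>Evaluation at the lifts makes sense for every function, so this inverse of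
  \<open>functional\<close> is linear on the whole type, as homomorphisms of tori have to
  be.\<close>

definition vector_of :: "('n tensor set \<Rightarrow> real) \<Rightarrow> 'm" where
  "vector_of \<phi> = (\<Sum>b\<in>Basis. \<phi> (clifford_class G (lift b)) *\<^sub>R b)"

lemma linear_vector_of: "linear vector_of"
  by (rule linearI)
     (simp_all add: vector_of_def scaleR_fun_def algebra_simps sum.distrib scaleR_sum_right)

lemma vector_of_functional: "vector_of (functional z) = z"
  by (simp add: vector_of_def functional_class lift_even eval_lift euclidean_representation)

lemma functional_vector_of:
  assumes "\<phi> \<in> clifford_even_dual G"
  shows "functional (vector_of \<phi>) = \<phi>"
  by (rule dual_eqI[OF functional_in_dual assms])
     (simp add: functional_class lift_even eval_lift, simp add: vector_of_def)

text \<open>If \<open>\<phi>\<close> is the functional of \<open>x\<close>, its value at a product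
  \<open>s * t\<close> is the inner product of \<open>x\<close> with \<open>s\<close> applied to
  \<open>t v\<close>; the adjoint \<open>L\<close> moves \<open>s\<close> to the other side.\<close>

lemma vector_of_left_mult:
  assumes \<phi>: "\<phi> \<in> clifford_even_dual G" and s: "s \<in> tensor_even"
    and adj: "\<And>x z. x \<bullet> tensor_eval \<rho> s z = L x \<bullet> z"
  shows "vector_of (\<lambda>X. if X \<in> clifford_even G
      then \<phi> (clifford_class G s \<otimes>\<^bsub>clifford_ring G\<^esub> X) else 0) = L (vector_of \<phi>)"
proof -
  have "(\<lambda>X. if X \<in> clifford_even G then \<phi> (clifford_class G s \<otimes>\<^bsub>clifford_ring G\<^esub> X) else 0)
      = functional (L (vector_of \<phi>))"
  proof
    fix X
    show "(if X \<in> clifford_even G then \<phi> (clifford_class G s \<otimes>\<^bsub>clifford_ring G\<^esub> X) else 0)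
      = functional (L (vector_of \<phi>)) X"
    proof (cases "X \<in> clifford_even G")
      case True
      then obtain t where t: "t \<in> tensor_even" "X = clifford_class G t"
        by (auto simp: clifford_even_def)
      have "\<phi> (clifford_class G (s * t)) = functional (vector_of \<phi>) (clifford_class G (s * t))"
        by (simp add: functional_vector_of[OF \<phi>])
      also have "\<dots> = L (vector_of \<phi>) \<bullet> tensor_eval \<rho> t v"
        by (simp add: functional_class tensor_even_mult s t(1) tensor_eval_mult[of \<rho>, OF lin] adj)
      finally show ?thesis
        using True by (simp add: t functional_class clifford_class_mult)
    next
      case False
      then show ?thesis
        using functional_in_dual[of "L (vector_of \<phi>)"] by (simp add: clifford_even_dual_def)
    qed
  qed
  then show ?thesis by (simp add: vector_of_functional)
qed

lemma vector_of_rational: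
  assumes "\<And>X. X \<in> clifford_even_rational G \<Longrightarrow> \<phi> X \<in> \<rat>" and b: "b \<in> Basis"
  shows "vector_of \<phi> \<bullet> b \<in> \<rat>"
proof -
  have "clifford_class G (lift b) \<in> clifford_even_rational G"
    using lift_even lift_rational[OF b] by (auto simp: clifford_even_rational_def)
  then show ?thesis using assms by (simp add: vector_of_def)
qed

end

section \<open>Pure spinors\<close>

text \<open>The letters come from an orthogonal splitting: \<open>a\<close>, \<open>b\<close> from
  an isotropic pair of U, \<open>c\<^sub>1\<close> from the vector of square 2\<Delta>,
  \<open>c\<^sub>4\<close> and \<open>c\<^sub>5\<close> from those of square -2, and
  \<open>y\<close> from the normal vector of square -2\<Delta>. Each operator squares to minus half
  the form. The equations are oriented as rewrite rules that bring \<open>b\<close> to the left of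
  the other frame letters and \<open>a\<close> to the right.\<close>

locale spin_operators =
  fixes a b c\<^sub>1 c\<^sub>4 c\<^sub>5 y :: "'a::real_vector \<Rightarrow> 'a" and \<Delta> :: real
  assumes linear: "linear a" "linear b" "linear c\<^sub>1" "linear c\<^sub>4" "linear c\<^sub>5" "linear y"
    and \<Delta>_pos: "\<Delta> > 0"
    and square: "a (a v) = 0" "b (b v) = 0" "c\<^sub>1 (c\<^sub>1 v) = - \<Delta> *\<^sub>R v" "c\<^sub>4 (c\<^sub>4 v) = v"
      "c\<^sub>5 (c\<^sub>5 v) = v" "y (y v) = \<Delta> *\<^sub>R v"
    and hyperbolic: "a (b v) = - v - b (a v)"
    and anticommute: "a (c\<^sub>1 v) = - c\<^sub>1 (a v)" "a (c\<^sub>4 v) = - c\<^sub>4 (a v)" "a (c\<^sub>5 v) = - c\<^sub>5 (a v)"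
      "a (y v) = - y (a v)" "c\<^sub>1 (b v) = - b (c\<^sub>1 v)" "c\<^sub>4 (b v) = - b (c\<^sub>4 v)"
      "c\<^sub>5 (b v) = - b (c\<^sub>5 v)" "c\<^sub>4 (c\<^sub>1 v) = - c\<^sub>1 (c\<^sub>4 v)" "c\<^sub>5 (c\<^sub>1 v) = - c\<^sub>1 (c\<^sub>5 v)"
      "c\<^sub>5 (c\<^sub>4 v) = - c\<^sub>4 (c\<^sub>5 v)" "y (c\<^sub>1 v) = - c\<^sub>1 (y v)" "y (c\<^sub>4 v) = - c\<^sub>4 (y v)"
      "y (c\<^sub>5 v) = - c\<^sub>5 (y v)"
begin

lemmas lin_simps =
  linear[THEN linear_add] linear[THEN linear_diff] linear[THEN linear_neg]
  linear[THEN linear_scale] linear[THEN linear_0]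

lemmas rewrite = square hyperbolic anticommute lin_simps

text \<open>
  The words in \<open>a, b, c\<^sub>1, c\<^sub>4, c\<^sub>5\<close> act on \<open>v\<close> and on \<open>b v\<close> without relations only for suitable \<open>v\<close>:
  \<open>v\<close> has to be killed by \<open>a\<close> and fixed by the involution \<open>c\<^sub>1 y / \<Delta>\<close>, which commutes with \<open>c\<^sub>4 c\<^sub>5\<close>
  and anticommutes with \<open>c\<^sub>1 c\<^sub>4\<close> and \<open>c\<^sub>1 c\<^sub>5\<close>.
\<close>

definition pure_spinor :: "'a \<Rightarrow> bool" where
  "pure_spinor v \<longleftrightarrow> v \<noteq> 0 \<and> a v = 0 \<and> y v = - c\<^sub>1 v"

text \<open>The involution \<open>c\<^sub>1 y / \<Delta>\<close> commutes with \<open>a\<close>. So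
  \<open>?p\<close>, which adds to a vector its image under the involution and then applies
  \<open>a\<close>, has values that are fixed by the involution and killed by \<open>a\<close>. The
  set \<open>S\<close> is kept abstract in order to be the set of rational vectors later.\<close>

lemma pure_spinor_exists:
  assumes "z \<in> S" "z \<noteq> 0"
    and S: "\<And>v. v \<in> S \<Longrightarrow> a v \<in> S" "\<And>v. v \<in> S \<Longrightarrow> c\<^sub>1 v \<in> S" "\<And>v. v \<in> S \<Longrightarrow> y v \<in> S"
      "\<And>v w. v \<in> S \<Longrightarrow> w \<in> S \<Longrightarrow> v + w \<in> S" "\<And>v. v \<in> S \<Longrightarrow> (1 / \<Delta>) *\<^sub>R v \<in> S"
      "\<And>v. v \<in> S \<Longrightarrow> b v \<in> S"
  shows "\<exists>v\<in>S. pure_spinor v"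
proof -
  let ?p = "\<lambda>x. a (x + (1 / \<Delta>) *\<^sub>R c\<^sub>1 (y x))"
  have "\<exists>x\<in>S. ?p x \<noteq> 0"
  proof (rule ccontr)
    assume "\<not> (\<exists>x\<in>S. ?p x \<noteq> 0)"
    then have p: "?p x = 0" if "x \<in> S" for x using that by blast
    \<comment> \<open>In \<open>c\<^sub>1 (?p x) + ?p (c\<^sub>1 x)\<close> the terms without
      \<open>y\<close> cancel, because \<open>c\<^sub>1\<close> and \<open>a\<close> anticommute,
      while the two terms with \<open>y\<close> agree. If \<open>?p\<close> vanished on
      \<open>S\<close>, so would \<open>a\<close>, against the hyperbolic relation.\<close>
    have a: "a x = 0" if x: "x \<in> S" for x
    proof -
      have "c\<^sub>1 (?p x) + ?p (c\<^sub>1 x) = - 2 *\<^sub>R y (a x)"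
        using \<Delta>_pos by (simp add: rewrite scaleR_2)
      moreover have "c\<^sub>1 (?p x) + ?p (c\<^sub>1 x) = 0"
        by (simp only: p[OF x] p[OF S(2)[OF x]] linear(3)[THEN linear_0] add_0)
      ultimately have "y (a x) = 0" by simp
      then have "y (y (a x)) = 0" by (simp add: lin_simps)
      then show ?thesis using \<Delta>_pos by (simp add: square)
    qed
    show False using hyperbolic[of z] a[OF assms(1)] a[OF S(6)[OF assms(1)]] assms(2)
      by (simp add: lin_simps)
  qed
  then obtain x where x: "x \<in> S" "?p x \<noteq> 0" by blast
  have "y (?p x) = - c\<^sub>1 (?p x)" "a (?p x) = 0"
    using \<Delta>_pos by (simp_all add: rewrite)
  moreover have "?p x \<in> S" using x(1) by (intro S)
  ultimately show ?thesis using x(2) unfolding pure_spinor_def by (intro bexI[of _ "?p x"] conjI)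
qed

context
  fixes v assumes v: "pure_spinor v"
begin

lemma v_simps: "a v = 0" "y v = - c\<^sub>1 v"
  using v by (auto simp: pure_spinor_def)

text \<open>The operator \<open>c\<^sub>4 c\<^sub>5\<close> has square -1, so multiplying by the
  conjugate expression leaves the sum of the two squares.\<close>

lemma pure_spinor_indep2:
  assumes "\<alpha> *\<^sub>R v + \<beta> *\<^sub>R c\<^sub>4 (c\<^sub>5 v) = 0"
  shows "\<alpha> = 0 \<and> \<beta> = 0"
proof -
  have "(\<alpha>\<^sup>2 + \<beta>\<^sup>2) *\<^sub>R v = \<alpha> *\<^sub>R (\<alpha> *\<^sub>R v + \<beta> *\<^sub>R c\<^sub>4 (c\<^sub>5 v))
      - \<beta> *\<^sub>R c\<^sub>4 (c\<^sub>5 (\<alpha> *\<^sub>R v + \<beta> *\<^sub>R c\<^sub>4 (c\<^sub>5 v)))"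
    by (simp add: rewrite algebra_simps power2_eq_square)
  also have "\<dots> = 0" unfolding assms by (simp add: lin_simps)
  finally show ?thesis using v by (simp add: pure_spinor_def sum_power2_eq_zero_iff)
qed

text \<open>The operator \<open>y\<close> commutes with even words in the \<open>c\<^sub>i\<close>
  and agrees with \<open>- c\<^sub>1\<close> on \<open>v\<close>. Hence \<open>c\<^sub>1 + y\<close>
  kills the first two vectors and doubles the effect of \<open>c\<^sub>1\<close> on the other two,
  which separates the pairs.\<close>

lemma pure_spinor_indep4:
  assumes "\<alpha> *\<^sub>R v + \<beta> *\<^sub>R c\<^sub>4 (c\<^sub>5 v) + \<gamma> *\<^sub>R c\<^sub>1 (c\<^sub>4 v) + \<delta> *\<^sub>R c\<^sub>1 (c\<^sub>5 v) = 0" (is "?e = 0")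
  shows "\<alpha> = 0 \<and> \<beta> = 0 \<and> \<gamma> = 0 \<and> \<delta> = 0"
proof -
  have "c\<^sub>4 (c\<^sub>1 ?e + y ?e) = (- 2 * \<Delta>) *\<^sub>R (\<gamma> *\<^sub>R v + \<delta> *\<^sub>R c\<^sub>4 (c\<^sub>5 v))"
    by (simp add: rewrite v_simps algebra_simps flip: scaleR_add_left)
  then have \<gamma>\<delta>: "\<gamma> *\<^sub>R v + \<delta> *\<^sub>R c\<^sub>4 (c\<^sub>5 v) = 0"
    unfolding assms using \<Delta>_pos by (simp add: lin_simps)
  then show ?thesis
    using assms pure_spinor_indep2[OF \<gamma>\<delta>] pure_spinor_indep2[of \<alpha> \<beta>] by simp
qed

text \<open>Multiplication by \<open>c\<^sub>4\<close> turns the odd words into the even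
  ones.\<close>

lemma pure_spinor_indep4_odd:
  assumes "\<alpha> *\<^sub>R c\<^sub>1 v + \<beta> *\<^sub>R c\<^sub>4 v + \<gamma> *\<^sub>R c\<^sub>5 v + \<delta> *\<^sub>R c\<^sub>1 (c\<^sub>4 (c\<^sub>5 v)) = 0" (is "?e = 0")
  shows "\<alpha> = 0 \<and> \<beta> = 0 \<and> \<gamma> = 0 \<and> \<delta> = 0"
proof -
  have "c\<^sub>4 ?e = \<beta> *\<^sub>R v + \<gamma> *\<^sub>R c\<^sub>4 (c\<^sub>5 v) + (- \<alpha>) *\<^sub>R c\<^sub>1 (c\<^sub>4 v) + (- \<delta>) *\<^sub>R c\<^sub>1 (c\<^sub>5 v)"
    by (simp add: rewrite algebra_simps)
  then show ?thesis
    using pure_spinor_indep4[of \<beta> \<gamma> "- \<alpha>" "- \<delta>"] unfolding assms by (simp add: lin_simps)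
qed

text \<open>Because \<open>a v = 0\<close> and \<open>a (b v) = - v\<close>, the vectors
  \<open>a (X v)\<close>, \<open>a (X (b v))\<close>, \<open>X v\<close> and \<open>X (b v)\<close>,
  taken in this order, isolate the words containing only \<open>b\<close>, neither, both, and only
  \<open>a\<close> among \<open>a\<close> and \<open>b\<close>. Each group of four is settled by the
  independence on \<open>v\<close>.\<close>

lemma pure_spinor_faithful:
  fixes g :: "nat \<Rightarrow> real"
  defines "X \<equiv> \<lambda>v. g 0 *\<^sub>R v + g 1 *\<^sub>R c\<^sub>4 (c\<^sub>5 v) + g 2 *\<^sub>R c\<^sub>1 (c\<^sub>4 v) + g 3 *\<^sub>R c\<^sub>1 (c\<^sub>5 v)
    + g 4 *\<^sub>R a (b v) + g 5 *\<^sub>R a (b (c\<^sub>4 (c\<^sub>5 v))) + g 6 *\<^sub>R a (b (c\<^sub>1 (c\<^sub>4 v))) + g 7 *\<^sub>R a (b (c\<^sub>1 (c\<^sub>5 v)))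
    + g 8 *\<^sub>R a (c\<^sub>1 v) + g 9 *\<^sub>R a (c\<^sub>4 v) + g 10 *\<^sub>R a (c\<^sub>5 v) + g 11 *\<^sub>R a (c\<^sub>1 (c\<^sub>4 (c\<^sub>5 v)))
    + g 12 *\<^sub>R b (c\<^sub>1 v) + g 13 *\<^sub>R b (c\<^sub>4 v) + g 14 *\<^sub>R b (c\<^sub>5 v) + g 15 *\<^sub>R b (c\<^sub>1 (c\<^sub>4 (c\<^sub>5 v)))"
  assumes X: "X v = 0" "X (b v) = 0"
  shows "\<forall>i<16. g i = 0"
proof -
  have "- a (X v) = (g 12 *\<^sub>R c\<^sub>1 v + g 13 *\<^sub>R c\<^sub>4 v + g 14 *\<^sub>R c\<^sub>5 v + g 15 *\<^sub>R c\<^sub>1 (c\<^sub>4 (c\<^sub>5 v)))"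
    by (simp add: X_def rewrite v_simps)
  then have 1: "g 12 = 0" "g 13 = 0" "g 14 = 0" "g 15 = 0"
    unfolding X lin_simps minus_zero using pure_spinor_indep4_odd[of "g 12" "g 13" "g 14" "g 15"] by auto
  have "- a (X (b v)) = (g 0 *\<^sub>R v + g 1 *\<^sub>R c\<^sub>4 (c\<^sub>5 v) + g 2 *\<^sub>R c\<^sub>1 (c\<^sub>4 v) + g 3 *\<^sub>R c\<^sub>1 (c\<^sub>5 v))"
    by (simp add: X_def rewrite v_simps)
  then have 2: "g 0 = 0" "g 1 = 0" "g 2 = 0" "g 3 = 0"
    unfolding X lin_simps minus_zero using pure_spinor_indep4[of "g 0" "g 1" "g 2" "g 3"] by auto
  have "- X v = (g 4 *\<^sub>R v + g 5 *\<^sub>R c\<^sub>4 (c\<^sub>5 v) + g 6 *\<^sub>R c\<^sub>1 (c\<^sub>4 v) + g 7 *\<^sub>R c\<^sub>1 (c\<^sub>5 v))"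
    by (simp add: X_def rewrite v_simps 1 2 2(2)[simplified])
  then have 3: "g 4 = 0" "g 5 = 0" "g 6 = 0" "g 7 = 0"
    unfolding X minus_zero using pure_spinor_indep4[of "g 4" "g 5" "g 6" "g 7"] by auto
  have "X (b v) = g 8 *\<^sub>R c\<^sub>1 v + g 9 *\<^sub>R c\<^sub>4 v + g 10 *\<^sub>R c\<^sub>5 v + g 11 *\<^sub>R c\<^sub>1 (c\<^sub>4 (c\<^sub>5 v))"
    by (simp add: X_def rewrite v_simps 1 2 3 2(2)[simplified])
  then have 4: "g 8 = 0" "g 9 = 0" "g 10 = 0" "g 11 = 0"
    unfolding X using pure_spinor_indep4_odd[of "g 8" "g 9" "g 10" "g 11"] by auto
  show ?thesis
    using 1 2 3 4 by (auto simp: eval_nat_numeral less_Suc_eq)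
qed

end

end

section \<open>The spin representation on \<open>H\<^sub>1(A)\<close>\<close>

text \<open>For \<open>u = a \<and> b\<close> this is \<open>x \<mapsto> f(a, x) b - f(b, x) a\<close>.\<close>

definition contraction :: "complex^6 \<Rightarrow> complex^4 \<Rightarrow> complex^4" where
  "contraction u x = vector
     [u$5 * cnj (x$1) + u$3 * cnj (x$2) - u$1 * cnj (x$4),
      u$4 * cnj (x$1) + u$6 * cnj (x$2) + u$1 * cnj (x$3),
      u$2 * cnj (x$2) + u$5 * cnj (x$3) + u$4 * cnj (x$4),
      u$3 * cnj (x$3) + u$6 * cnj (x$4) - u$2 * cnj (x$1)]"

lemmas vec4 = vec_eq_iff forall_4 vector_4_components

lemma contraction_wedge:
  "contraction (wedge a b) x = skew_form a x *s b - skew_form b x *s a"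
  by (simp add: contraction_def wedge_def skew_form_def vec4 algebra_simps)

text \<open>Through this adjunction, orthogonality of \<open>u\<close> to the exterior square of a
  plane says that the operator of \<open>u\<close> maps the plane into its orthogonal
  complement.\<close>

lemma skew_form_contraction: "skew_form (contraction u x) z = wedge_g u (wedge x z)"
  by (simp add: contraction_def wedge_def skew_form_def wedge_g_def vec4 algebra_simps)

lemma contraction_add_left: "contraction (u + v) x = contraction u x + contraction v x"
  and contraction_smult_left: "contraction (c *s u) x = c *s contraction u x"
  and contraction_add: "contraction u (x + z) = contraction u x + contraction u z"
  and contraction_smult: "contraction u (c *s x) = cnj c *s contraction u x"
  by (simp_all add: contraction_def vec4 algebra_simps)

lemma skew_form_add: "skew_form (x + z) w = skew_form x w + skew_form z w"
  "skew_form w (x + z) = skew_form w x + skew_form w z"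
  and skew_form_smult: "skew_form (c *s x) w = c * skew_form x w"
  "skew_form w (c *s x) = cnj c * skew_form w x"
  by (simp_all add: skew_form_def algebra_simps)

definition spin :: "complex^6 \<Rightarrow> complex^4 \<Rightarrow> complex^4" where
  "spin x = contraction (T_iso x)"

lemma T_iso_add: "T_iso (x + z) = T_iso x + T_iso z"
  and T_iso_smult: "T_iso (c *s x) = c *s T_iso x"
  by (simp_all add: T_iso_def vec_eq_iff forall_6 algebra_simps add_divide_distrib diff_divide_distrib)

lemma spin_add_left: "spin (x + z) v = spin x v + spin z v"
  and spin_smult_left: "spin (c *s x) v = c *s spin x v"
  and spin_add: "spin x (v + w) = spin x v + spin x w"
  and spin_smult: "spin x (c *s v) = cnj c *s spin x v"
  by (simp_all add: spin_def T_iso_add T_iso_smult contraction_add_left contraction_smult_left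
      contraction_add contraction_smult)

lemma spin_sum_left: "spin (\<Sum>i\<in>A. c i *s x i) v = (\<Sum>i\<in>A. c i *s spin (x i) v)"
proof (induction A rule: infinite_finite_induct)
  case empty
  have "spin (0 *s 0) v = 0 *s spin 0 v" by (rule spin_smult_left)
  then show ?case by simp
qed (simp_all add: spin_add_left spin_smult_left, use spin_smult_left[of 0 0 v] in simp)

text \<open>A composite of two contractions is antilinear in the inner bivector; the antilinear
  \<open>wedge_t\<close> makes both sides bilinear. At fixed points of \<open>wedge_t\<close>, that
  is in T(A), this is the Clifford relation for minus half the form.\<close>

lemma contraction_contraction:
  "contraction u (contraction (wedge_t w) v) + contraction w (contraction (wedge_t u) v)
     = - wedge_det u w *s v"
  by (simp add: contraction_def wedge_t_def wedge_det_def vec4 algebra_simps)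

lemma vmap_cnj_cnj [simp]: "vmap cnj (vmap cnj z) = z"
  by (simp add: vmap_def vec_eq_iff)

lemma wedge_det_T_iso: "wedge_det (T_iso x) (T_iso z) = gram_form T_gram x z"
proof -
  have "wedge_det (T_iso x) (T_iso z) = wedge_det (T_iso z) (T_iso x)"
    by (simp add: wedge_det_def algebra_simps)
  then show ?thesis
    using wedge_g_T_iso[of x "vmap cnj z"]
    by (simp add: wedge_g_eq_wedge_det wedge_t_T_iso)
qed

lemma spin_spin:
  "spin x (spin (vmap cnj z) v) + spin z (spin (vmap cnj x) v) = - gram_form T_gram x z *s v"
  using contraction_contraction[of "T_iso x" "T_iso z" v]
  by (simp add: spin_def wedge_t_T_iso wedge_det_T_iso)

lemma scaleR_eq_smult: "r *\<^sub>R v = complex_of_real r *s (v :: complex^'n)"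
  by (rule vec_eq_iff[THEN iffD2]) (simp add: scaleR_conv_of_real[where 'a=complex])

lemma linear_spin: "linear (spin x)"
  by (rule linearI) (simp_all add: spin_add scaleR_eq_smult spin_smult)

text \<open>
  The complex structure \<open>J\<close> of the fourfold in the coordinates given by an adapted basis.
\<close>

locale period =
  fixes J :: "complex^4 \<Rightarrow> complex^4"
  assumes linear_J: "linear J"
    and J_J: "J (J c) = - c"
    and J_ii: "J (\<i> *s c) = \<i> *s J c"
    and J_isometry: "Re (skew_form (J c) (J d)) = Re (skew_form c d)"
    and J_positive: "c \<noteq> 0 \<Longrightarrow> Re (skew_form (J c) c) > 0"
begin

definition plane :: "(complex^4) set" where
  "plane = {c. J c = \<i> *s c}"

definition coplane :: "(complex^4) set" where
  "coplane = {c. J c = - (\<i> *s c)}"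

lemma skew_form_J: "skew_form (J c) (J d) = skew_form c d"
  using J_isometry[of c d] J_isometry[of "\<i> *s c" d]
  by (simp add: J_ii skew_form_smult complex_eq_iff)

lemma plane_coplane_split: "c - \<i> *s J c \<in> plane" "c + \<i> *s J c \<in> coplane"
  by (simp_all add: plane_def coplane_def linear_add[OF linear_J] linear_diff[OF linear_J] J_ii J_J
      vec_eq_iff algebra_simps)

lemma skew_form_neg: "skew_form (- x) y = - skew_form x y"
  by (simp add: skew_form_def)

text \<open>Vectors of the two eigenspaces are orthogonal since \<open>J\<close> is an isometry.
  Conversely, the component \<open>p\<close> in the plane of a vector orthogonal to the plane
  satisfies \<open>skew_form p p = 0\<close>, and positivity forces it to vanish.\<close>

lemma skew_perp_plane: "skew_perp plane = coplane"
proof (intro equalityI subsetI)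
  have perp: "skew_form c d = 0" if "c \<in> coplane" "d \<in> plane" for c d
    using skew_form_J[of c d] that by (simp add: coplane_def plane_def skew_form_neg skew_form_smult)
  fix c
  show "c \<in> skew_perp plane" if "c \<in> coplane"
    using perp[OF that] by (simp add: skew_perp_def)
  assume c: "c \<in> skew_perp plane"
  define p where "p = c - \<i> *s J c"
  have p: "p \<in> plane" unfolding p_def by (rule plane_coplane_split)
  have "skew_form (p + (c + \<i> *s J c)) p = skew_form (2 *s c) p"
    by (rule arg_cong[of _ _ "\<lambda>x. skew_form x p"]) (simp add: p_def vec_eq_iff)
  then have "skew_form p p + skew_form (c + \<i> *s J c) p = 2 * skew_form c p"
    by (simp only: skew_form_add(1)[of p] skew_form_smult(1))
  then have "skew_form p p = 0"
    using c p unfolding perp[OF plane_coplane_split(2) p] by (simp add: skew_perp_def)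
  then have "p = 0"
    using p J_positive[of p] by (auto simp: plane_def skew_form_smult)
  then show "c \<in> coplane"
    by (auto simp: p_def coplane_def J_J vec_eq_iff)
qed

lemma subspace_plane: "subspace plane" and subspace_coplane: "subspace coplane"
  by (auto simp: subspace_def plane_def coplane_def linear_0[OF linear_J] linear_add[OF linear_J]
      linear_scale[OF linear_J] vec_eq_iff algebra_simps)

lemma complex_structure_eq:
  assumes dim: "dim plane = 4" "dim coplane = 4"
    and q: "gram_form T_gram p p = 1" "gram_form T_gram p q = 0"
      "gram_form T_gram p y = 0" "gram_form T_gram q y = 0" "gram_form T_gram y y = - 2 * of_nat \<Delta>"
    and real: "vmap cnj p = p" "vmap cnj q = q" "vmap cnj y = y"
    and \<Delta>: "\<Delta> > 0"
    and kill: "\<And>d. d \<in> plane \<Longrightarrow> spin (p + \<i> *s q) d = 0"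
    and y: "\<And>d. d \<in> plane \<Longrightarrow> spin y d \<in> coplane"
  shows "2 *s spin p (spin q c) = J c" and "spin y (J c) = J (spin y c)"
proof -
  let ?F = "\<lambda>c. 2 *s spin p (spin q c)"
  have yy: "spin y (spin y v) = of_nat \<Delta> *s v" for v
    using spin_spin[of y y v] q(5) by (simp add: real vec_eq_iff)
  have py: "spin p (spin y v) = - spin y (spin p v)" and qy: "spin q (spin y v) = - spin y (spin q v)" for v
    using spin_spin[of p y v] spin_spin[of q y v] q(3,4) by (simp_all add: real eq_neg_iff_add_eq_0)
  have pp: "2 *s spin p (spin p v) = - v" for v
    using spin_spin[of p p v] q(1) by (simp add: real vec_eq_iff)
  have neg: "spin x (- v) = - spin x v" for x v using linear_neg[OF linear_spin] .
  have Fy: "?F (spin y v) = spin y (?F v)" for v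
    by (simp add: py qy neg spin_smult)
  have F_plane: "?F d = J d" if d: "d \<in> plane" for d
  proof -
    have "spin p d = - (\<i> *s spin q d)"
      using kill[OF d] by (simp add: spin_add_left spin_smult_left eq_neg_iff_add_eq_0)
    \<comment> \<open>Antilinearity of \<open>spin p\<close> turns the factor \<open>- \<i>\<close>
      into \<open>\<i>\<close>. As the square of \<open>spin p\<close> is -1/2, the operator
      \<open>?F\<close> is multiplication by \<open>\<i>\<close> on the plane.\<close>
    then have sq: "spin p (spin p d) = \<i> *s spin p (spin q d)"
      by (simp add: neg spin_smult)
    have eq: "\<i> *s (2 *s (\<i> *s spin p (spin q d))) = \<i> *s (- d)"
      using pp[of d] unfolding sq by (rule arg_cong)
    have ii: "\<i> *s (2 *s (\<i> *s w)) = - (2 *s w)" for w :: "complex^4"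
      by (simp add: vec_eq_iff complex_eq_iff)
    have "- (2 *s spin p (spin q d)) = \<i> *s (- d)"
      using eq unfolding ii .
    moreover have "\<i> *s (- d) = - (\<i> *s d)" by (simp add: vec_eq_iff)
    ultimately show ?thesis
      using d by (simp only: plane_def mem_Collect_eq neg_equal_iff_equal)
  qed
  \<comment> \<open>The type (2,2) enters here: \<open>spin y\<close> is injective, its square being
    \<Delta>, and equal dimensions make the inclusion an equality.\<close>
  have image_y: "spin y ` plane = coplane"
  proof (rule subspace_dim_equal)
    have "inj (spin y)"
    proof (rule injI)
      fix v w assume "spin y v = spin y w"
      then have "spin y (spin y v) = spin y (spin y w)" by simp
      then show "v = w" using \<Delta> by (simp add: yy vec_eq_iff)
    qed
    then show "dim coplane \<le> dim (spin y ` plane)"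
      using eucl.dim_image_eq[OF linear_spin, of y plane] dim by (simp add: inj_on_subset)
    show "subspace (spin y ` plane)"
      by (rule linear_subspace_image[OF linear_spin subspace_plane])
  qed (use y subspace_coplane in auto)
  have F_coplane: "?F m = J m" if m: "m \<in> coplane" for m
  proof -
    obtain d where d: "d \<in> plane" "m = spin y d"
      using m unfolding image_y[symmetric] by auto
    \<comment> \<open>Pulling \<open>\<i>\<close> out of the antilinear \<open>spin y\<close>
      produces the eigenvalue \<open>- \<i>\<close>, which is that of \<open>J\<close> on the
      complement.\<close>
    have "?F m = spin y (\<i> *s d)"
      using F_plane[OF d(1)] d by (simp add: Fy plane_def)
    then show ?thesis using m d by (simp add: spin_smult coplane_def)
  qed
  have lin: "linear ?F"
    by (rule linearI) (simp_all add: scaleR_eq_smult spin_add spin_smult vec_eq_iff algebra_simps)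
  show F: "?F c = J c" for c
  proof -
    have c: "c = (1/2) *\<^sub>R ((c - \<i> *s J c) + (c + \<i> *s J c))"
      by (simp add: vec_eq_iff)
    have "?F (r *\<^sub>R (d + e)) = J (r *\<^sub>R (d + e))" if "d \<in> plane" "e \<in> coplane" for r d e
      unfolding linear_scale[OF lin] linear_add[OF lin] linear_scale[OF linear_J] linear_add[OF linear_J]
        F_plane[OF that(1)] F_coplane[OF that(2)] ..
    from this[OF plane_coplane_split, of "1/2" c c] show ?thesis by (simp only: c[symmetric])
  qed
  show "spin y (J c) = J (spin y c)"
    by (simp only: Fy flip: F)
qed

end

section \<open>Rational vectors and common denominators\<close>

definition gaussian_rational :: "(complex^4) set" where
  "gaussian_rational = {c. \<forall>k. Re (c $ k) \<in> \<rat> \<and> Im (c $ k) \<in> \<rat>}"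

lemma gaussian_rational_add: "c \<in> gaussian_rational \<Longrightarrow> d \<in> gaussian_rational \<Longrightarrow> c + d \<in> gaussian_rational"
  and gaussian_rational_scaleR: "r \<in> \<rat> \<Longrightarrow> c \<in> gaussian_rational \<Longrightarrow> r *\<^sub>R c \<in> gaussian_rational"
  by (auto simp: gaussian_rational_def)

text \<open>The map \<open>T_iso\<close> has coefficients in the Gaussian rationals, so rational
  vectors of T act on the rational homology.\<close>

lemma gaussian_rational_spin:
  assumes "c \<in> gaussian_rational"
  shows "spin (vmap of_rat x) c \<in> gaussian_rational"
  using assms unfolding gaussian_rational_def forall_4 mem_Collect_eq spin_def contraction_def
  by (simp add: vector_4_components T_iso_def vmap_def complex_of_rat Re_divide Im_divide Rats_add Rats_diff Rats_mult Rats_divide)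

lemma gaussian_lattice_add: "c \<in> gaussian_lattice \<Longrightarrow> d \<in> gaussian_lattice \<Longrightarrow> c + d \<in> gaussian_lattice"
  and gaussian_lattice_scaleR: "r \<in> \<int> \<Longrightarrow> c \<in> gaussian_lattice \<Longrightarrow> r *\<^sub>R c \<in> gaussian_lattice"
  and gaussian_lattice_0: "0 \<in> gaussian_lattice"
  by (auto simp: gaussian_lattice_def)

lemma gaussian_lattice_sum: "(\<And>i. i \<in> A \<Longrightarrow> f i \<in> gaussian_lattice) \<Longrightarrow> sum f A \<in> gaussian_lattice"
  by (induction A rule: infinite_finite_induct) (auto simp: gaussian_lattice_add gaussian_lattice_0)

lemma Basis_complex_vec:
  fixes b :: "complex^'n"
  assumes "b \<in> Basis"
  obtains k where "b = axis k 1" | k where "b = axis k \<i>"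
  using assms by (auto simp: Basis_vec_def Basis_complex_def)

lemma inner_Basis_gaussian_lattice:
  assumes "c \<in> gaussian_lattice" "b \<in> Basis"
  shows "c \<bullet> b \<in> \<int>"
  using assms
  by (auto elim!: Basis_complex_vec simp: gaussian_lattice_def inner_axis inner_complex_def)

lemma Basis_gaussian_rational: "b \<in> Basis \<Longrightarrow> b \<in> gaussian_rational"
  by (auto elim!: Basis_complex_vec simp: gaussian_rational_def axis_def)

lemma common_denominator:
  fixes R :: "real set"
  assumes "finite R" "R \<subseteq> \<rat>"
  shows "\<exists>n::nat. n > 0 \<and> (\<forall>r\<in>R. real n * r \<in> \<int>)"
  using assms
proof (induction R)
  case (insert r R)
  then obtain n :: nat where n: "n > 0" "\<forall>r\<in>R. real n * r \<in> \<int>" by auto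
  from insert obtain p q :: int where pq: "q > 0" "r = of_int p / of_int q"
    by (metis Rats_cases' insert_subset)
  have r: "real (n * nat q) * r = of_int (int n * p)" using pq by simp
  have "real (n * nat q) * s = of_int q * (real n * s)" for s using pq by simp
  then have "\<forall>s\<in>insert r R. real (n * nat q) * s \<in> \<int>"
    using n(2) r by (metis Ints_mult Ints_of_int insert_iff)
  then show ?case using n(1) pq(1) by (intro exI[of _ "n * nat q"]) simp
qed auto

lemma gaussian_common_denominator:
  assumes "finite S" "S \<subseteq> gaussian_rational"
  shows "\<exists>n::nat. n > 0 \<and> (\<forall>c\<in>S. real n *\<^sub>R c \<in> gaussian_lattice)"
proof -
  have "\<exists>n::nat. n > 0 \<and> (\<forall>r\<in>(\<Union>c\<in>S. range (\<lambda>k. Re (c $ k)) \<union> range (\<lambda>k. Im (c $ k))). real n * r \<in> \<int>)"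
    using assms by (intro common_denominator) (auto simp: gaussian_rational_def)
  then show ?thesis by (fastforce simp: gaussian_lattice_def)
qed

lemma gaussian_rational_linear_denominator:
  fixes h :: "complex^4 \<Rightarrow> complex^4"
  assumes "linear h" "\<And>c. c \<in> gaussian_rational \<Longrightarrow> h c \<in> gaussian_rational"
  shows "\<exists>n::nat. n > 0 \<and> (\<forall>c\<in>gaussian_lattice. real n *\<^sub>R h c \<in> gaussian_lattice)"
proof -
  have sub: "h ` Basis \<subseteq> gaussian_rational"
    using assms(2) Basis_gaussian_rational by auto
  obtain n :: nat where n: "n > 0" "\<forall>c\<in>h ` Basis. real n *\<^sub>R c \<in> gaussian_lattice"
    using gaussian_common_denominator[OF _ sub] by auto
  have "real n *\<^sub>R h c \<in> gaussian_lattice" if c: "c \<in> gaussian_lattice" for c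
  proof -
    have "real n *\<^sub>R h c = real n *\<^sub>R h (\<Sum>b\<in>Basis. (c \<bullet> b) *\<^sub>R b)"
      by (simp add: euclidean_representation)
    also have "\<dots> = (\<Sum>b\<in>Basis. (c \<bullet> b) *\<^sub>R (real n *\<^sub>R h b))"
      by (simp add: linear_sum[OF assms(1)] linear_scale[OF assms(1)] scaleR_sum_right mult.commute)
    also have "\<dots> \<in> gaussian_lattice"
      by (intro gaussian_lattice_sum, rule gaussian_lattice_scaleR)
         (use n(2) inner_Basis_gaussian_lattice[OF c] in auto)
    finally show ?thesis .
  qed
  then show ?thesis using n(1) by blast
qed

section \<open>Isogenies and Gaussian fourfolds\<close>

lemma int_spanI: "(\<Sum>b\<in>B. of_int (n b) *\<^sub>R b) \<in> int_span B"
  unfolding int_span_def by (rule CollectI) (rule exI[of _ n], simp)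

lemma int_span_diff:
  assumes "v \<in> int_span B" "w \<in> int_span B"
  shows "v - w \<in> int_span B"
proof -
  obtain m n where "v = (\<Sum>b\<in>B. of_int (m b) *\<^sub>R b)" "w = (\<Sum>b\<in>B. of_int (n b) *\<^sub>R b)"
    using assms by (auto simp: int_span_def)
  then have "v - w = (\<Sum>b\<in>B. of_int (m b - n b) *\<^sub>R b)"
    by (simp add: sum_subtractf algebra_simps)
  then show ?thesis by (simp only: int_spanI)
qed

lemma int_span_base:
  assumes "finite B" "b \<in> B"
  shows "b \<in> int_span B"
  using int_spanI[of "\<lambda>c. if c = b then 1 else 0" B] assms
  by (simp add: if_distrib[of of_int] if_distrib[of "\<lambda>x. x *\<^sub>R _"] cong: if_cong)

lemma tspace_int_span:
  assumes "lat X = int_span B" "finite B"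
  shows "tspace X = span B"
proof (rule subset_antisym)
  have "B \<subseteq> lat X"
    using int_span_base[OF assms(2)] by (auto simp: assms(1))
  then show "span B \<subseteq> tspace X" unfolding tspace_def by (rule span_mono)
  have "lat X \<subseteq> span B"
    unfolding assms(1) int_span_def by (auto intro: span_sum[OF span_scale[OF span_base]])
  then show "tspace X \<subseteq> span B" unfolding tspace_def by (rule span_minimal) simp
qed

text \<open>Every class of the kernel has a representative in a fundamental parallelotope of the
  lattice of \<open>X\<close>, whose image is bounded; only finitely many points of the target
  lattice are bounded, and \<open>h\<close> is injective. The map \<open>\<pi>\<close> supplies the
  norm, as the target is only a real vector space.\<close>

lemma isogeny_if_bijective:
  fixes X :: "'v::real_vector torus" and Y :: "'w::real_vector torus"
    and \<pi> :: "'w \<Rightarrow> 'e::real_normed_vector"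
  assumes X: "complex_torus X" and h: "h \<in> torus_hom X Y"
    and surj: "h ` tspace X = tspace Y" and inj: "inj_on h (tspace X)"
    and Y: "\<And>v w. v \<in> lat Y \<Longrightarrow> w \<in> lat Y \<Longrightarrow> v - w \<in> lat Y"
    and \<pi>: "linear \<pi>" "\<And>r. finite {w \<in> lat Y. norm (\<pi> w) \<le> r}"
  shows "isogeny X Y h"
proof -
  obtain B where B: "finite B" "lat X = int_span B"
    using X by (auto simp: complex_torus_def)
  have lin: "linear h" and lat: "h ` lat X \<subseteq> lat Y"
    using h by (auto simp: torus_hom_def)
  have span: "tspace X = span B" using tspace_int_span[OF B(2,1)] .
  have lin': "linear (\<lambda>v. \<pi> (h v))"
    using linear_compose[OF lin \<pi>(1)] by (simp add: comp_def)
  define r where "r = (\<Sum>b\<in>B. norm (\<pi> (h b)))"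
  let ?R = "{(u, v). u - v \<in> lat X}"
  let ?S = "{v \<in> tspace X. h v \<in> lat Y}"
  let ?F = "{v \<in> tspace X. h v \<in> lat Y \<and> norm (\<pi> (h v)) \<le> r}"
  have "finite ?F"
  proof (rule finite_imageD)
    show "finite (h ` ?F)" by (rule finite_subset[OF _ \<pi>(2)[of r]]) auto
    show "inj_on h ?F" by (rule inj_on_subset[OF inj]) auto
  qed
  moreover have "?S // ?R \<subseteq> (\<lambda>v. ?R `` {v}) ` ?F"
  proof
    fix C assume "C \<in> ?S // ?R"
    then obtain v where v: "v \<in> tspace X" "h v \<in> lat Y" "C = ?R `` {v}"
      by (auto simp: quotient_def)
    obtain t where t: "v = (\<Sum>b\<in>B. t b *\<^sub>R b)"
      using v(1) unfolding span span_finite[OF B(1)] by auto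
    \<comment> \<open>Fractional parts of the coordinates: the representative of \<open>v\<close> in
      the fundamental parallelotope.\<close>
    define v' where "v' = (\<Sum>b\<in>B. frac (t b) *\<^sub>R b)"
    have "v - v' = (\<Sum>b\<in>B. of_int \<lfloor>t b\<rfloor> *\<^sub>R b)"
      by (simp add: t v'_def frac_def sum_subtractf algebra_simps)
    then have lat1: "v - v' \<in> lat X" unfolding B(2) by (simp only: int_spanI)
    have lat2: "v' - v \<in> lat X"
      using int_span_diff[OF int_span_diff[of "v - v'" B "v - v'"], of "v - v'"] lat1 B(2) by simp
    have "?R `` {v} = ?R `` {v'}"
    proof -
      have "v - w \<in> lat X \<longleftrightarrow> v' - w \<in> lat X" for w
        using int_span_diff[of "v - w" B "v - v'"] int_span_diff[of "v' - w" B "v' - v"] lat1 lat2 B(2)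
        by auto
      then show ?thesis by auto
    qed
    moreover have "v' \<in> ?F"
    proof (intro CollectI conjI)
      show "v' \<in> tspace X" unfolding span v'_def by (intro span_sum span_scale span_base)
      have "h v' = h v - h (v - v')" by (simp add: linear_diff[OF lin])
      then show "h v' \<in> lat Y" using Y v(2) lat lat1 by (metis imageI subsetD)
      have "\<pi> (h v') = (\<Sum>b\<in>B. frac (t b) *\<^sub>R \<pi> (h b))"
        unfolding v'_def by (simp add: linear_sum[OF lin'] linear_scale[OF lin'])
      also have "norm \<dots> \<le> r"
        unfolding r_def
      proof (rule sum_norm_le)
        fix b
        show "norm (frac (t b) *\<^sub>R \<pi> (h b)) \<le> norm (\<pi> (h b))"
          using frac_ge_0[of "t b"] frac_lt_1[of "t b"] by (simp add: mult_left_le_one_le)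
      qed
      finally show "norm (\<pi> (h v')) \<le> r" .
    qed
    ultimately show "C \<in> (\<lambda>v. ?R `` {v}) ` ?F" using v(3) by blast
  qed
  ultimately have "finite (?S // ?R)" by (meson finite_imageI finite_subset)
  then show ?thesis using h surj unfolding isogeny_def by blast
qed

lemma finite_bounded_Ints: "finite {x::real. x \<in> \<int> \<and> \<bar>x\<bar> \<le> r}"
proof (rule finite_subset)
  show "{x::real. x \<in> \<int> \<and> \<bar>x\<bar> \<le> r} \<subseteq> real_of_int ` {- \<lceil>r\<rceil>..\<lceil>r\<rceil>}"
  proof
    fix x :: real assume "x \<in> {x. x \<in> \<int> \<and> \<bar>x\<bar> \<le> r}"
    then obtain n where "x = of_int n" "\<bar>x\<bar> \<le> r" by (auto elim: Ints_cases)
    then show "x \<in> real_of_int ` {- \<lceil>r\<rceil>..\<lceil>r\<rceil>}" by (intro image_eqI[of _ _ n]) (auto, linarith+)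
  qed
qed simp

lemma finite_bounded_gaussian_lattice: "finite {c \<in> gaussian_lattice. norm c \<le> r}"
proof -
  let ?Z = "{x::real. x \<in> \<int> \<and> \<bar>x\<bar> \<le> r}"
  let ?C = "(\<lambda>(x, y). Complex x y) ` (?Z \<times> ?Z)"
  have fin: "finite ?C" by (intro finite_imageI finite_cartesian_product finite_bounded_Ints)
  have "{c \<in> gaussian_lattice. norm c \<le> r} \<subseteq> (\<lambda>(p, q, s, t). vector [p, q, s, t]) ` (?C \<times> ?C \<times> ?C \<times> ?C)"
  proof
    fix c :: "complex^4" assume c: "c \<in> {c \<in> gaussian_lattice. norm c \<le> r}"
    have k: "c $ k \<in> ?C" for k
    proof (rule image_eqI)
      show "c $ k = (\<lambda>(x, y). Complex x y) (Re (c $ k), Im (c $ k))" by simp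
      have "norm (c $ k) \<le> r" using c Finite_Cartesian_Product.norm_nth_le[of c k] by auto
      then show "(Re (c $ k), Im (c $ k)) \<in> ?Z \<times> ?Z"
        using c abs_Re_le_cmod[of "c $ k"] abs_Im_le_cmod[of "c $ k"] by (auto simp: gaussian_lattice_def)
    qed
    show "c \<in> (\<lambda>(p, q, s, t). vector [p, q, s, t]) ` (?C \<times> ?C \<times> ?C \<times> ?C)"
      by (rule image_eqI[of _ _ "(c $ 1, c $ 2, c $ 3, c $ 4)"])
         (simp add: vec_eq_iff forall_4 vector_4_components, use k in blast)
  qed
  then show ?thesis by (rule finite_subset) (intro finite_imageI finite_cartesian_product fin)
qed

section \<open>Coordinates on the homology of the fourfold\<close>

lemma skew_form_nondegenerate:
  assumes "\<And>d. Re (skew_form c d) = 0"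
  shows "c = 0"
proof -
  have "Re (skew_form c (axis k 1)) = 0" "Re (skew_form c (axis k \<i>)) = 0" for k using assms by auto
  from this[of 1] this[of 2] this[of 3] this[of 4] show ?thesis
    by (simp add: skew_form_def axis_def vec_eq_iff forall_4 complex_eq_iff)
qed

locale gaussian_fourfold =
  fixes A :: "'v::real_vector torus" and E :: "'v \<Rightarrow> 'v \<Rightarrow> real" and \<iota> :: "'v \<Rightarrow> 'v" and \<beta> :: "'v^4"
  assumes ppav: "gaussian_ppav4 A E \<iota>" and adapted: "adapted_basis A E \<iota> \<beta>"
begin

abbreviation "comb \<equiv> gaussian_comb \<iota> \<beta>"

lemma linear_\<iota>: "linear \<iota>"
  using ppav by (simp add: gaussian_ppav4_def torus_hom_def)

lemma linear_comb: "linear comb"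
  by (rule linearI)
     (simp_all add: gaussian_comb_def sum.distrib algebra_simps scaleR_sum_right)

lemma lat_eq: "lat A = comb ` gaussian_lattice"
  using adapted by (simp add: adapted_basis_def bij_betw_def)

lemma range_comb: "range comb = tspace A"
proof -
  have "Basis \<subseteq> (gaussian_lattice :: (complex^4) set)"
    by (auto elim!: Basis_complex_vec simp: gaussian_lattice_def axis_def)
  then have "span (gaussian_lattice :: (complex^4) set) = UNIV"
    using span_mono span_Basis by blast
  then show ?thesis
    unfolding tspace_def lat_eq using linear_span_image[OF linear_comb, of gaussian_lattice] by simp
qed

lemma E_comb: "E (comb c) (comb d) = Re (skew_form c d)"
  using adapted by (simp add: adapted_basis_def)

lemma inj_comb: "inj comb"
proof (rule linear_injective_0[OF linear_comb, THEN iffD2, rule_format])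
  fix c assume "comb c = 0"
  moreover have "E 0 (comb d) = 0" for d
    using ppav by (auto simp: gaussian_ppav4_def principal_polarization_def dest: bilinear_lzero)
  ultimately have "Re (skew_form c d) = 0" for d using E_comb[of c d] by simp
  then show "c = 0" by (rule skew_form_nondegenerate)
qed

text \<open>Endomorphisms of a torus have to be linear on the whole ambient type, so a linear left
  inverse of \<open>comb\<close> is chosen there; only its values on \<open>tspace A\<close> are
  determined.\<close>

definition coord :: "'v \<Rightarrow> complex^4" where
  "coord = (SOME g. linear g \<and> g \<circ> comb = id)"

lemma linear_coord: "linear coord" and coord_comb [simp]: "coord (comb c) = c"
proof -
  have "linear coord \<and> coord \<circ> comb = id"
    unfolding coord_def
    by (rule someI_ex[OF real_vector.linear_injective_left_inverse[OF linear_comb inj_comb]])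
  then show "linear coord" "coord (comb c) = c" by (auto simp: fun_eq_iff)
qed

lemma comb_coord: "v \<in> tspace A \<Longrightarrow> comb (coord v) = v"
  by (metis coord_comb rangeE range_comb)

lemma comb_in_tspace [simp]: "comb c \<in> tspace A"
  using range_comb by blast

lemma \<iota>_comb: "\<iota> (comb c) = comb (\<i> *s c)"
proof -
  have "comb (axis k 1) = \<beta> $ k" for k
  proof -
    have "comb (axis k 1) = (\<Sum>j\<in>UNIV. if j = k then \<beta> $ k else 0)"
      unfolding gaussian_comb_def by (rule sum.cong) (auto simp: axis_def)
    then show ?thesis by simp
  qed
  then have "\<beta> $ k \<in> tspace A" for k by (metis comb_in_tspace)
  then have "\<iota> (\<iota> (\<beta> $ k)) = - \<beta> $ k" for k using ppav by (simp add: gaussian_ppav4_def)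
  then show ?thesis
    by (simp add: gaussian_comb_def linear_sum[OF linear_\<iota>] linear_add[OF linear_\<iota>]
        linear_scale[OF linear_\<iota>] algebra_simps)
qed

definition J :: "complex^4 \<Rightarrow> complex^4" where
  "J c = coord (cstr A (comb c))"

lemma cstr_comb: "cstr A (comb c) = comb (J c)"
proof -
  have "cstr A (comb c) \<in> tspace A"
    using ppav by (simp add: gaussian_ppav4_def complex_torus_def)
  then show ?thesis by (simp add: J_def comb_coord)
qed

sublocale period J
proof (rule period.intro)
  have torus: "complex_torus A" "principal_polarization A E" "\<iota> \<in> torus_hom A A"
    using ppav by (auto simp: gaussian_ppav4_def)
  show "linear J"
    using linear_compose[OF linear_compose[OF linear_comb, of "cstr A"] linear_coord] torus(1)
    by (simp add: complex_torus_def J_def[abs_def] comp_def)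
  have comb_eqD: "c = d" if "comb c = comb d" for c d using that inj_comb by (auto dest: injD)
  show "J (J c) = - c" for c
    using torus(1) linear_neg[OF linear_comb]
    by (intro comb_eqD) (auto simp: complex_torus_def simp flip: cstr_comb)
  show "J (\<i> *s c) = \<i> *s J c" for c
    using torus(3) by (intro comb_eqD) (simp add: torus_hom_def flip: cstr_comb \<iota>_comb)
  show "Re (skew_form (J c) (J d)) = Re (skew_form c d)" for c d
    using torus(2) by (simp add: principal_polarization_def cstr_comb flip: E_comb) (simp flip: cstr_comb)
  show "Re (skew_form (J c) c) > 0" if "c \<noteq> 0" for c
  proof -
    have "comb c \<noteq> 0" using that comb_eqD[of c 0] linear_0[OF linear_comb] by auto
    then show ?thesis
      using torus(2) by (simp add: principal_polarization_def flip: E_comb cstr_comb)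
  qed
qed

lemma comb_eq_iff: "comb c = comb d \<longleftrightarrow> c = d"
  using inj_comb by (auto dest: injD)

lemma period_plane_eq: "period_plane A \<iota> \<beta> = plane"
  by (simp add: period_plane_def plane_def cstr_comb \<iota>_comb comb_eq_iff)

lemma dim_plane: "dim plane = 4" and dim_coplane: "dim coplane = 4"
proof -
  have neg: "- comb c = comb (- c)" for c using linear_neg[OF linear_comb] by simp
  have "{v \<in> tspace A. \<iota> v = cstr A v} = comb ` plane"
    "{v \<in> tspace A. \<iota> v = - cstr A v} = comb ` coplane"
    unfolding range_comb[symmetric] plane_def coplane_def
    by (auto simp: cstr_comb \<iota>_comb comb_eq_iff neg image_iff)
  then have "dim (comb ` plane) = 4" "dim (comb ` coplane) = 4"
    using ppav by (simp_all add: gaussian_ppav4_def)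
  then show "dim plane = 4" "dim coplane = 4"
    using eucl.dim_image_eq[OF linear_comb inj_on_subset[OF inj_comb subset_UNIV]] by auto
qed

lemma torus_End_Q_comb:
  assumes h: "linear h" "\<And>c. c \<in> gaussian_rational \<Longrightarrow> h c \<in> gaussian_rational"
    and J: "\<And>c. h (J c) = J (h c)"
  shows "(\<lambda>v. comb (h (coord v))) \<in> torus_End_Q A"
proof -
  obtain n :: nat where n: "n > 0" "\<forall>c\<in>gaussian_lattice. real n *\<^sub>R h c \<in> gaussian_lattice"
    using gaussian_rational_linear_denominator[OF h] by blast
  have lin: "linear (\<lambda>v. comb (h (coord v)))"
    using linear_compose[OF linear_compose[OF linear_coord h(1)] linear_comb] by (simp add: comp_def)
  have "(\<lambda>v. real n *\<^sub>R comb (h (coord v))) \<in> torus_hom A A"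
    unfolding torus_hom_def
  proof (intro CollectI conjI ballI)
    show "linear (\<lambda>v. real n *\<^sub>R comb (h (coord v)))"
      by (rule linear_compose_scale_right[OF lin])
    show "(\<lambda>v. real n *\<^sub>R comb (h (coord v))) ` lat A \<subseteq> lat A"
      using n(2) by (auto simp: lat_eq simp flip: linear_scale[OF linear_comb])
    have cA: "linear (cstr A)" using ppav by (simp add: gaussian_ppav4_def complex_torus_def)
    fix v assume "v \<in> tspace A"
    then obtain c where "v = comb c" using comb_coord by metis
    then show "real n *\<^sub>R comb (h (coord (cstr A v))) = cstr A (real n *\<^sub>R comb (h (coord v)))"
      by (simp add: linear_scale[OF cA] cstr_comb J)
  qed
  then show ?thesis using n(1) lin by (auto simp: torus_End_Q_def)
qed

end

section \<open>The spin representation of the orthogonal complement of \<open>y\<close>\<close>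

lemma exhaust_5: "x = 1 \<or> x = 2 \<or> x = 3 \<or> x = 4 \<or> x = 5" for x :: 5
proof (induct x)
  case (of_int z)
  then have "z = 0 \<or> z = 1 \<or> z = 2 \<or> z = 3 \<or> z = 4" by fastforce
  then show ?case by auto
qed

lemma UNIV_5: "UNIV = {1, 2, 3, 4, 5::5}"
  using exhaust_5 by auto

lemma vector_5 [simp]:
  "(vector [a, b, c, d, e] :: 'a::zero^5) $ 1 = a"
  "(vector [a, b, c, d, e] :: 'a::zero^5) $ 2 = b"
  "(vector [a, b, c, d, e] :: 'a::zero^5) $ 3 = c"
  "(vector [a, b, c, d, e] :: 'a::zero^5) $ 4 = d"
  "(vector [a, b, c, d, e] :: 'a::zero^5) $ 5 = e"
  "(vector [a, b, c, d, e] :: 'a::zero^5) $ 0 = e"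
  unfolding vector_def by simp_all

lemma transpose_T_Delta_gram: "transpose (T_Delta_gram \<Delta>) = T_Delta_gram \<Delta>"
proof -
  have "T_Delta_gram \<Delta> $ i $ j = T_Delta_gram \<Delta> $ j $ i" for i j
    using exhaust_5[of i] exhaust_5[of j] by (auto simp: T_Delta_gram_def)
  then show ?thesis by (simp add: transpose_def vec_eq_iff)
qed

text \<open>The even sublists of \<open>[2, 3, 1, 4, 5]\<close>. The isotropic pair 2, 3 comes
  first, so that the words have the shape used in \<open>pure_spinor_faithful\<close>.\<close>

definition spinor_words :: "5 list list" where
  "spinor_words = [[2, 3, 1, 4], [2, 3, 1, 5], [2, 3, 4, 5], [2, 3], [2, 1, 4, 5], [2, 1], [2, 4], [2, 5], 
     [3, 1, 4, 5], [3, 1], [3, 4], [3, 5], [1, 4], [1, 5], [4, 5], []]"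

lemma even_subseqs_5: "{w \<in> set (subseqs [2, 3, 1, 4, 5 :: 5]). even (length w)} = set spinor_words"
proof -
  have "filter (\<lambda>w. even (length w)) (subseqs [2, 3, 1, 4, 5]) = spinor_words"
    by (simp add: spinor_words_def Let_def)
  then show ?thesis by (metis set_filter)
qed

lemma distinct_spinor_words: "distinct spinor_words"
  by (simp add: spinor_words_def)

lemma spin_spin_rat:
  "spin (vmap of_rat x) (spin (vmap of_rat z) v) + spin (vmap of_rat z) (spin (vmap of_rat x) v)
     = - of_rat (gram_form T_gram x z) *\<^sub>R v"
proof -
  have cnj: "vmap cnj (vmap of_rat x) = vmap of_rat x" for x :: "rat^6"
    by (simp add: vmap_def complex_of_rat)
  show ?thesis
    using spin_spin[of "vmap of_rat x" "vmap of_rat z" v]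
    by (simp add: cnj gram_form_of_rat scaleR_eq_smult complex_of_rat vec_eq_iff)
qed

text \<open>The data after transport by \<open>\<sigma>\<close>: \<open>e\<close> is a frame of the
  complement of \<open>y\<close> with Gram matrix \<open>T_Delta_gram\<close>, and \<open>f\<close>,
  \<open>g\<close> are the coordinates of the two vectors whose product gives the complex structure
  of the Kuga-Satake variety.\<close>

locale spin_fourfold = gaussian_fourfold A E \<iota> \<beta>
  for A :: "'v::real_vector torus" and E \<iota> \<beta> +
  fixes \<Delta> :: nat and e :: "5 \<Rightarrow> rat^6" and y :: "rat^6" and f g :: "real^5"
  assumes \<Delta>: "\<Delta> > 0"
    and gram_e: "\<And>i j. gram_form T_gram (e i) (e j) = T_Delta_gram \<Delta> $ i $ j"
    and gram_e_y: "\<And>i. gram_form T_gram (e i) y = 0"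
    and gram_y: "gram_form T_gram y y = - 2 * of_nat \<Delta>"
    and gram_f_g: "gram_form (T_Delta_gram \<Delta>) f f = 1" "gram_form (T_Delta_gram \<Delta>) f g = 0"
    and hodge: "T_iso (\<Sum>i\<in>UNIV. Complex (f $ i) (g $ i) *s vmap of_rat (e i))
      \<in> wedge_span (skew_perp plane) (skew_perp plane)"
    and y_perp: "\<And>c d. c \<in> plane \<Longrightarrow> d \<in> plane \<Longrightarrow> wedge_g (T_iso (vmap of_rat y)) (wedge c d) = 0"
begin

definition k :: "5 \<Rightarrow> complex^4 \<Rightarrow> complex^4" where
  "k i = spin (vmap of_rat (e i))"

definition \<kappa> :: "complex^4 \<Rightarrow> complex^4" where
  "\<kappa> = spin (vmap of_rat y)"

lemma linear_k: "linear (k i)" and linear_\<kappa>: "linear \<kappa>"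
  by (simp_all add: k_def \<kappa>_def linear_spin)

lemma k_k: "k i (k j v) + k j (k i v) = - of_rat (T_Delta_gram \<Delta> $ i $ j) *\<^sub>R v"
  unfolding k_def spin_spin_rat gram_e ..

lemma k_\<kappa>: "\<kappa> (k i v) = - k i (\<kappa> v)"
  using spin_spin_rat[of "e i" y v] by (simp add: k_def \<kappa>_def gram_e_y eq_neg_iff_add_eq_0 add.commute)

lemma \<kappa>_\<kappa>: "\<kappa> (\<kappa> v) = real \<Delta> *\<^sub>R v"
proof -
  have "2 *\<^sub>R \<kappa> (\<kappa> v) = 2 *\<^sub>R (real \<Delta> *\<^sub>R v)"
    using spin_spin_rat[of y y v] by (simp add: \<kappa>_def gram_y scaleR_2 of_rat_mult of_rat_minus)
  then show ?thesis by (rule real_vector.scale_left_imp_eq[rotated]) simp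
qed

lemma gaussian_rational_k: "c \<in> gaussian_rational \<Longrightarrow> k i c \<in> gaussian_rational"
  and gaussian_rational_\<kappa>: "c \<in> gaussian_rational \<Longrightarrow> \<kappa> c \<in> gaussian_rational"
  by (simp_all add: k_def \<kappa>_def gaussian_rational_spin)

abbreviation comb_e :: "real^5 \<Rightarrow> complex^6" where
  "comb_e h \<equiv> \<Sum>i\<in>UNIV. complex_of_real (h $ i) *s vmap of_rat (e i)"

lemma spin_comb_e: "spin (comb_e h) v = (\<Sum>i\<in>UNIV. h $ i *\<^sub>R k i v)"
  by (simp add: spin_sum_left k_def scaleR_eq_smult)

lemma gram_comb_e:
  "gram_form T_gram (comb_e h) (comb_e h') = complex_of_real (gram_form (T_Delta_gram \<Delta>) h h')"
  by (simp add: gram_form_sum gram_form_smult gram_form_of_rat gram_e,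
      simp add: gram_form_def sum_distrib_left complex_of_rat mult_ac, rule sum.swap)

lemma J_eq: "2 *s spin (comb_e f) (spin (comb_e g) c) = J c" and \<kappa>_J: "\<kappa> (J c) = J (\<kappa> c)"
proof -
  have cnj: "vmap cnj (comb_e h) = comb_e h" "vmap cnj (vmap of_rat y) = vmap of_rat y" for h
    by (simp_all add: vmap_def complex_of_rat vec_eq_iff)
  have hy: "gram_form T_gram (comb_e h) (vmap of_rat y) = 0" for h
    by (simp add: gram_form_sum gram_form_smult gram_form_of_rat gram_e_y)
  have yy: "gram_form T_gram (vmap of_rat y) (vmap of_rat y) = - 2 * of_nat \<Delta>"
    unfolding gram_form_of_rat gram_y by (simp add: of_rat_mult of_rat_minus)
  have "comb_e f + \<i> *s comb_e g = (\<Sum>i\<in>UNIV. Complex (f $ i) (g $ i) *s vmap of_rat (e i))"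
    by (simp add: vec_eq_iff sum_distrib_left Complex_eq algebra_simps flip: sum.distrib)
  then have span: "T_iso (comb_e f + \<i> *s comb_e g) \<in> wedge_span (skew_perp plane) (skew_perp plane)"
    using hodge by simp
  \<comment> \<open>By \<open>contraction_wedge\<close>, bivectors of the orthogonal complement kill
    the plane.\<close>
  have kill: "spin (comb_e f + \<i> *s comb_e g) d = 0" if d: "d \<in> plane" for d
    using span unfolding spin_def wedge_span_def
  proof (induction rule: vec.span_induct_alt)
    case base
    show ?case using contraction_smult_left[of 0 0 d] by simp
  next
    case (step c u v)
    then show ?case using d
      by (auto simp: contraction_add_left contraction_smult_left contraction_wedge skew_perp_def)
  qed
  have plane: "spin (vmap of_rat y) d \<in> coplane" if "d \<in> plane" for d
    using y_perp that unfolding skew_perp_plane[symmetric] skew_perp_def spin_def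
    by (simp add: skew_form_contraction)
  note * = complex_structure_eq[OF dim_plane dim_coplane _ _ hy hy yy cnj(1,1,2) \<Delta> kill plane]
  show "2 *s spin (comb_e f) (spin (comb_e g) c) = J c" "\<kappa> (J c) = J (\<kappa> c)"
    using * gram_f_g by (simp_all add: gram_comb_e \<kappa>_def)
qed

sublocale spin_operators "k 2" "k 3" "k 1" "k 4" "k 5" \<kappa> "real \<Delta>"
proof
  have sq: "k i (k i v) = - (of_rat (T_Delta_gram \<Delta> $ i $ i) / 2) *\<^sub>R v" for i v
  proof -
    have "2 *\<^sub>R k i (k i v) = 2 *\<^sub>R (- (of_rat (T_Delta_gram \<Delta> $ i $ i) / 2) *\<^sub>R v)"
      using k_k[of i i v] by (simp add: scaleR_2)
    then show ?thesis by (rule real_vector.scale_left_imp_eq[rotated]) simp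
  qed
  show "k 2 (k 2 v) = 0" "k 3 (k 3 v) = 0" "k 1 (k 1 v) = - real \<Delta> *\<^sub>R v" "k 4 (k 4 v) = v"
    "k 5 (k 5 v) = v" for v
    unfolding sq by (simp_all add: T_Delta_gram_def of_rat_mult)
  show "k 2 (k 3 v) = - v - k 3 (k 2 v)" for v
    using k_k[of 2 3 v] by (simp add: T_Delta_gram_def eq_diff_eq)
  have anti: "k i (k j v) = - k j (k i v)" if "T_Delta_gram \<Delta> $ i $ j = 0" for i j v
    using k_k[of i j v] that by (simp add: eq_neg_iff_add_eq_0)
  show "k 2 (k 1 v) = - k 1 (k 2 v)" "k 2 (k 4 v) = - k 4 (k 2 v)" "k 2 (k 5 v) = - k 5 (k 2 v)"
    "k 1 (k 3 v) = - k 3 (k 1 v)" "k 4 (k 3 v) = - k 3 (k 4 v)" "k 5 (k 3 v) = - k 3 (k 5 v)"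
    "k 4 (k 1 v) = - k 1 (k 4 v)" "k 5 (k 1 v) = - k 1 (k 5 v)" "k 5 (k 4 v) = - k 4 (k 5 v)" for v
    by (rule anti, simp add: T_Delta_gram_def)+
qed (use linear_k linear_\<kappa> \<Delta> \<kappa>_\<kappa> k_\<kappa> in \<open>simp_all add: linear_iff\<close>)

end

lemma span_Times_0:
  fixes S :: "'a::real_vector set" and T :: "'b::real_vector set"
  assumes "0 \<in> S" "0 \<in> T"
  shows "span (S \<times> T) = span S \<times> span T"
proof (rule subset_antisym)
  show "span (S \<times> T) \<subseteq> span S \<times> span T"
    by (rule span_minimal) (auto simp: subspace_Times intro: span_base)
  have l: "linear (\<lambda>x::'a. (x, 0::'b))" and r: "linear (\<lambda>x::'b. (0::'a, x))"
    by (auto intro!: linearI)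
  have "(\<lambda>x. (x, 0)) ` span S \<subseteq> span (S \<times> T)" "(\<lambda>x. (0, x)) ` span T \<subseteq> span (S \<times> T)"
    unfolding linear_span_image[OF l, symmetric] linear_span_image[OF r, symmetric]
    using assms by (auto intro!: span_mono)
  then have "(x, 0) + (0, z) \<in> span (S \<times> T)" if "x \<in> span S" "z \<in> span T" for x z
    using that by (intro span_add) auto
  then show "span S \<times> span T \<subseteq> span (S \<times> T)" by auto
qed

text \<open>This operator converts the polarization into the standard inner product, in which
  \<open>clifford_module\<close> is phrased; it is thus the identification of V with its dual by the
  polarization.\<close>

definition rot :: "complex^4 \<Rightarrow> complex^4" where
  "rot w = vector [- w$3, - w$4, w$1, w$2]"

lemma inner_rot: "rot w \<bullet> z = Re (skew_form w z)"
  by (simp add: rot_def skew_form_def inner_vec_def sum_4 vector_4_components inner_complex_def)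

lemma rot_rot: "rot (rot w) = - w"
  by (simp add: rot_def vec4)

lemma linear_rot: "linear rot"
  by (rule linearI) (simp_all add: rot_def vec4)

lemma rot_neg: "rot (- w) = - rot w"
  by (rule linear_neg[OF linear_rot])

lemma gaussian_rational_iff_inner:
  "c \<in> gaussian_rational \<longleftrightarrow> (\<forall>b\<in>Basis. c \<bullet> b \<in> \<rat>)"
proof
  assume "c \<in> gaussian_rational"
  then show "\<forall>b\<in>Basis. c \<bullet> b \<in> \<rat>"
    by (auto elim!: Basis_complex_vec simp: gaussian_rational_def inner_axis inner_complex_def)
next
  assume *: "\<forall>b\<in>Basis. c \<bullet> b \<in> \<rat>"
  have "axis k 1 \<in> (Basis :: (complex^4) set)" "axis k \<i> \<in> (Basis :: (complex^4) set)" for k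
    by (auto simp: Basis_vec_def Basis_complex_def)
  then have "c \<bullet> axis k 1 \<in> \<rat>" "c \<bullet> axis k \<i> \<in> \<rat>" for k using * by auto
  then show "c \<in> gaussian_rational"
    by (simp add: gaussian_rational_def inner_axis inner_complex_def)
qed

lemma gaussian_rational_rot: "c \<in> gaussian_rational \<Longrightarrow> rot c \<in> gaussian_rational"
  by (simp add: gaussian_rational_def rot_def vector_4_components forall_4)

context spin_fourfold
begin

text \<open>
  The antilinear operators \<open>k i\<close> satisfy the Clifford relations of the form \<open>- q / 2\<close>. Twisting them on
  \<open>V \<oplus> V\<close> gives the relations of \<open>q\<close>, and even products still act diagonally.
\<close>

definition \<rho> :: "5 \<Rightarrow> (complex^4) \<times> (complex^4) \<Rightarrow> (complex^4) \<times> (complex^4)" where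
  "\<rho> i z = (- k i (snd z), 2 *\<^sub>R k i (fst z))"

lemma linear_\<rho>: "linear (\<rho> i)"
  by (rule linearI)
     (simp_all add: \<rho>_def linear_add[OF linear_k] linear_scale[OF linear_k] scaleR_add_right)

text \<open>The factor -2 compensates the -1/2 of the relations of \<open>k\<close>. Scaling an
  antilinear operator by a complex number multiplies its square by a nonnegative real, so such a
  rescaling on V alone could not change the sign.\<close>

lemma \<rho>_\<rho>: "\<rho> i (\<rho> j z) = ((- 2) *\<^sub>R k i (k j (fst z)), (- 2) *\<^sub>R k i (k j (snd z)))"
  by (simp add: \<rho>_def linear_neg[OF linear_k] linear_scale[OF linear_k])

lemma \<rho>_relation: "\<rho> i (\<rho> j z) + \<rho> j (\<rho> i z) = (2 * of_rat (T_Delta_gram \<Delta> $ i $ j)) *\<^sub>R z"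
proof -
  have "(- 2) *\<^sub>R k i (k j v) + (- 2) *\<^sub>R k j (k i v) = (2 * of_rat (T_Delta_gram \<Delta> $ i $ j)) *\<^sub>R v" for v
    unfolding scaleR_add_right[symmetric] k_k by simp
  then show ?thesis by (simp add: \<rho>_\<rho> prod_eq_iff)
qed

definition v\<^sub>0 :: "complex^4" where
  "v\<^sub>0 = (SOME v. v \<in> gaussian_rational \<and> pure_spinor v)"

lemma v\<^sub>0: "v\<^sub>0 \<in> gaussian_rational" "pure_spinor v\<^sub>0"
proof -
  have \<Delta>_rat: "1 / real \<Delta> \<in> \<rat>" by simp
  have "\<exists>v\<in>gaussian_rational. pure_spinor v"
  proof (rule pure_spinor_exists)
    show "axis 1 1 \<in> gaussian_rational" by (auto simp: gaussian_rational_def axis_def)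
    show "axis 1 1 \<noteq> (0 :: complex^4)" by (simp add: axis_eq_0_iff)
  qed (fact gaussian_rational_k gaussian_rational_\<kappa> gaussian_rational_add
      gaussian_rational_scaleR[OF \<Delta>_rat])+
  then have "\<exists>v. v \<in> gaussian_rational \<and> pure_spinor v" by auto
  from someI_ex[OF this] have "v\<^sub>0 \<in> gaussian_rational \<and> pure_spinor v\<^sub>0"
    unfolding v\<^sub>0_def .
  then show "v\<^sub>0 \<in> gaussian_rational" "pure_spinor v\<^sub>0" by auto
qed

lemma word_indep:
  assumes "(\<Sum>w\<in>set spinor_words. u w *\<^sub>R foldr \<rho> w (v\<^sub>0, k 3 v\<^sub>0)) = 0" and "w \<in> set spinor_words"
  shows "u w = 0"
proof -
  \<comment> \<open>A word of length two acts through -2 times the product of its operators, a word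
    of length four through 4 times it. The order is that of
    \<open>pure_spinor_faithful\<close>.\<close>
  define g where "g = (\<lambda>i. [u [], - 2 * u [4, 5], - 2 * u [1, 4], - 2 * u [1, 5],
    - 2 * u [2, 3], 4 * u [2, 3, 4, 5], 4 * u [2, 3, 1, 4], 4 * u [2, 3, 1, 5],
    - 2 * u [2, 1], - 2 * u [2, 4], - 2 * u [2, 5], 4 * u [2, 1, 4, 5],
    - 2 * u [3, 1], - 2 * u [3, 4], - 2 * u [3, 5], 4 * u [3, 1, 4, 5]] ! i)"
  have g: "g 0 = u []" "g 1 = - 2 * u [4, 5]" "g 2 = - 2 * u [1, 4]" "g 3 = - 2 * u [1, 5]"
    "g 4 = - 2 * u [2, 3]" "g 5 = 4 * u [2, 3, 4, 5]" "g 6 = 4 * u [2, 3, 1, 4]" "g 7 = 4 * u [2, 3, 1, 5]"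
    "g 8 = - 2 * u [2, 1]" "g 9 = - 2 * u [2, 4]" "g 10 = - 2 * u [2, 5]" "g 11 = 4 * u [2, 1, 4, 5]"
    "g 12 = - 2 * u [3, 1]" "g 13 = - 2 * u [3, 4]" "g 14 = - 2 * u [3, 5]" "g 15 = 4 * u [3, 1, 4, 5]"
    by (simp_all add: g_def)
  have sum: "(\<Sum>w\<leftarrow>spinor_words. u w *\<^sub>R foldr \<rho> w (v\<^sub>0, k 3 v\<^sub>0)) = 0"
    using assms(1) by (simp add: sum.distinct_set_conv_list[OF distinct_spinor_words])
  have comp: "(\<Sum>w\<leftarrow>spinor_words. u w *\<^sub>R foldr \<rho> w z) =
     (let X = \<lambda>v. g 0 *\<^sub>R v + g 1 *\<^sub>R k 4 (k 5 v) + g 2 *\<^sub>R k 1 (k 4 v) + g 3 *\<^sub>R k 1 (k 5 v)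
    + g 4 *\<^sub>R k 2 (k 3 v) + g 5 *\<^sub>R k 2 (k 3 (k 4 (k 5 v))) + g 6 *\<^sub>R k 2 (k 3 (k 1 (k 4 v))) + g 7 *\<^sub>R k 2 (k 3 (k 1 (k 5 v)))
    + g 8 *\<^sub>R k 2 (k 1 v) + g 9 *\<^sub>R k 2 (k 4 v) + g 10 *\<^sub>R k 2 (k 5 v) + g 11 *\<^sub>R k 2 (k 1 (k 4 (k 5 v)))
    + g 12 *\<^sub>R k 3 (k 1 v) + g 13 *\<^sub>R k 3 (k 4 v) + g 14 *\<^sub>R k 3 (k 5 v) + g 15 *\<^sub>R k 3 (k 1 (k 4 (k 5 v)))
     in (X (fst z), X (snd z)))" for z
    unfolding g
    by (cases z) (simp add: spinor_words_def \<rho>_\<rho> linear_scale[OF linear_k] linear_neg[OF linear_k] Let_def algebra_simps)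
  have "\<forall>i<16. g i = 0"
    using sum unfolding comp Let_def
    by (intro pure_spinor_faithful[OF v\<^sub>0(2)]) (simp_all add: zero_prod_def)
  then have "g 0 = 0" "g 1 = 0" "g 2 = 0" "g 3 = 0" "g 4 = 0" "g 5 = 0" "g 6 = 0" "g 7 = 0"
    "g 8 = 0" "g 9 = 0" "g 10 = 0" "g 11 = 0" "g 12 = 0" "g 13 = 0" "g 14 = 0" "g 15 = 0"
    by (simp_all del: One_nat_def)
  then show ?thesis
    using assms(2) unfolding g spinor_words_def by auto
qed

sublocale clifford_module "T_Delta_gram \<Delta>" \<rho> "(v\<^sub>0, k 3 v\<^sub>0)" "[2, 3, 1, 4, 5]"
proof (rule clifford_module.intro)
  let ?R = "{z. fst z \<in> gaussian_rational \<and> snd z \<in> gaussian_rational}"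
  have "\<rho> i z \<in> ?R" if "z \<in> ?R" for i z
    using that gaussian_rational_scaleR[of "-1" "k i (snd z)"]
    by (simp add: \<rho>_def gaussian_rational_k gaussian_rational_scaleR)
  then have R: "foldr \<rho> w (v\<^sub>0, k 3 v\<^sub>0) \<in> ?R" for w
    by (induction w) (simp_all add: v\<^sub>0 gaussian_rational_k)
  show "foldr \<rho> w (v\<^sub>0, k 3 v\<^sub>0) \<bullet> b \<in> \<rat>" if "b \<in> Basis" for w b
    using R[of w] that by (auto simp: Basis_prod_def inner_prod_def gaussian_rational_iff_inner)
  show "card {w \<in> set (subseqs [2, 3, 1, 4, 5 :: 5]). even (length w)} = DIM((complex^4) \<times> (complex^4))"
    unfolding even_subseqs_5 distinct_card[OF distinct_spinor_words] by (simp add: spinor_words_def)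
  show "u w = 0"
    if "(\<Sum>w | w \<in> set (subseqs [2, 3, 1, 4, 5]) \<and> even (length w). u w *\<^sub>R foldr \<rho> w (v\<^sub>0, k 3 v\<^sub>0)) = 0"
      and "w \<in> set (subseqs [2, 3, 1, 4, 5])" "even (length w)" for u w
    using word_indep[of u w] that unfolding even_subseqs_5[symmetric] by simp
qed (simp_all only: transpose_T_Delta_gram linear_\<rho> \<rho>_relation, simp add: UNIV_5, blast)

lemma eval_f_g: "tensor_eval \<rho> (tensor_vec f * tensor_vec g) z = (- J (fst z), - J (snd z))"
proof -
  have vec: "tensor_eval \<rho> (tensor_vec h) z = (- spin (comb_e h) (snd z), 2 *\<^sub>R spin (comb_e h) (fst z))" for h z
    unfolding tensor_eval_vec spin_comb_e
    by (simp add: \<rho>_def prod_eq_iff fst_sum snd_sum sum_negf scaleR_sum_right mult.commute)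
  show ?thesis
    unfolding tensor_eval_mult[of \<rho>, OF linear_\<rho>] vec J_eq[symmetric]
    by (simp add: linear_neg[OF linear_spin] linear_scale[OF linear_spin] scaleR_eq_smult spin_smult)
qed

end

section \<open>The quaternion algebra and the isogeny\<close>

context spin_fourfold
begin

text \<open>The first generator acts as the scalar \<open>\<i>\<close>, the second as
  \<open>\<kappa>\<close>. They anticommute because \<open>\<kappa>\<close> is antilinear, and
  \<open>\<kappa>\<close> commutes with \<open>J\<close> by \<open>\<kappa>_J\<close>.\<close>

definition quat_action :: "rat^4 \<Rightarrow> complex^4 \<Rightarrow> complex^4" where
  "quat_action x c = Complex (of_rat (x$1)) (of_rat (x$2)) *s c + Complex (of_rat (x$3)) (of_rat (x$4)) *s \<kappa> c"

lemma \<kappa>_add: "\<kappa> (c + d) = \<kappa> c + \<kappa> d"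
  and \<kappa>_smult: "\<kappa> (z *s c) = cnj z *s \<kappa> c"
  by (simp_all add: \<kappa>_def spin_add spin_smult)

lemma linear_quat_action: "linear (quat_action x)"
  by (rule linearI)
     (simp_all add: quat_action_def \<kappa>_add scaleR_eq_smult \<kappa>_smult vec_eq_iff algebra_simps)

lemma J_smult: "J (z *s c) = z *s J c"
proof -
  have z: "z *s c = Re z *\<^sub>R c + Im z *\<^sub>R (\<i> *s c)" for c :: "complex^4"
    by (simp add: vec_eq_iff complex_eq_iff)
  show ?thesis
    unfolding z[of c] z[of "J c"] by (simp add: linear_add[OF linear_J] linear_scale[OF linear_J] J_ii)
qed

lemma quat_action_J: "quat_action x (J c) = J (quat_action x c)"
  by (simp add: quat_action_def linear_add[OF linear_J] J_smult \<kappa>_J)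

lemma quat_action_rational: "c \<in> gaussian_rational \<Longrightarrow> quat_action x c \<in> gaussian_rational"
  using gaussian_rational_\<kappa>[of c] by (simp add: quat_action_def gaussian_rational_def)

lemma quat_action_mult:
  "quat_action (quat_mult (-1) (of_nat \<Delta>) x z) c = quat_action x (quat_action z c)"
  by (simp add: quat_action_def quat_mult_def vector_4_components \<kappa>_add \<kappa>_smult \<kappa>_\<kappa> scaleR_eq_smult
      vec_eq_iff complex_eq_iff of_rat_add of_rat_mult of_rat_diff of_rat_minus algebra_simps)

text \<open>Comparing the values at a vector and at \<open>\<i>\<close> times this vector separates
  the complex linear part from the antilinear one.\<close>

lemma quat_action_faithful:
  assumes 0: "\<And>c. quat_action x c = 0"
  shows "x = 0"
proof -
  let ?z = "Complex (of_rat (x$1)) (of_rat (x$2))" and ?w = "Complex (of_rat (x$3)) (of_rat (x$4))"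
  let ?c = "axis 1 1 :: complex^4"
  have 1: "?z *s ?c + ?w *s \<kappa> ?c = 0" using 0[of ?c] by (simp add: quat_action_def)
  have "\<i> *s (?z *s ?c - ?w *s \<kappa> ?c) = quat_action x (\<i> *s ?c)"
    by (simp add: quat_action_def \<kappa>_smult vec_eq_iff algebra_simps)
  then have "?z *s ?c - ?w *s \<kappa> ?c = 0" using 0[of "\<i> *s ?c"] by (simp add: vec_eq_iff)
  with 1 have zw: "?z *s ?c = 0" "?w *s \<kappa> ?c = 0" by (auto simp: vec_eq_iff)
  have c: "?c \<noteq> 0" by (simp add: axis_eq_0_iff)
  have "\<kappa> ?c \<noteq> 0"
  proof
    assume "\<kappa> ?c = 0"
    then have "\<kappa> (\<kappa> ?c) = 0" by (simp add: linear_0[OF linear_\<kappa>])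
    then show False using c \<Delta> by (simp add: \<kappa>_\<kappa>)
  qed
  then have "?z = 0" "?w = 0" using zw c by (auto simp: vector_mul_eq_0)
  then show ?thesis by (simp add: vec_eq_iff forall_4 complex_eq_iff)
qed

lemma quaternion_embeds: "quaternion_embeds_End_Q (-1) (of_nat \<Delta>) A"
  unfolding quaternion_embeds_End_Q_def
proof (intro exI conjI allI ballI impI)
  let ?\<Psi> = "\<lambda>x v. comb (quat_action x (coord v))"
  show "?\<Psi> x \<in> torus_End_Q A" for x
    by (rule torus_End_Q_comb[OF linear_quat_action quat_action_rational quat_action_J])
  have lin: "comb (c + d) = comb c + comb d" for c d by (rule linear_add[OF linear_comb])
  show "x = 0" if "\<forall>v\<in>tspace A. ?\<Psi> x v = 0" for x
  proof (rule quat_action_faithful)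
    fix c
    have "comb (quat_action x c) = comb 0"
      using that[THEN bspec, OF comb_in_tspace[of c]] by (simp add: linear_0[OF linear_comb])
    then show "quat_action x c = 0" by (simp only: comb_eq_iff)
  qed
  fix v assume "v \<in> tspace A"
  then have v: "comb (coord v) = v" by (rule comb_coord)
  have "quat_action (axis 1 1) (coord v) = coord v"
    by (simp add: quat_action_def axis_def flip: one_complex.code zero_complex.code)
  then show "?\<Psi> (axis 1 1) v = v" by (simp only: v)
  show "?\<Psi> (x + z) v = ?\<Psi> x v + ?\<Psi> z v" for x z
    unfolding lin[symmetric] comb_eq_iff
    by (simp add: quat_action_def vec_eq_iff complex_eq_iff of_rat_add algebra_simps)
  show "?\<Psi> (r *s x) v = of_rat r *\<^sub>R ?\<Psi> x v" for r x
    unfolding linear_scale[OF linear_comb, symmetric] comb_eq_iff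
    by (simp add: quat_action_def vec_eq_iff complex_eq_iff of_rat_mult algebra_simps)
  show "?\<Psi> (quat_mult (-1) (of_nat \<Delta>) x z) v = ?\<Psi> x (?\<Psi> z v)" for x z
    by (simp add: quat_action_mult)
qed

text \<open>The pair \<open>w\<close> of vectors that represents the functional through the
  polarization instead of the inner product: \<open>- rot\<close> is the inverse of
  \<open>rot\<close>.\<close>

definition period_vector ::
  "(5 tensor set \<Rightarrow> real) \<Rightarrow> (complex^4) \<times> (complex^4)" where
  "period_vector \<phi> = (- rot (fst (vector_of \<phi>)), - rot (snd (vector_of \<phi>)))"

lemma linear_period_vector: "linear period_vector"
  by (rule linearI)
     (simp_all add: period_vector_def linear_add[OF linear_vector_of] linear_scale[OF linear_vector_of]
       linear_add[OF linear_rot] linear_scale[OF linear_rot])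

lemma inj_on_period_vector: "inj_on period_vector (clifford_even_dual (T_Delta_gram \<Delta>))"
proof (rule inj_onI)
  fix \<phi> \<psi> assume *: "\<phi> \<in> clifford_even_dual (T_Delta_gram \<Delta>)" "\<psi> \<in> clifford_even_dual (T_Delta_gram \<Delta>)"
    "period_vector \<phi> = period_vector \<psi>"
  then have "rot (rot (fst (vector_of \<phi>))) = rot (rot (fst (vector_of \<psi>)))"
    "rot (rot (snd (vector_of \<phi>))) = rot (rot (snd (vector_of \<psi>)))"
    by (simp_all add: period_vector_def)
  then have eq: "vector_of \<phi> = vector_of \<psi>" by (simp add: rot_rot prod_eq_iff)
  have "\<phi> = functional (vector_of \<phi>)" by (rule functional_vector_of[OF *(1), symmetric])
  also have "\<dots> = \<psi>" unfolding eq by (rule functional_vector_of[OF *(2)])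
  finally show "\<phi> = \<psi>" .
qed

lemma period_vector_surj:
  "\<exists>\<phi>\<in>clifford_even_dual (T_Delta_gram \<Delta>). period_vector \<phi> = z"
  by (rule bexI[OF _ functional_in_dual[of "(rot (fst z), rot (snd z))"]])
     (simp add: period_vector_def vector_of_functional rot_rot)

text \<open>
  The functional \<open>x \<mapsto> E(w, x v)\<close> is sent by the transpose of \<open>f\<^sub>1 f\<^sub>2\<close>, which acts as \<open>- J\<close>, to the
  one of \<open>J w\<close>, because \<open>J\<close> is an isometry for \<open>E\<close>.
\<close>

lemma period_vector_cstr:
  assumes \<phi>: "\<phi> \<in> clifford_even_dual (T_Delta_gram \<Delta>)"
  shows "period_vector (\<lambda>X. if X \<in> clifford_even (T_Delta_gram \<Delta>)
      then \<phi> (clifford_class (T_Delta_gram \<Delta>) (tensor_vec f * tensor_vec g) \<otimes>\<^bsub>clifford_ring (T_Delta_gram \<Delta>)\<^esub> X)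
      else 0) = map_prod J J (period_vector \<phi>)"
proof -
  let ?L = "\<lambda>x. (rot (J (- rot (fst x))), rot (J (- rot (snd x))))"
  have adj: "x \<bullet> - J z = rot (J (- rot x)) \<bullet> z" for x z
  proof -
    have "x \<bullet> - J z = rot (- rot x) \<bullet> - J z" by (simp add: rot_neg rot_rot)
    also have "\<dots> = - Re (skew_form (- rot x) (J z))" unfolding inner_minus_right inner_rot ..
    also have "\<dots> = - Re (skew_form (J (- rot x)) (J (J z)))" by (simp only: skew_form_J)
    also have "\<dots> = Re (skew_form (J (- rot x)) z)" by (simp add: J_J skew_form_def)
    finally show ?thesis by (simp only: inner_rot)
  qed
  have "x \<bullet> tensor_eval \<rho> (tensor_vec f * tensor_vec g) z = ?L x \<bullet> z" for x z
    unfolding eval_f_g inner_prod_def fst_conv snd_conv adj ..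
  from vector_of_left_mult[OF \<phi> tensor_even_vec_mult_vec this]
  show ?thesis
    by (simp add: period_vector_def rot_rot rot_neg)
qed

text \<open>The functionals in a finite basis of the lattice of \<open>K\<close> are rational on
  rational elements, so their period vectors are rational. A common denominator \<open>N\<close>
  turns the real isomorphism \<open>period_vector\<close> into a map between the lattices.\<close>

lemma isogenous_kuga_satake:
  assumes K: "complex_torus K" "tspace K = clifford_even_dual (T_Delta_gram \<Delta>)"
    and rat: "\<And>\<phi> X. \<phi> \<in> lat K \<Longrightarrow> X \<in> clifford_even_rational (T_Delta_gram \<Delta>) \<Longrightarrow> \<phi> X \<in> \<rat>"
    and cstr: "cstr K = (\<lambda>\<phi> X. if X \<in> clifford_even (T_Delta_gram \<Delta>)
      then \<phi> (clifford_class (T_Delta_gram \<Delta>) (tensor_vec f * tensor_vec g) \<otimes>\<^bsub>clifford_ring (T_Delta_gram \<Delta>)\<^esub> X)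
      else 0)"
  shows "isogenous K (torus_prod A A)"
proof -
  let ?Y = "torus_prod A A" and ?L = "gaussian_lattice \<times> gaussian_lattice"
  obtain B where B: "finite B" "lat K = int_span B"
    using K(1) by (auto simp: complex_torus_def)
  have B_lat: "b \<in> lat K" if "b \<in> B" for b
    using int_span_base[OF B(1) that] by (simp only: B(2))
  have rational: "fst (period_vector b) \<in> gaussian_rational \<and> snd (period_vector b) \<in> gaussian_rational"
    if "b \<in> B" for b
  proof -
    have *: "vector_of b \<bullet> c \<in> \<rat>" if "c \<in> Basis" for c
      using vector_of_rational[OF rat[OF B_lat[OF \<open>b \<in> B\<close>]] that] .
    have "fst (vector_of b) \<bullet> c \<in> \<rat>" "snd (vector_of b) \<bullet> c \<in> \<rat>" if "c \<in> Basis" for c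
      using *[of "(c, 0)"] *[of "(0, c)"] that by (simp_all add: Basis_prod_def inner_prod_def)
    then have "fst (vector_of b) \<in> gaussian_rational" "snd (vector_of b) \<in> gaussian_rational"
      by (simp_all add: gaussian_rational_iff_inner)
    then show ?thesis
      using gaussian_rational_scaleR[OF _ gaussian_rational_rot, of "-1"] by (simp add: period_vector_def)
  qed
  obtain N :: nat where N: "N > 0"
    "\<forall>c\<in>fst ` period_vector ` B \<union> snd ` period_vector ` B. real N *\<^sub>R c \<in> gaussian_lattice"
  proof -
    have "fst ` period_vector ` B \<union> snd ` period_vector ` B \<subseteq> gaussian_rational"
      using rational by auto
    then show ?thesis using gaussian_common_denominator[of "fst ` period_vector ` B \<union> snd ` period_vector ` B"] B(1) that
      by auto
  qed
  define h where "h \<phi> = map_prod comb comb (real N *\<^sub>R period_vector \<phi>)" for \<phi>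
  have "linear (map_prod comb comb)"
    by (rule linearI) (auto simp: linear_add[OF linear_comb] linear_scale[OF linear_comb])
  then have lin: "linear h"
    using linear_compose[OF linear_compose_scale_right[OF linear_period_vector]] by (simp add: h_def[abs_def] comp_def)
  have tspace: "tspace ?Y = tspace A \<times> tspace A"
    unfolding tspace_def torus_prod_def torus.simps
    using linear_0[OF linear_comb] gaussian_lattice_0
    by (intro span_Times_0) (auto simp: lat_eq image_iff intro!: bexI[of _ 0])
  have lat: "lat ?Y = map_prod comb comb ` ?L"
    by (auto simp: torus_prod_def lat_eq)
  have lat_diff: "v - w \<in> lat ?Y" if "v \<in> lat ?Y" "w \<in> lat ?Y" for v w
  proof -
    have "comb c - comb d \<in> lat A" if "c \<in> gaussian_lattice" "d \<in> gaussian_lattice" for c d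
    proof -
      have "c - d \<in> gaussian_lattice" using that by (simp add: gaussian_lattice_def)
      then show ?thesis by (simp add: lat_eq flip: linear_diff[OF linear_comb])
    qed
    then show ?thesis using that by (auto simp: torus_prod_def lat_eq)
  qed
  have hB: "real N *\<^sub>R period_vector b \<in> ?L" if "b \<in> B" for b
    using N(2) that by (auto simp: mem_Times_iff)
  have "real N *\<^sub>R period_vector \<phi> \<in> ?L" if \<phi>: "\<phi> \<in> lat K" for \<phi>
  proof -
    obtain n where n: "\<phi> = (\<Sum>b\<in>B. of_int (n b) *\<^sub>R b)" using \<phi> B(2) by (auto simp: int_span_def)
    have eq: "real N *\<^sub>R period_vector \<phi> = (\<Sum>b\<in>B. of_int (n b) *\<^sub>R (real N *\<^sub>R period_vector b))"
      unfolding n by (simp add: linear_sum[OF linear_period_vector] linear_scale[OF linear_period_vector]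
          scaleR_sum_right mult.commute)
    show ?thesis
      unfolding eq mem_Times_iff fst_sum snd_sum fst_scaleR snd_scaleR
      by (intro conjI gaussian_lattice_sum; rule gaussian_lattice_scaleR)
         (use hB in \<open>auto simp: mem_Times_iff\<close>)
  qed
  then have h_lat: "h ` lat K \<subseteq> lat ?Y" unfolding lat h_def by blast
  have hom: "h \<in> torus_hom K ?Y"
    unfolding torus_hom_def
  proof (intro CollectI conjI ballI lin h_lat)
    fix \<phi> assume "\<phi> \<in> tspace K"
    then have "period_vector (cstr K \<phi>) = map_prod J J (period_vector \<phi>)"
      unfolding cstr by (intro period_vector_cstr) (simp add: K(2))
    then show "h (cstr K \<phi>) = cstr ?Y (h \<phi>)"
      by (cases "period_vector \<phi>") (simp add: h_def torus_prod_def cstr_comb linear_scale[OF linear_J])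
  qed
  have "h ` tspace K = tspace ?Y"
  proof (rule subset_antisym)
    show "h ` tspace K \<subseteq> tspace ?Y"
      unfolding tspace by (auto simp: h_def map_prod_def split_beta)
    show "tspace ?Y \<subseteq> h ` tspace K"
    proof
      fix w assume "w \<in> tspace ?Y"
      then obtain c d where w: "w = (comb c, comb d)"
        unfolding tspace range_comb[symmetric] by auto
      obtain \<phi> where "\<phi> \<in> tspace K" "period_vector \<phi> = (1 / real N) *\<^sub>R (c, d)"
        using period_vector_surj[of "(1 / real N) *\<^sub>R (c, d)"] K(2) by auto
      then show "w \<in> h ` tspace K"
        using N(1) w by (intro image_eqI[of _ _ \<phi>]) (auto simp: h_def)
    qed
  qed
  moreover have "inj_on h (tspace K)"
  proof (rule inj_onI)
    fix \<phi> \<psi> assume *: "\<phi> \<in> tspace K" "\<psi> \<in> tspace K" "h \<phi> = h \<psi>"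
    then have "real N *\<^sub>R period_vector \<phi> = real N *\<^sub>R period_vector \<psi>"
      by (auto simp: h_def map_prod_def split_beta comb_eq_iff prod_eq_iff)
    then have "period_vector \<phi> = period_vector \<psi>" using N(1) by simp
    then show "\<phi> = \<psi>" using inj_on_period_vector *(1,2) unfolding K(2) by (auto dest: inj_onD)
  qed
  moreover have "linear (map_prod coord coord)"
    by (rule linearI) (auto simp: linear_add[OF linear_coord] linear_scale[OF linear_coord])
  moreover have "finite {w \<in> lat ?Y. norm (map_prod coord coord w) \<le> r}" for r
  proof (rule finite_subset)
    let ?F = "{c \<in> gaussian_lattice. norm c \<le> r}"
    show "{w \<in> lat ?Y. norm (map_prod coord coord w) \<le> r} \<subseteq> map_prod comb comb ` (?F \<times> ?F)"
    proof
      fix w assume "w \<in> {w \<in> lat ?Y. norm (map_prod coord coord w) \<le> r}"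
      then obtain c d where w: "w = map_prod comb comb (c, d)" "(c, d) \<in> ?L" "norm (c, d) \<le> r"
        unfolding lat by auto
      then have "(c, d) \<in> ?F \<times> ?F"
        using norm_fst_le[of c d] norm_snd_le[of d c] by auto
      then show "w \<in> map_prod comb comb ` (?F \<times> ?F)" unfolding w(1) by (rule imageI)
    qed
    show "finite (map_prod comb comb ` (?F \<times> ?F))"
      by (intro finite_imageI finite_cartesian_product finite_bounded_gaussian_lattice)
  qed
  ultimately have "isogeny K ?Y h"
    by (intro isogeny_if_bijective[where \<pi> = "map_prod coord coord", OF K(1) hom] lat_diff)
  then show ?thesis unfolding isogenous_def by blast
qed

end

section \<open>The theorem\<close>

theorem theorem4p5:
  fixes \<Delta> :: nat
    and H :: "nat \<Rightarrow> (complex^5) set"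
    and K :: "(5 tensor set \<Rightarrow> real) torus"
    and A :: "'v::real_vector torus"
    and E :: "'v \<Rightarrow> 'v \<Rightarrow> real"
    and \<iota> :: "'v \<Rightarrow> 'v"
    and \<beta> :: "'v^4"
    and \<sigma> :: "int^6^6"
    and y :: "rat^6"
  assumes "\<Delta> > 0"
    and "weight2_hodge_structure H"
    and "weight2_polarization (T_Delta_gram \<Delta>) H"
    and "hodge_numbers H = (1, 3, 1)"
    and "kuga_satake (T_Delta_gram \<Delta>) H K"
    and "gaussian_ppav4 A E \<iota>"
    and "adapted_basis A E \<iota> \<beta>"
    and "\<sigma> \<in> SO_star_T"
    and "y \<in> divisor_vectors \<Delta>"
    and "\<forall>z\<in>T_hodge A \<iota> \<beta> \<sigma> 2. gram_form T_gram (vmap of_rat y) z = 0"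
    and "\<exists>M. polarized_hodge_iso_onto M (T_Delta_gram \<Delta>) H T_gram (T_hodge A \<iota> \<beta> \<sigma>) (T_perp y)"
  shows "isogenous K (torus_prod A A) \<and> quaternion_embeds_End_Q (-1) (of_nat \<Delta>) A"
proof -
  let ?G = "T_Delta_gram \<Delta>"
  interpret A: gaussian_fourfold A E \<iota> \<beta>
    using assms(6,7) by (rule gaussian_fourfold.intro)
  obtain f g :: "real^5" and s where fgs: "s = 1 \<or> s = - 1" "gram_form ?G f f = s" "gram_form ?G g g = s"
      "gram_form ?G f g = 0" "(\<chi> k. Complex (f $ k) (g $ k)) \<in> H 0"
    and cstr: "cstr K = (\<lambda>\<phi> x. if x \<in> clifford_even ?G
          then \<phi> (clifford_class ?G (tensor_vec f * tensor_vec g) \<otimes>\<^bsub>clifford_ring ?G\<^esub> x) else 0)"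
    and K: "complex_torus K" "tspace K = clifford_even_dual ?G"
      "\<forall>\<phi>\<in>lat K. \<forall>x\<in>clifford_even_rational ?G. \<phi> x \<in> \<rat>"
    using assms(5) unfolding kuga_satake_def by blast
  obtain M where M: "bij_betw ((*v) M) UNIV (T_perp y)"
    "\<And>x z :: rat^5. gram_form T_gram (M *v x) (M *v z) = gram_form ?G x z"
    "(*v) (map_matrix of_rat M) ` H 0 = T_hodge A \<iota> \<beta> \<sigma> 0 \<inter> vec.span (vmap of_rat ` T_perp y)"
    using assms(11) unfolding polarized_hodge_iso_onto_def by (metis zero_le)
  define w :: "complex^5" where "w = (\<chi> k. Complex (f $ k) (g $ k))"
  define \<sigma>' :: "rat^6^6" where "\<sigma>' = map_matrix of_int \<sigma>"
  \<comment> \<open>\<open>T_hodge\<close> is a pullback by \<open>\<sigma>\<close>. Moving the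
    frame and \<open>y\<close> forward by \<open>\<sigma>'\<close> expresses all conditions by the
    period plane of \<open>A\<close> itself.\<close>
  define N where "N = \<sigma>' ** M"
  have \<sigma>: "gram_form T_gram (\<sigma>' *v x) (\<sigma>' *v z) = gram_form T_gram x z" for x z :: "rat^6"
    using assms(8) by (simp add: SO_star_T_def \<sigma>'_def)
  note \<sigma>_complex = gram_form_isometry[of T_gram \<sigma>' T_gram, OF \<sigma>]
  have N: "gram_form T_gram (N *v x) (N *v z) = gram_form ?G x z" for x z :: "rat^5"
    by (simp add: N_def \<sigma> M(2) flip: matrix_vector_mul_assoc)
  have y: "gram_form T_gram y y = - 2 * of_nat \<Delta>"
    using assms(9) by (auto simp: divisor_vectors_def)

  \<comment> \<open>The vector \<open>w\<close> lies in the piece \<open>H 0\<close>, where the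
    polarization is positive, and its hermitian square is twice \<open>s\<close>.\<close>
  have s: "s = 1"
  proof -
    have w: "w = vmap of_real f + \<i> *s vmap of_real g"
      and cnj_w: "vmap cnj w = vmap of_real f + (- \<i>) *s vmap of_real g"
      by (simp_all add: w_def vmap_def vec_eq_iff complex_eq_iff)
    have of_real: "gram_form ?G (vmap of_real x) (vmap of_real z) = complex_of_real (gram_form ?G x z)"
      for x z :: "real^5"
      by (simp add: gram_form_def vmap_def complex_of_rat)
    have "gram_form ?G w (vmap cnj w) = of_real (2 * s)"
      unfolding cnj_w unfolding w gram_form_add_left gram_form_add_right gram_form_smult of_real
      using fgs(2-4) gram_form_commute[OF transpose_T_Delta_gram, of \<Delta> g f] by simp
    moreover have "w \<noteq> 0"
    proof
      assume "w = 0"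
      then have "f $ k = 0" for k by (simp add: w_def vec_eq_iff complex_eq_iff)
      then have "gram_form ?G f f = 0" by (simp add: gram_form_def)
      then show False using fgs(1,2) by auto
    qed
    moreover have "\<forall>p\<le>2. \<forall>x\<in>H p. x \<noteq> 0 \<longrightarrow> (- 1) ^ p * Re (gram_form ?G x (vmap cnj x)) > 0"
      using assms(3) unfolding weight2_polarization_def by (elim conjE)
    note this[rule_format, of 0 w]
    ultimately have "0 < 2 * s"
      using fgs(5) by (simp add: w_def[symmetric])
    then show ?thesis using fgs(1) by auto
  qed

  have hodge: "T_iso (\<Sum>i\<in>UNIV. Complex (f $ i) (g $ i) *s vmap of_rat (N *v axis i 1))
      \<in> wedge_span (skew_perp A.plane) (skew_perp A.plane)"
  proof -
    have "map_matrix of_rat M *v w \<in> T_hodge A \<iota> \<beta> \<sigma> 0"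
      using M(3) fgs(5) unfolding w_def by blast
    moreover have "map_matrix of_int \<sigma> *v (map_matrix of_rat M *v w) = map_matrix of_rat N *v w"
      unfolding N_def \<sigma>'_def map_matrix_of_rat_mult matrix_vector_mul_assoc map_matrix_of_int[symmetric] ..
    moreover have "map_matrix of_rat N *v w = (\<Sum>i\<in>UNIV. Complex (f $ i) (g $ i) *s vmap of_rat (N *v axis i 1))"
      unfolding map_matrix_of_rat_mult_vec by (simp add: w_def)
    ultimately show ?thesis
      by (simp add: T_hodge_def wedge_hodge_def A.period_plane_eq)
  qed

  have perp: "wedge_g (T_iso (vmap of_rat (\<sigma>' *v y))) (wedge c d) = 0" if cd: "c \<in> A.plane" "d \<in> A.plane" for c d
  proof -
    let ?S = "\<lambda>z. T_iso (map_matrix of_rat \<sigma>' *v z)"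
    have lin: "Vector_Spaces.linear (*s) (*s) ?S"
      by unfold_locales (simp_all add: matrix_vector_right_distrib T_iso_add T_iso_smult vector_scalar_commute)
    have det: "wedge_det (?S z) (?S x) = gram_form T_gram z x" for z x
      by (simp add: wedge_det_T_iso \<sigma>_complex)
    have inj: "inj ?S"
    proof (rule injI)
      fix z z' assume eq: "?S z = ?S z'"
      have "gram_form T_gram (z + (- 1) *s z') x = 0" for x
        unfolding gram_form_add_left gram_form_smult det[symmetric] eq by simp
      then have "z + (- 1) *s z' = 0" by (rule T_gram_nondegenerate)
      then show "z = z'" by (simp add: vec_eq_iff)
    qed
    \<comment> \<open>The hypothesis on \<open>y\<close> concerns points of the complexified T, so
      \<open>wedge c d\<close> has to be written as the image of such a point. Nondegeneracy of the
      form gave injectivity, and the dimensions agree.\<close>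
    have "surj ?S" by (rule vec.linear_injective_imp_surjective[OF lin inj refl])
    then obtain z where z: "wedge c d = ?S z" by (rule surjE)
    have "wedge c d \<in> wedge_hodge A.plane 2"
      unfolding wedge_hodge_def wedge_span_def using cd by (auto intro!: vec.span_base)
    then have "z \<in> T_hodge A \<iota> \<beta> \<sigma> 2"
      by (simp add: T_hodge_def A.period_plane_eq z map_matrix_of_int[of \<sigma>, where ?'a = complex] \<sigma>'_def)
    then have "gram_form T_gram (vmap of_rat y) z = 0" using assms(10) by blast
    then have "wedge_det (T_iso (vmap of_rat (\<sigma>' *v y))) (wedge c d) = 0"
      unfolding z map_matrix_of_rat_vmap[symmetric] det .
    \<comment> \<open>A real vector of T goes to a fixed point of \<open>wedge_t\<close>, so
      vanishing of the determinant pairing becomes vanishing of the hermitian form.\<close>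
    moreover have "vmap cnj (vmap of_rat x) = vmap of_rat x" for x :: "rat^6"
      by (simp add: vmap_def complex_of_rat)
    ultimately have 0: "wedge_g (wedge c d) (T_iso (vmap of_rat (\<sigma>' *v y))) = 0"
      by (simp add: wedge_g_eq_wedge_det wedge_t_T_iso)
    have hermitian: "wedge_g x u = cnj (wedge_g u x)" for x u
      by (simp add: wedge_g_def algebra_simps)
    show ?thesis unfolding hermitian[of "T_iso _"] 0 by simp
  qed

  interpret spin_fourfold A E \<iota> \<beta> \<Delta> "\<lambda>i. N *v axis i 1" "\<sigma>' *v y" f g
  proof
    show "gram_form T_gram (N *v axis i 1) (N *v axis j 1) = ?G $ i $ j" for i j
      unfolding N gram_form_axis by simp
    show "gram_form T_gram (N *v axis i 1) (\<sigma>' *v y) = 0" for i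
    proof -
      have "M *v axis i 1 \<in> T_perp y" using M(1) by (auto simp: bij_betw_def)
      then show ?thesis
        by (simp add: N_def T_perp_def \<sigma> gram_form_commute[OF transpose_T_gram, of _ y]
            flip: matrix_vector_mul_assoc)
    qed
    show "gram_form T_gram (\<sigma>' *v y) (\<sigma>' *v y) = - 2 * of_nat \<Delta>" by (simp add: \<sigma> y)
  qed (use assms(1) fgs s hodge perp in simp_all)
  show ?thesis
    using isogenous_kuga_satake[OF K(1,2) _ cstr] K(3) quaternion_embeds by blast
qed

end
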